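(* Let $\widehat{M}=M/\mathbb{Z}_3$ be the $8$-dimensional orbifold, and $\alpha_i,\beta_i,\gamma_i$ ($i=1,2$) the $1$-forms on $M$, described in the context. The $2$-forms $\gamma_1\wedge\gamma_2$, $\beta_1\wedge\beta_2$ and $\alpha_1\wedge\gamma_1+\alpha_2\wedge\gamma_1+\alpha_2\wedge\gamma_2$ on $M$ are closed and $\mathbb{Z}_3$-invariant, hence are regarded as orbifold forms on $\widehat{M}$. The quadruple Massey product $$\langle [\gamma_1\wedge\gamma_2],\,[\beta_1\wedge\beta_2],\,[\beta_1\wedge\beta_2],\,[\alpha_1\wedge\gamma_1+\alpha_2\wedge\gamma_1+\alpha_2\wedge\gamma_2]\rangle$$ is non-trivial on $\widehat{M}$ (that is, it is defined and does not contain $0$). Therefore, the space $\widehat{M}$ is non-formal.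
   Context: The manifold $M$. Let $G=\mathbb{R}^6$ with coordinates $(y_1,y_2,z_1,z_2,v_1,v_2)$ and the nilpotent Lie group multiplication $$(y_1',y_2',z_1',z_2',v_1',v_2')\cdot(y_1,y_2,z_1,z_2,v_1,v_2)=\big(y_1+y_1',\,y_2+y_2',\,z_1+z_1',\,z_2+z_2',\,v_1+v_1'+(y_1'-y_2')z_1-(y_1'+2y_2')z_2,\,v_2+v_2'-(2y_1'+y_2')z_1+(y_2'-y_1')z_2\big).$$ Let $\Gamma=\{(y_1,y_2,z_1,z_2,v_1,v_2)\in\mathbb{Z}^6 : v_1\equiv v_2 \pmod 3\}$, a discrete subgroup of $G$, and let $N=\Gamma\backslash G$ (a compact nilmanifold). Let $T^2=\mathbb{Z}^2\backslash\mathbb{R}^2$ with coordinates $(x_1,x_2)$, and $M=T^2\times N$, a compact $8$-dimensional nilmanifold. The following $1$-forms descend to $M$ and form a basis of the left invariant $1$-forms: $\alpha_i=dx_i$, $\beta_i=dy_i$, $\gamma_i=dz_i$ ($i=1,2$), $\eta_1=dv_1-y_1dz_1+y_2dz_1+y_1dz_2+2y_2dz_2$, $\eta_2=dv_2+2y_1dz_1+y_2dz_1+y_1dz_2-y_2dz_2$. The forms $\alpha_i,\beta_i,\gamma_i$ are closed, and $d\eta_1=-\beta_1\wedge\gamma_1+\beta_2\wedge\gamma_1+\beta_1\wedge\gamma_2+2\beta_2\wedge\gamma_2$, $d\eta_2=2\beta_1\wedge\gamma_1+\beta_2\wedge\gamma_1+\beta_1\wedge\gamma_2-\beta_2\wedge\gamma_2$.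 The action. The map $$\rho(x_1,x_2,y_1,y_2,z_1,z_2,v_1,v_2)=(-x_1-x_2,\,x_1,\,-y_1-y_2,\,y_1,\,-z_1-z_2,\,z_1,\,-v_1-v_2,\,v_1)$$ is an automorphism of order $3$ of the Lie group $\mathbb{R}^2\times G$ preserving $\mathbb{Z}^2\times\Gamma$, so it induces a diffeomorphism $\rho:M\to M$ generating an action of $\mathbb{Z}_3$ on $M$, which is free away from finitely many fixed points. The orbifold is $\widehat{M}=M/\mathbb{Z}_3$. Its algebra of orbifold differential forms $\Omega^*_{\mathrm{orb}}(\widehat{M})$ is identified with the algebra $\Omega^*(M)^{\mathbb{Z}_3}$ of $\mathbb{Z}_3$-invariant forms on $M$; its cohomology is $H^*(\widehat{M})=H^*(M)^{\mathbb{Z}_3}$ (real coefficients). Massey products. For $t\ge 3$ and classes $a_i\in H^{p_i}(\widehat{M})$, $1\le i\le t$, the Massey product $\langle a_1,\dots,a_t\rangle$ is defined if there are orbifold forms $\alpha_{i,j}$ on $\widehat{M}$, for $1\le i\le j\le t$ with $(i,j)\ne(1,t)$, such that $a_i=[\alpha_{i,i}]$ and $d\alpha_{i,j}=\sum_{k=i}^{j-1}\bar\alpha_{i,k}\wedge\alpha_{k+1,j}$, where $\bar\alpha=(-1)^{\deg\alpha}\alpha$. In that case $\langle a_1,\dots,a_t\rangle\subset H^{p_1+\cdots+p_t-(t-2)}(\widehat{M})$ is the set of all classes $\big[\sum_{k=1}^{t-1}\bar\alpha_{1,k}\wedge\alpha_{k+1,t}\big]$ for all such choices of $\alpha_{i,j}$.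 The Massey product is trivial if $0\in\langle a_1,\dots,a_t\rangle$; it is non-trivial if it is defined and not trivial. Formality. $\widehat{M}$ is formal if $(\Omega^*_{\mathrm{orb}}(\widehat{M}),d)$ is connected to $(H^*(\widehat{M}),0)$ by a chain (zig-zag) of quasi-isomorphisms of commutative differential graded algebras; otherwise it is non-formal. *)

theory Defs
  imports
    "HOL-Analysis.Analysis"
    "HOL-Library.Function_Algebras"
    "HOL-Algebra.Module"
    "HOL-Algebra.QuotRing"
begin

section \<open>Commutative differential graded algebras over the reals\<close>

definition real_ring :: "real ring" where
  "real_ring = \<lparr>carrier = UNIV, mult = (*), one = 1, zero = 0, add = (+)\<rparr>"

record 'a dga = "(real, 'a) module" +
  hcomp :: "nat \<Rightarrow> 'a set"
  differential :: "'a \<Rightarrow> 'a"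

locale cdga = ring A + module real_ring A for A :: "'a dga" (structure) +
  assumes smult_mult_left: "\<lbrakk>x \<in> carrier A; y \<in> carrier A\<rbrakk> \<Longrightarrow> (r \<odot> x) \<otimes> y = r \<odot> (x \<otimes> y)"
    and smult_mult_right: "\<lbrakk>x \<in> carrier A; y \<in> carrier A\<rbrakk> \<Longrightarrow> x \<otimes> (r \<odot> y) = r \<odot> (x \<otimes> y)"
    and hcomp_submodule: "submodule (hcomp A k) real_ring A"
    and hcomp_direct_sum: "x \<in> carrier A \<Longrightarrow>
      \<exists>!f. (\<forall>k. f k \<in> hcomp A k) \<and> finite {k. f k \<noteq> \<zero>} \<and> x = (\<Oplus>k\<in>{k. f k \<noteq> \<zero>}. f k)"
    and one_hcomp: "\<one> \<in> hcomp A 0"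
    and mult_hcomp: "\<lbrakk>x \<in> hcomp A i; y \<in> hcomp A j\<rbrakk> \<Longrightarrow> x \<otimes> y \<in> hcomp A (i + j)"
    and graded_commute: "\<lbrakk>x \<in> hcomp A i; y \<in> hcomp A j\<rbrakk> \<Longrightarrow> x \<otimes> y = (- 1) ^ (i * j) \<odot> (y \<otimes> x)"
    and differential_add: "\<lbrakk>x \<in> carrier A; y \<in> carrier A\<rbrakk> \<Longrightarrow>
      differential A (x \<oplus> y) = differential A x \<oplus> differential A y"
    and differential_smult: "x \<in> carrier A \<Longrightarrow> differential A (r \<odot> x) = r \<odot> differential A x"
    and differential_hcomp: "x \<in> hcomp A k \<Longrightarrow> differential A x \<in> hcomp A (Suc k)"
    and differential_differential: "x \<in> carrier A \<Longrightarrow> differential A (differential A x) = \<zero>"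
    and leibniz: "\<lbrakk>x \<in> hcomp A i; y \<in> carrier A\<rbrakk> \<Longrightarrow>
      differential A (x \<otimes> y) = differential A x \<otimes> y \<oplus> (- 1) ^ i \<odot> (x \<otimes> differential A y)"

definition cocycles :: "'a dga \<Rightarrow> 'a set" where
  "cocycles A = {x \<in> carrier A. differential A x = \<zero>\<^bsub>A\<^esub>}"

definition coboundaries :: "'a dga \<Rightarrow> 'a set" where
  "coboundaries A = differential A ` carrier A"

definition cohomology_class :: "'a dga \<Rightarrow> 'a \<Rightarrow> 'a set" where
  "cohomology_class A x = coboundaries A +>\<^bsub>A\<^esub> x"

text \<open>The cohomology algebra is the quotient ring of the cocycles by the ideal of
  coboundaries, regarded as a differential graded algebra with zero differential.\<close>

definition cohomology :: "'a dga \<Rightarrow> 'a set dga" where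
  "cohomology A = (let Q = (A\<lparr>carrier := cocycles A\<rparr>) Quot coboundaries A in
    \<lparr>carrier = carrier Q, mult = mult Q, one = one Q, zero = zero Q, add = add Q,
     smult = (\<lambda>r U. \<Union>x\<in>U. cohomology_class A (r \<odot>\<^bsub>A\<^esub> x)),
     hcomp = (\<lambda>k. cohomology_class A ` (cocycles A \<inter> hcomp A k)),
     differential = (\<lambda>_. zero Q)\<rparr>)"

definition dga_hom :: "'a dga \<Rightarrow> 'b dga \<Rightarrow> ('a \<Rightarrow> 'b) set" where
  "dga_hom A B = {f \<in> ring_hom A B.
     (\<forall>r. \<forall>x\<in>carrier A. f (r \<odot>\<^bsub>A\<^esub> x) = r \<odot>\<^bsub>B\<^esub> f x) \<and>
     (\<forall>k. f ` hcomp A k \<subseteq> hcomp B k) \<and>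
     (\<forall>x\<in>carrier A. f (differential A x) = differential B (f x))}"

definition cohomology_map :: "'a dga \<Rightarrow> 'b dga \<Rightarrow> ('a \<Rightarrow> 'b) \<Rightarrow> 'a set \<Rightarrow> 'b set" where
  "cohomology_map A B f U = (\<Union>x\<in>U. cohomology_class B (f x))"

definition quasi_isomorphism :: "'a dga \<Rightarrow> 'b dga \<Rightarrow> ('a \<Rightarrow> 'b) \<Rightarrow> bool" where
  "quasi_isomorphism A B f \<longleftrightarrow> f \<in> dga_hom A B \<and>
     bij_betw (cohomology_map A B f) (carrier (cohomology A)) (carrier (cohomology B))"

definition quasi_linked :: "'a dga \<Rightarrow> 'b dga \<Rightarrow> bool" where
  "quasi_linked A B \<longleftrightarrow> (\<exists>f. quasi_isomorphism A B f) \<or> (\<exists>g. quasi_isomorphism B A g)"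

text \<open>A formula cannot quantify over types, so the type of the intermediate algebras of a
  zig-zag is a parameter. The finitely many algebras of an arbitrary zig-zag can be transported
  into one type (such as the disjoint sum of their types), so non-formality in the usual sense is
  \<^term>\<open>\<not> formal TYPE('c) A\<close> for a free type variable \<^typ>\<open>'c\<close>. The first disjunct
  is the zig-zag without intermediate algebras.\<close>

definition formal :: "'c itself \<Rightarrow> 'a dga \<Rightarrow> bool" where
  "formal _ A \<longleftrightarrow> quasi_linked A (cohomology A) \<or>
     (\<exists>Bs :: 'c dga list. Bs \<noteq> [] \<and> (\<forall>B\<in>set Bs. cdga B) \<and>
        quasi_linked A (hd Bs) \<and> successively quasi_linked Bs \<and>
        quasi_linked (last Bs) (cohomology A))"


section \<open>Massey products\<close>

text \<open>Indices run from 0 to \<^term>\<open>length cs - 1\<close>; \<^term>\<open>cs ! i\<close> is a class of degree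
  \<^term>\<open>ps ! i\<close>.\<close>

definition massey_degree :: "nat list \<Rightarrow> nat \<Rightarrow> nat \<Rightarrow> nat" where
  "massey_degree ps i j = (\<Sum>l=i..j. ps ! l) - (j - i)"

text \<open>If the degree \<open>p\<^sub>i + \<dots> + p\<^sub>j - (j - i)\<close> is negative, only 0 is allowed.\<close>

definition massey_component :: "'a dga \<Rightarrow> nat list \<Rightarrow> nat \<Rightarrow> nat \<Rightarrow> 'a set" where
  "massey_component A ps i j =
     (if j - i \<le> (\<Sum>l=i..j. ps ! l) then hcomp A (massey_degree ps i j) else {\<zero>\<^bsub>A\<^esub>})"

definition massey_sum :: "'a dga \<Rightarrow> nat list \<Rightarrow> (nat \<Rightarrow> nat \<Rightarrow> 'a) \<Rightarrow> nat \<Rightarrow> nat \<Rightarrow> 'a" where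
  "massey_sum A ps m i j =
     (\<Oplus>\<^bsub>A\<^esub>k\<in>{i..<j}. ((- 1) ^ massey_degree ps i k \<odot>\<^bsub>A\<^esub> m i k) \<otimes>\<^bsub>A\<^esub> m (Suc k) j)"

definition defining_system ::
  "'a dga \<Rightarrow> nat list \<Rightarrow> 'a set list \<Rightarrow> (nat \<Rightarrow> nat \<Rightarrow> 'a) \<Rightarrow> bool" where
  "defining_system A ps cs m \<longleftrightarrow>
     (\<forall>i<length cs. cohomology_class A (m i i) = cs ! i) \<and>
     (\<forall>i j. i \<le> j \<and> j < length cs \<and> (i, j) \<noteq> (0, length cs - 1) \<longrightarrow>
        m i j \<in> massey_component A ps i j \<and> differential A (m i j) = massey_sum A ps m i j)"

definition massey_product :: "'a dga \<Rightarrow> nat list \<Rightarrow> 'a set list \<Rightarrow> 'a set set" where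
  "massey_product A ps cs =
     {cohomology_class A (massey_sum A ps m 0 (length cs - 1)) | m. defining_system A ps cs m}"

definition massey_defined :: "'a dga \<Rightarrow> nat list \<Rightarrow> 'a set list \<Rightarrow> bool" where
  "massey_defined A ps cs \<longleftrightarrow>
     3 \<le> length cs \<and> length ps = length cs \<and> (\<exists>m. defining_system A ps cs m)"

definition massey_nontrivial :: "'a dga \<Rightarrow> nat list \<Rightarrow> 'a set list \<Rightarrow> bool" where
  "massey_nontrivial A ps cs \<longleftrightarrow>
     massey_defined A ps cs \<and> \<zero>\<^bsub>cohomology A\<^esub> \<notin> massey_product A ps cs"


section \<open>Differential forms on a Euclidean space\<close>

text \<open>A form of mixed degree assigns to a point a function on lists of tangent vectors; its part
  of degree \<open>k\<close> is its restriction to lists of length \<open>k\<close>.\<close>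

type_synonym 'v form = "'v \<Rightarrow> 'v list \<Rightarrow> real"

definition alternating :: "('v::real_vector list \<Rightarrow> real) \<Rightarrow> bool" where
  "alternating f \<longleftrightarrow> (\<forall>us vs. linear (\<lambda>v. f (us @ v # vs))) \<and> (\<forall>vs. \<not> distinct vs \<longrightarrow> f vs = 0)"

primrec k_times_cont_diff :: "nat \<Rightarrow> ('v::euclidean_space \<Rightarrow> real) \<Rightarrow> bool" where
  "k_times_cont_diff 0 f \<longleftrightarrow> continuous_on UNIV f"
| "k_times_cont_diff (Suc k) f \<longleftrightarrow> (\<forall>p. f differentiable (at p)) \<and>
     (\<forall>v. k_times_cont_diff k (\<lambda>p. frechet_derivative f (at p) v))"

definition smooth :: "('v::euclidean_space \<Rightarrow> real) \<Rightarrow> bool" where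
  "smooth f \<longleftrightarrow> (\<forall>k. k_times_cont_diff k f)"

definition smooth_form :: "'v::euclidean_space form \<Rightarrow> bool" where
  "smooth_form \<omega> \<longleftrightarrow> (\<forall>p. alternating (\<omega> p)) \<and> (\<forall>vs. smooth (\<lambda>p. \<omega> p vs))"

definition shuffle_sign :: "nat \<Rightarrow> nat set \<Rightarrow> real" where
  "shuffle_sign n S = (- 1) ^ card {(i, j). i \<in> S \<and> j \<in> {..<n} - S \<and> j < i}"

text \<open>The sum over subsets is the sum over shuffles, so that
  \<open>(\<omega> \<and> \<eta>)(u, v) = \<omega>(u) \<eta>(v) - \<omega>(v) \<eta>(u)\<close> for 1-forms.\<close>

definition wedge :: "'v form \<Rightarrow> 'v form \<Rightarrow> 'v form" (infixl "\<and>\<^sub>w" 70) where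
  "\<omega> \<and>\<^sub>w \<eta> = (\<lambda>p vs. \<Sum>S\<in>Pow {..<length vs}.
     shuffle_sign (length vs) S * \<omega> p (nths vs S) * \<eta> p (nths vs (- S)))"

definition ext_derivative :: "'v::euclidean_space form \<Rightarrow> 'v form" where
  "ext_derivative \<omega> = (\<lambda>p vs. \<Sum>i<length vs. (- 1) ^ i *
     frechet_derivative (\<lambda>q. \<omega> q (take i vs @ drop (Suc i) vs)) (at p) (vs ! i))"

definition pullback :: "('v::euclidean_space \<Rightarrow> 'v) \<Rightarrow> 'v form \<Rightarrow> 'v form" where
  "pullback \<phi> \<omega> = (\<lambda>p vs. \<omega> (\<phi> p) (map (frechet_derivative \<phi> (at p)) vs))"

definition invariant_forms :: "('v::euclidean_space \<Rightarrow> 'v) set \<Rightarrow> 'v form dga" where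
  "invariant_forms \<Phi> = (let C = {\<omega>. smooth_form \<omega> \<and> (\<forall>\<phi>\<in>\<Phi>. pullback \<phi> \<omega> = \<omega>)} in
    \<lparr>carrier = C, mult = wedge, one = (\<lambda>p vs. if vs = [] then 1 else 0), zero = 0, add = (+),
     smult = (\<lambda>r \<omega> p vs. r * \<omega> p vs),
     hcomp = (\<lambda>k. {\<omega> \<in> C. \<forall>p vs. length vs \<noteq> k \<longrightarrow> \<omega> p vs = 0}),
     differential = ext_derivative\<rparr>)"


section \<open>The nilmanifold and its quotient orbifold\<close>

datatype coord = X1 | X2 | Y1 | Y2 | Z1 | Z2 | V1 | V2

instance coord :: finite
proof
  have "(UNIV :: coord set) \<subseteq> {X1, X2, Y1, Y2, Z1, Z2, V1, V2}"
    using coord.exhaust by blast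
  then show "finite (UNIV :: coord set)"
    by (rule finite_subset) simp
qed

text \<open>The multiplication of the Lie group \<open>\<real>\<^sup>2 \<times> G\<close>.\<close>

definition group_mult :: "real ^ coord \<Rightarrow> real ^ coord \<Rightarrow> real ^ coord" where
  "group_mult g p = (\<chi> c. case c of
      V1 \<Rightarrow> p $ V1 + g $ V1 + (g $ Y1 - g $ Y2) * p $ Z1 - (g $ Y1 + 2 * g $ Y2) * p $ Z2
    | V2 \<Rightarrow> p $ V2 + g $ V2 - (2 * g $ Y1 + g $ Y2) * p $ Z1 + (g $ Y2 - g $ Y1) * p $ Z2
    | _ \<Rightarrow> p $ c + g $ c)"

text \<open>The lattice \<open>\<int>\<^sup>2 \<times> \<Gamma>\<close>.\<close>

definition lattice :: "(real ^ coord) set" where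
  "lattice = {g. (\<forall>c. g $ c \<in> \<int>) \<and> (\<exists>n::int. g $ V1 - g $ V2 = 3 * of_int n)}"

definition rho :: "real ^ coord \<Rightarrow> real ^ coord" where
  "rho p = (\<chi> c. case c of
      X1 \<Rightarrow> - p $ X1 - p $ X2 | X2 \<Rightarrow> p $ X1
    | Y1 \<Rightarrow> - p $ Y1 - p $ Y2 | Y2 \<Rightarrow> p $ Y1
    | Z1 \<Rightarrow> - p $ Z1 - p $ Z2 | Z2 \<Rightarrow> p $ Z1
    | V1 \<Rightarrow> - p $ V1 - p $ V2 | V2 \<Rightarrow> p $ V1)"

text \<open>Forms on the compact nilmanifold \<open>M = (\<int>\<^sup>2 \<times> \<Gamma>) \ (\<real>\<^sup>2 \<times> G)\<close> are identified with
  their pullbacks to the universal covering, that is, with the forms invariant under the deck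
  transformations; orbifold forms on \<open>M / \<int>\<^sub>3\<close> are the \<open>\<int>\<^sub>3\<close>-invariant forms on \<open>M\<close>.\<close>

definition orbifold_forms :: "(real ^ coord) form dga" where
  "orbifold_forms = invariant_forms (insert rho (group_mult ` lattice))"

definition d_coord :: "coord \<Rightarrow> (real ^ coord) form" where
  "d_coord c = (\<lambda>p vs. case vs of [v] \<Rightarrow> v $ c | _ \<Rightarrow> 0)"

abbreviation "\<alpha>\<^sub>1 \<equiv> d_coord X1"
abbreviation "\<alpha>\<^sub>2 \<equiv> d_coord X2"
abbreviation "\<beta>\<^sub>1 \<equiv> d_coord Y1"
abbreviation "\<beta>\<^sub>2 \<equiv> d_coord Y2"
abbreviation "\<gamma>\<^sub>1 \<equiv> d_coord Z1"
abbreviation "\<gamma>\<^sub>2 \<equiv> d_coord Z2"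

end

theory Submission
  imports Defs "HOL-Algebra.Subrings"
begin

section \<open>Commutative differential graded algebras\<close>

lemma real_ring_simps [simp]:
  "carrier real_ring = UNIV" "mult real_ring = (*)" "one real_ring = 1"
  "zero real_ring = 0" "add real_ring = (+)"
  by (simp_all add: real_ring_def)

lemma cring_real_ring: "cring real_ring"
proof (rule cringI)
  show "abelian_group real_ring"
  proof (rule abelian_groupI)
    show "\<exists>y\<in>carrier real_ring. y \<oplus>\<^bsub>real_ring\<^esub> x = \<zero>\<^bsub>real_ring\<^esub>" for x
      by (rule bexI[of _ "- x"]) simp_all
  qed simp_all
  show "comm_monoid real_ring"
    by (rule comm_monoidI) simp_all
qed (simp add: distrib_right)

lemma sign_square [simp]: "(- 1) ^ k * (- 1) ^ k = (1 :: real)"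
  by (metis minus_one_mult_self)

context ring
begin

lemma minus_diff:
  assumes "x \<in> carrier R" "y \<in> carrier R"
  shows "\<ominus> (x \<ominus> y) = y \<ominus> x"
  using assms by algebra

lemma add_diff_self:
  assumes "x \<in> carrier R" "y \<in> carrier R"
  shows "x \<oplus> (y \<ominus> x) = y"
  using assms by algebra

lemma diff_telescope:
  assumes "x \<in> carrier R" "y \<in> carrier R" "z \<in> carrier R"
  shows "(x \<ominus> y) \<ominus> (z \<ominus> y) = x \<ominus> z"
  using assms by algebra

lemma mult_diff_telescope:
  assumes "x \<in> carrier R" "x' \<in> carrier R" "y \<in> carrier R" "y' \<in> carrier R"
  shows "y \<otimes> y' \<ominus> y \<otimes> (y' \<ominus> x') \<ominus> (y \<ominus> x) \<otimes> x' = x \<otimes> x'"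
proof -
  have "y \<otimes> (y' \<ominus> x') = y \<otimes> y' \<ominus> y \<otimes> x'" "(y \<ominus> x) \<otimes> x' = y \<otimes> x' \<ominus> x \<otimes> x'"
    using assms by (simp_all add: a_minus_def l_distr r_distr l_minus r_minus)
  then show ?thesis
    using assms m_closed[OF assms(3,4)] m_closed[OF assms(3,2)] m_closed[OF assms(1,2)]
    by (simp add: a_minus_def minus_add a_assoc r_neg1 r_neg2)
qed

end

definition component :: "'a dga \<Rightarrow> nat \<Rightarrow> 'a \<Rightarrow> 'a" where
  "component A k x = (THE f. (\<forall>k. f k \<in> hcomp A k) \<and> finite {k. f k \<noteq> \<zero>\<^bsub>A\<^esub>} \<and>
     x = (\<Oplus>\<^bsub>A\<^esub>k\<in>{k. f k \<noteq> \<zero>\<^bsub>A\<^esub>}. f k)) k"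

text \<open>Inside the locale of commutative differential graded algebras the facts about the ring of
  scalars shadow those about the algebra. The following locale has the ring structure of the
  algebra only, and the laws of the scalar multiplication as laws for real numbers.\<close>

locale dg_algebra = ring A for A :: "'a dga" (structure) +
  assumes smult_in [simp, intro]: "x \<in> carrier A \<Longrightarrow> r \<odot> x \<in> carrier A"
    and smult_add_left: "x \<in> carrier A \<Longrightarrow> (r + s) \<odot> x = r \<odot> x \<oplus> s \<odot> x"
    and smult_add_right:
      "\<lbrakk>x \<in> carrier A; y \<in> carrier A\<rbrakk> \<Longrightarrow> r \<odot> (x \<oplus> y) = r \<odot> x \<oplus> r \<odot> y"
    and smult_smult: "x \<in> carrier A \<Longrightarrow> r \<odot> (s \<odot> x) = (r * s) \<odot> x"
    and smult_1 [simp]: "x \<in> carrier A \<Longrightarrow> 1 \<odot> x = x"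
    and smult_mult_left: "\<lbrakk>x \<in> carrier A; y \<in> carrier A\<rbrakk> \<Longrightarrow> (r \<odot> x) \<otimes> y = r \<odot> (x \<otimes> y)"
    and smult_mult_right: "\<lbrakk>x \<in> carrier A; y \<in> carrier A\<rbrakk> \<Longrightarrow> x \<otimes> (r \<odot> y) = r \<odot> (x \<otimes> y)"
    and hcomp_carrier: "x \<in> hcomp A k \<Longrightarrow> x \<in> carrier A"
    and hcomp_closed [simp, intro]: "\<zero> \<in> hcomp A k"
      "x \<in> hcomp A k \<Longrightarrow> r \<odot> x \<in> hcomp A k"
      "\<lbrakk>x \<in> hcomp A k; y \<in> hcomp A k\<rbrakk> \<Longrightarrow> x \<oplus> y \<in> hcomp A k"
    and hcomp_direct_sum: "x \<in> carrier A \<Longrightarrow>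
      \<exists>!f. (\<forall>k. f k \<in> hcomp A k) \<and> finite {k. f k \<noteq> \<zero>} \<and> x = (\<Oplus>k\<in>{k. f k \<noteq> \<zero>}. f k)"
    and one_hcomp: "\<one> \<in> hcomp A 0"
    and mult_hcomp: "\<lbrakk>x \<in> hcomp A i; y \<in> hcomp A j\<rbrakk> \<Longrightarrow> x \<otimes> y \<in> hcomp A (i + j)"
    and graded_commute: "\<lbrakk>x \<in> hcomp A i; y \<in> hcomp A j\<rbrakk> \<Longrightarrow> x \<otimes> y = (- 1) ^ (i * j) \<odot> (y \<otimes> x)"
    and differential_add: "\<lbrakk>x \<in> carrier A; y \<in> carrier A\<rbrakk> \<Longrightarrow>
      differential A (x \<oplus> y) = differential A x \<oplus> differential A y"
    and differential_smult: "x \<in> carrier A \<Longrightarrow> differential A (r \<odot> x) = r \<odot> differential A x"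
    and differential_hcomp: "x \<in> hcomp A k \<Longrightarrow> differential A x \<in> hcomp A (Suc k)"
    and differential_differential: "x \<in> carrier A \<Longrightarrow> differential A (differential A x) = \<zero>"
    and leibniz: "\<lbrakk>x \<in> hcomp A i; y \<in> carrier A\<rbrakk> \<Longrightarrow>
      differential A (x \<otimes> y) = differential A x \<otimes> y \<oplus> (- 1) ^ i \<odot> (x \<otimes> differential A y)"

lemma cdga_imp_dg_algebra:
  assumes "cdga A"
  shows "dg_algebra A"
proof -
  interpret cdga A by (rule assms)
  show ?thesis
  proof (intro dg_algebra.intro dg_algebra_axioms.intro)
    show "ring A" by (rule cdga.axioms(1)[OF assms])
    show "smult A r x \<in> carrier A" if "x \<in> carrier A" for r x
      using smult_closed[of r x] that by simp
    show "smult A (r + s) x = add A (smult A r x) (smult A s x)" if "x \<in> carrier A" for r s x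
      using smult_l_distr[of r s x] that by simp
    show "smult A r (add A x y) = add A (smult A r x) (smult A r y)"
      if "x \<in> carrier A" "y \<in> carrier A" for r x y
      using smult_r_distr[of r x y] that by simp
    show "smult A r (smult A s x) = smult A (r * s) x" if "x \<in> carrier A" for r s x
      using smult_assoc1[of r s x] that by simp
    show "smult A 1 x = x" if "x \<in> carrier A" for x
      using smult_one[of x] that by simp
    show "zero A \<in> hcomp A k" for k
      using subgroup.one_closed[of "hcomp A k" "add_monoid A"] hcomp_submodule[of k]
      by (auto simp: submodule_def)
    show "x \<in> carrier A" if "x \<in> hcomp A k" for x k
      using submoduleE(1)[OF hcomp_submodule[of k]] that by blast
    show "smult A r x \<in> hcomp A k" if "x \<in> hcomp A k" for r x k
      using submoduleE(4)[OF hcomp_submodule[of k]] that by simp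
    show "add A x y \<in> hcomp A k" if "x \<in> hcomp A k" "y \<in> hcomp A k" for x y k
      using submoduleE(5)[OF hcomp_submodule[of k]] that by simp
  qed (fact smult_mult_left smult_mult_right hcomp_direct_sum one_hcomp mult_hcomp graded_commute
      differential_add differential_smult differential_hcomp differential_differential leibniz)+
qed

lemma dg_algebra_imp_cdga:
  assumes "dg_algebra A"
  shows "cdga A"
proof -
  interpret dg_algebra A by (rule assms)
  have M: "module real_ring A"
    by (rule moduleI[OF cring_real_ring is_abelian_group])
      (auto simp: smult_add_left smult_add_right smult_smult)
  show ?thesis
  proof (intro cdga.intro cdga_axioms.intro M)
    show "ring A" by (rule ring_axioms)
    show "submodule (hcomp A k) real_ring A" for k
    proof (rule module.submoduleI[OF M])
      show "a_inv A x \<in> hcomp A k" if x: "x \<in> hcomp A k" for x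
      proof -
        have "add A (smult A (- 1) x) x = zero A"
          using smult_add_left[of x "-1" 1] smult_add_left[of x 0 0] hcomp_carrier[OF x] by simp
        then show ?thesis
          using minus_equality[of "smult A (- 1) x" x] hcomp_carrier[OF x] hcomp_closed(2)[OF x, of "-1"]
          by simp
      qed
    qed (use hcomp_carrier in auto)
  qed (fact smult_mult_left smult_mult_right hcomp_direct_sum one_hcomp mult_hcomp graded_commute
      differential_add differential_smult differential_hcomp differential_differential leibniz)+
qed

context dg_algebra
begin

lemma smult_0 [simp]: "x \<in> carrier A \<Longrightarrow> 0 \<odot> x = \<zero>"
  using smult_add_left[of x 0 0] by simp

lemma smult_zero [simp]: "r \<odot> \<zero> = \<zero>"
  using smult_add_right[of \<zero> \<zero> r] by simp

lemma smult_minus_left: "x \<in> carrier A \<Longrightarrow> (- r) \<odot> x = \<ominus> (r \<odot> x)"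
  using smult_add_left[of x "- r" r] by (simp add: minus_equality)

lemma smult_minus_one: "x \<in> carrier A \<Longrightarrow> (- 1) \<odot> x = \<ominus> x"
  by (simp add: smult_minus_left)

lemma smult_minus_right: "x \<in> carrier A \<Longrightarrow> r \<odot> (\<ominus> x) = \<ominus> (r \<odot> x)"
  using smult_smult[of x r "-1"] smult_minus_left[of x r] by (simp add: smult_minus_one)

lemma finsum_smult:
  "finite F \<Longrightarrow> g \<in> F \<rightarrow> carrier A \<Longrightarrow> r \<odot> (\<Oplus>i\<in>F. g i) = (\<Oplus>i\<in>F. r \<odot> g i)"
proof (induction F rule: finite_induct)
  case (insert i F)
  then have "(\<lambda>i. r \<odot> g i) \<in> F \<rightarrow> carrier A" by auto
  with insert show ?case by (simp add: smult_add_right Pi_def)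
qed simp

lemma hcomp_neg [simp, intro]: "x \<in> hcomp A k \<Longrightarrow> \<ominus> x \<in> hcomp A k"
  using hcomp_closed(2)[of x k "-1"] hcomp_carrier by (simp add: smult_minus_one)

lemma hcomp_minus [simp, intro]:
  "x \<in> hcomp A k \<Longrightarrow> y \<in> hcomp A k \<Longrightarrow> x \<ominus> y \<in> hcomp A k"
  by (simp add: a_minus_def)

lemma hcomp_finsum:
  assumes "finite F" "\<And>i. i \<in> F \<Longrightarrow> g i \<in> hcomp A k"
  shows "(\<Oplus>i\<in>F. g i) \<in> hcomp A k"
  using assms
proof (induction F rule: finite_induct)
  case (insert i F)
  then have "g \<in> F \<rightarrow> carrier A" "g i \<in> carrier A" using hcomp_carrier by blast+
  with insert show ?case by simp
qed simp

lemma d_closed [simp, intro]: "x \<in> carrier A \<Longrightarrow> differential A x \<in> carrier A"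
proof -
  assume x: "x \<in> carrier A"
  obtain f where f: "\<forall>k. f k \<in> hcomp A k" "finite {k. f k \<noteq> \<zero>}"
    "x = (\<Oplus>k\<in>{k. f k \<noteq> \<zero>}. f k)"
    using hcomp_direct_sum[OF x] by blast
  have z: "differential A \<zero> \<in> carrier A"
    using differential_hcomp[of \<zero> 0] hcomp_carrier by simp
  have "differential A (\<Oplus>k\<in>F. f k) \<in> carrier A" if "finite F" for F
    using that
  proof (induction F rule: finite_induct)
    case (insert i F)
    have c: "f i \<in> carrier A" "f \<in> F \<rightarrow> carrier A" using f(1) hcomp_carrier by blast+
    have "differential A (f i) \<in> carrier A"
      using differential_hcomp f(1) hcomp_carrier by blast
    with insert c show ?case by (simp add: differential_add)
  qed (simp add: z)
  with f show ?thesis by metis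
qed

lemma d_zero [simp]: "differential A \<zero> = \<zero>"
  using differential_smult[of \<zero> 0] by simp

lemma d_minus: "x \<in> carrier A \<Longrightarrow> differential A (\<ominus> x) = \<ominus> differential A x"
  using differential_smult[of x "-1"] by (simp add: smult_minus_one)

lemma d_diff: "x \<in> carrier A \<Longrightarrow> y \<in> carrier A \<Longrightarrow>
    differential A (x \<ominus> y) = differential A x \<ominus> differential A y"
  by (simp add: a_minus_def differential_add d_minus)

lemma d_finsum:
  "finite F \<Longrightarrow> g \<in> F \<rightarrow> carrier A \<Longrightarrow>
    differential A (\<Oplus>i\<in>F. g i) = (\<Oplus>i\<in>F. differential A (g i))"
proof (induction F rule: finite_induct)
  case (insert i F)
  then have "(\<lambda>i. differential A (g i)) \<in> F \<rightarrow> carrier A" by auto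
  with insert show ?case by (simp add: differential_add Pi_def)
qed simp

lemma component_eq:
  assumes f: "\<And>k. f k \<in> hcomp A k" and F: "finite F" "\<And>k. k \<notin> F \<Longrightarrow> f k = \<zero>"
    and x: "x = (\<Oplus>k\<in>F. f k)"
  shows "component A k x = f k"
proof -
  let ?P = "\<lambda>f. (\<forall>k. f k \<in> hcomp A k) \<and> finite {k. f k \<noteq> \<zero>} \<and>
     x = (\<Oplus>k\<in>{k. f k \<noteq> \<zero>}. f k)"
  have c: "f \<in> B \<rightarrow> carrier A" for B using f hcomp_carrier by blast
  have sub: "{k. f k \<noteq> \<zero>} \<subseteq> F" using F(2) by blast
  have "(\<Oplus>k\<in>F. f k) = (\<Oplus>k\<in>{k. f k \<noteq> \<zero>}. f k)"
    by (rule add.finprod_mono_neutral_cong_left[symmetric]) (use F(1) sub c in auto)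
  then have P: "?P f" using f F(1) sub finite_subset x by auto
  have xA: "x \<in> carrier A" using x c by simp
  have "(THE f. ?P f) = f" by (rule the1_equality[OF hcomp_direct_sum[OF xA], OF P])
  then show ?thesis by (simp add: component_def)
qed

lemma component_decomposition:
  assumes x: "x \<in> carrier A"
  shows "\<exists>F. finite F \<and> (\<forall>k. k \<notin> F \<longrightarrow> component A k x = \<zero>) \<and>
    x = (\<Oplus>k\<in>F. component A k x)"
    "component A k x \<in> hcomp A k"
proof -
  obtain f where f: "\<forall>k. f k \<in> hcomp A k" "finite {k. f k \<noteq> \<zero>}"
    "x = (\<Oplus>k\<in>{k. f k \<noteq> \<zero>}. f k)"
    using hcomp_direct_sum[OF x] by blast
  have "component A k x = f k" for k
    by (rule component_eq[OF _ f(2) _ f(3)]) (use f(1) in simp_all)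
  then have *: "(\<lambda>k. component A k x) = f" by (intro ext)
  then show "component A k x \<in> hcomp A k" using f(1) by metis
  have "finite {k. f k \<noteq> \<zero>} \<and> (\<forall>k. k \<notin> {k. f k \<noteq> \<zero>} \<longrightarrow> f k = \<zero>) \<and>
      x = (\<Oplus>k\<in>{k. f k \<noteq> \<zero>}. f k)" using f by blast
  then show "\<exists>F. finite F \<and> (\<forall>k. k \<notin> F \<longrightarrow> component A k x = \<zero>) \<and>
      x = (\<Oplus>k\<in>F. component A k x)" unfolding * fun_cong[OF *] by (rule exI)
qed

lemma component_hcomp [simp, intro]: "x \<in> carrier A \<Longrightarrow> component A k x \<in> hcomp A k"
  by (rule component_decomposition)

lemma component_carrier [simp, intro]: "x \<in> carrier A \<Longrightarrow> component A k x \<in> carrier A"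
  using hcomp_carrier by blast

lemma component_homogeneous:
  "x \<in> hcomp A k \<Longrightarrow> component A j x = (if j = k then x else \<zero>)"
  using component_eq[of "\<lambda>j. if j = k then x else \<zero>" "{k}" x j] hcomp_carrier[of x k] by simp

lemma component_zero [simp]: "component A k \<zero> = \<zero>"
  using component_homogeneous[OF hcomp_closed(1), of k k] by simp

lemma component_add:
  assumes x: "x \<in> carrier A" and y: "y \<in> carrier A"
  shows "component A k (x \<oplus> y) = component A k x \<oplus> component A k y"
proof -
  obtain F where F: "finite F" "\<And>k. k \<notin> F \<Longrightarrow> component A k x = \<zero>"
    "x = (\<Oplus>k\<in>F. component A k x)"
    using component_decomposition(1)[OF x] by blast
  obtain G where G: "finite G" "\<And>k. k \<notin> G \<Longrightarrow> component A k y = \<zero>"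
    "y = (\<Oplus>k\<in>G. component A k y)"
    using component_decomposition(1)[OF y] by blast
  have cx: "(\<lambda>k. component A k x) \<in> B \<rightarrow> carrier A"
    and cy: "(\<lambda>k. component A k y) \<in> B \<rightarrow> carrier A" for B using x y by auto
  have "x = (\<Oplus>k\<in>F \<union> G. component A k x)"
    by (rule trans[OF F(3) add.finprod_mono_neutral_cong_left]) (use F(1,2) G(1,2) cx in auto)
  moreover have "y = (\<Oplus>k\<in>F \<union> G. component A k y)"
    by (rule trans[OF G(3) add.finprod_mono_neutral_cong_left]) (use F(1,2) G(1,2) cy in auto)
  ultimately have "x \<oplus> y = (\<Oplus>k\<in>F \<union> G. component A k x \<oplus> component A k y)"
    using add.finprod_multf[OF cx cy, of "F \<union> G"] by simp
  then show ?thesis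
    using component_eq[of "\<lambda>k. component A k x \<oplus> component A k y" "F \<union> G" "x \<oplus> y" k]
      F(1,2) G(1,2) x y by auto
qed

lemma component_smult:
  assumes x: "x \<in> carrier A"
  shows "component A k (r \<odot> x) = r \<odot> component A k x"
proof -
  obtain F where F: "finite F" "\<And>k. k \<notin> F \<Longrightarrow> component A k x = \<zero>"
    "x = (\<Oplus>k\<in>F. component A k x)"
    using component_decomposition(1)[OF x] by blast
  have "r \<odot> x = (\<Oplus>k\<in>F. r \<odot> component A k x)"
    by (rule trans[OF arg_cong[OF F(3), of "smult A r"] finsum_smult]) (use F(1) x in auto)
  then show ?thesis
    using component_eq[of "\<lambda>k. r \<odot> component A k x" F "r \<odot> x" k] F(1,2) x by auto
qed

lemma component_minus: "x \<in> carrier A \<Longrightarrow> component A k (\<ominus> x) = \<ominus> component A k x"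
  using component_smult[of x k "-1"] by (simp add: smult_minus_one)

lemma component_d:
  assumes x: "x \<in> carrier A"
  shows "component A (Suc k) (differential A x) = differential A (component A k x)"
    "component A 0 (differential A x) = \<zero>"
proof -
  obtain F where F: "finite F" "\<And>k. k \<notin> F \<Longrightarrow> component A k x = \<zero>"
    "x = (\<Oplus>k\<in>F. component A k x)"
    using component_decomposition(1)[OF x] by blast
  let ?g = "\<lambda>k. case k of 0 \<Rightarrow> \<zero> | Suc k \<Rightarrow> differential A (component A k x)"
  have c: "?g k \<in> hcomp A k" for k
    using x differential_hcomp by (auto split: nat.split)
  have "differential A x = (\<Oplus>k\<in>F. differential A (component A k x))"
    by (rule trans[OF arg_cong[OF F(3), of "differential A"] d_finsum]) (use F(1) x in auto)
  also have "\<dots> = (\<Oplus>k\<in>F. ?g (Suc k))" by simp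
  also have "\<dots> = (\<Oplus>k\<in>Suc ` F. ?g k)"
    by (rule add.finprod_reindex[symmetric]) (use hcomp_carrier[OF c] in auto)
  finally have *: "differential A x = (\<Oplus>k\<in>Suc ` F. ?g k)" .
  have z: "k \<notin> Suc ` F \<Longrightarrow> ?g k = \<zero>" for k
    using F(2) by (cases k) (simp_all add: inj_image_mem_iff)
  from component_eq[OF c _ z *] F(1) have "component A k (differential A x) = ?g k" for k by simp
  from this[of "Suc k"] this[of 0] show
    "component A (Suc k) (differential A x) = differential A (component A k x)"
    "component A 0 (differential A x) = \<zero>" by simp_all
qed

lemma cocycles_closed:
  "\<zero> \<in> cocycles A" "\<one> \<in> cocycles A"
  "x \<in> cocycles A \<Longrightarrow> x \<in> carrier A"
  "x \<in> cocycles A \<Longrightarrow> y \<in> cocycles A \<Longrightarrow> x \<oplus> y \<in> cocycles A"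
  "x \<in> cocycles A \<Longrightarrow> \<ominus> x \<in> cocycles A"
  "x \<in> cocycles A \<Longrightarrow> r \<odot> x \<in> cocycles A"
  "x \<in> cocycles A \<Longrightarrow> component A k x \<in> cocycles A"
proof -
  have "differential A \<one> \<oplus> differential A \<one> = differential A (\<one> \<otimes> \<one>)"
    by (subst leibniz[OF one_hcomp]) simp_all
  then have "differential A \<one> = \<zero>" by simp
  then show "\<one> \<in> cocycles A" by (simp add: cocycles_def)
  show "x \<in> cocycles A \<Longrightarrow> component A k x \<in> cocycles A"
    using component_d(1)[of x k] by (simp add: cocycles_def)
qed (auto simp: cocycles_def differential_add d_minus differential_smult)

lemma leibniz_component:
  "x \<in> carrier A \<Longrightarrow> y \<in> carrier A \<Longrightarrow>
    differential A (component A k x \<otimes> y) =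
    differential A (component A k x) \<otimes> y \<oplus> (- 1) ^ k \<odot> (component A k x \<otimes> differential A y)"
  using leibniz component_hcomp by blast

text \<open>A product of cocycles is reduced to its homogeneous parts, to which the Leibniz rule
  applies.\<close>

lemma component_induct:
  assumes x: "x \<in> carrier A" and P0: "P \<zero>"
    and Padd: "\<And>u v. u \<in> carrier A \<Longrightarrow> v \<in> carrier A \<Longrightarrow> P u \<Longrightarrow> P v \<Longrightarrow> P (u \<oplus> v)"
    and Pk: "\<And>k. P (component A k x)"
  shows "P x"
proof -
  obtain F where F: "finite F" "x = (\<Oplus>k\<in>F. component A k x)"
    using component_decomposition(1)[OF x] by blast
  have "P (\<Oplus>k\<in>F. component A k x)"
    using F(1)
  proof (induction F rule: finite_induct)
    case (insert k F)
    have "(\<lambda>k. component A k x) \<in> F \<rightarrow> carrier A" using x by auto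
    with insert show ?case using x Pk by (simp add: Padd)
  qed (simp add: P0)
  then show ?thesis by (subst F(2))
qed

lemma cocycles_mult:
  assumes x: "x \<in> cocycles A" and y: "y \<in> cocycles A"
  shows "x \<otimes> y \<in> cocycles A"
proof -
  have c: "x \<in> carrier A" "y \<in> carrier A" "differential A y = \<zero>"
    using x y by (auto simp: cocycles_def)
  have "differential A (x \<otimes> y) = \<zero>"
  proof (rule component_induct[where P = "\<lambda>u. differential A (u \<otimes> y) = \<zero>", OF c(1)])
    fix k show "differential A (component A k x \<otimes> y) = \<zero>"
      using leibniz_component[of x y k] c cocycles_closed(7)[OF x, of k] by (simp add: cocycles_def)
  qed (use c in \<open>simp_all add: l_distr differential_add\<close>)
  with c show ?thesis by (simp add: cocycles_def)
qed

lemma coboundaries_closed: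
  "\<zero> \<in> coboundaries A"
  "x \<in> coboundaries A \<Longrightarrow> x \<in> carrier A"
  "x \<in> coboundaries A \<Longrightarrow> x \<in> cocycles A"
  "x \<in> coboundaries A \<Longrightarrow> y \<in> coboundaries A \<Longrightarrow> x \<oplus> y \<in> coboundaries A"
  "x \<in> coboundaries A \<Longrightarrow> \<ominus> x \<in> coboundaries A"
  "x \<in> coboundaries A \<Longrightarrow> r \<odot> x \<in> coboundaries A"
  "x \<in> coboundaries A \<Longrightarrow> component A k x \<in> coboundaries A"
proof -
  show "\<zero> \<in> coboundaries A" unfolding coboundaries_def
    by (rule image_eqI[of _ _ \<zero>]) simp_all
next
  assume "x \<in> coboundaries A" "y \<in> coboundaries A"
  then obtain u v where "u \<in> carrier A" "v \<in> carrier A" "x = differential A u"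
    "y = differential A v" by (auto simp: coboundaries_def)
  then show "x \<oplus> y \<in> coboundaries A" unfolding coboundaries_def
    by (intro image_eqI[of _ _ "u \<oplus> v"]) (simp_all add: differential_add)
next
  assume "x \<in> coboundaries A"
  then obtain u where u: "u \<in> carrier A" "x = differential A u" by (auto simp: coboundaries_def)
  then show "x \<in> carrier A" "x \<in> cocycles A"
    by (simp_all add: cocycles_def differential_differential)
  show "\<ominus> x \<in> coboundaries A" unfolding coboundaries_def using u
    by (intro image_eqI[of _ _ "\<ominus> u"]) (simp_all add: d_minus)
  show "r \<odot> x \<in> coboundaries A" unfolding coboundaries_def using u
    by (intro image_eqI[of _ _ "r \<odot> u"]) (simp_all add: differential_smult)
  show "component A k x \<in> coboundaries A"
  proof (cases k)
    case 0
    with u show ?thesis using component_d(2)[OF u(1)] d_zero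
      unfolding coboundaries_def by (intro image_eqI[of _ _ \<zero>]) simp_all
  next
    case (Suc j)
    with u show ?thesis using component_d(1)[OF u(1)]
      unfolding coboundaries_def by (intro image_eqI[of _ _ "component A j u"]) simp_all
  qed
qed

lemma coboundaries_minus:
  "x \<in> coboundaries A \<Longrightarrow> y \<in> coboundaries A \<Longrightarrow> x \<ominus> y \<in> coboundaries A"
  by (simp add: a_minus_def coboundaries_closed)

lemma coboundaries_mult:
  assumes x: "x \<in> coboundaries A" and y: "y \<in> cocycles A"
  shows "x \<otimes> y \<in> coboundaries A" "y \<otimes> x \<in> coboundaries A"
proof -
  obtain u where u: "u \<in> carrier A" "x = differential A u" using x by (auto simp: coboundaries_def)
  have c: "x \<in> carrier A" "y \<in> carrier A" "differential A y = \<zero>"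
    using x y coboundaries_closed by (auto simp: cocycles_def)
  have "differential A u \<otimes> y \<in> coboundaries A"
  proof (rule component_induct[where P = "\<lambda>u. differential A u \<otimes> y \<in> coboundaries A", OF u(1)])
    fix k
    have "differential A (component A k u) \<otimes> y = differential A (component A k u \<otimes> y)"
      using leibniz_component[of u y k] u(1) c by simp
    then show "differential A (component A k u) \<otimes> y \<in> coboundaries A"
      using u(1) c by (auto simp: coboundaries_def)
  qed (use c in \<open>simp_all add: l_distr differential_add coboundaries_closed\<close>)
  then show "x \<otimes> y \<in> coboundaries A" using u by simp
  show "y \<otimes> x \<in> coboundaries A"
  proof (rule component_induct[where P = "\<lambda>y. y \<otimes> x \<in> coboundaries A", OF c(2)])
    fix k
    have yk: "differential A (component A k y) = \<zero>"
      using cocycles_closed(7)[OF y] by (simp add: cocycles_def)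
    have "differential A ((- 1) ^ k \<odot> (component A k y \<otimes> u)) = component A k y \<otimes> x"
      using leibniz_component[of y u k] u c yk
      by (simp add: differential_smult smult_smult)
    then show "component A k y \<otimes> x \<in> coboundaries A" unfolding coboundaries_def
      using u(1) c by (intro image_eqI[of _ _ "(- 1) ^ k \<odot> (component A k y \<otimes> u)"]) simp_all
  qed (use c in \<open>simp_all add: l_distr coboundaries_closed\<close>)
qed

lemma homogeneous_primitive:
  assumes x: "x \<in> hcomp A (Suc k)" "x \<in> coboundaries A"
  obtains u where "u \<in> hcomp A k" "x = differential A u"
proof -
  obtain u where u: "u \<in> carrier A" "x = differential A u" using x by (auto simp: coboundaries_def)
  then have "x = differential A (component A k u)"
    using component_d(1)[OF u(1), of k] component_homogeneous[OF x(1), of "Suc k"] by simp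
  with u that show ?thesis by blast
qed

end

section \<open>The cohomology algebra\<close>

lemma ring_transfer:
  assumes "ring R" "carrier S = carrier R" "mult S = mult R" "one S = one R"
    "zero S = zero R" "add S = add R"
  shows "ring S"
proof -
  interpret ring R by fact
  show ?thesis
  proof (intro ringI abelian_groupI monoidI)
    show "\<exists>y\<in>carrier S. y \<oplus>\<^bsub>S\<^esub> x = \<zero>\<^bsub>S\<^esub>" if "x \<in> carrier S" for x
      using that assms l_neg a_inv_closed by metis
  qed (simp_all add: assms(2-6) a_assoc m_assoc a_comm a_lcomm l_distr r_distr)
qed

lemma direct_sum_of_projections:
  fixes A (structure)
  assumes A: "abelian_monoid A"
    and C: "\<And>k. C k \<subseteq> carrier A" "\<And>k. \<zero> \<in> C k"
    and add: "\<And>k x y. x \<in> carrier A \<Longrightarrow> y \<in> carrier A \<Longrightarrow> \<pi> k (x \<oplus> y) = \<pi> k x \<oplus> \<pi> k y"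
    and mem: "\<And>k x. x \<in> carrier A \<Longrightarrow> \<pi> k x \<in> C k"
    and hom: "\<And>j k x. x \<in> C j \<Longrightarrow> \<pi> k x = (if k = j then x else \<zero>)"
    and dec: "x \<in> carrier A \<Longrightarrow> \<exists>F. finite F \<and> (\<forall>k. k \<notin> F \<longrightarrow> \<pi> k x = \<zero>) \<and> x = (\<Oplus>k\<in>F. \<pi> k x)"
    and x: "x \<in> carrier A"
  shows "\<exists>!f. (\<forall>k. f k \<in> C k) \<and> finite {k. f k \<noteq> \<zero>} \<and> x = (\<Oplus>k\<in>{k. f k \<noteq> \<zero>}. f k)"
proof -
  interpret abelian_monoid A by fact
  have car: "f k \<in> carrier A" if "\<forall>k. f k \<in> C k" for f k using that C(1) by blast
  show ?thesis
  proof (rule ex1I)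
    obtain F where F: "finite F" "\<And>k. k \<notin> F \<Longrightarrow> \<pi> k x = \<zero>" "x = (\<Oplus>k\<in>F. \<pi> k x)"
      using dec[OF x] by blast
    have sub: "{k. \<pi> k x \<noteq> \<zero>} \<subseteq> F" using F(2) by blast
    have pc: "\<And>k. \<pi> k x \<in> carrier A" using mem[OF x] C(1) by blast
    have "(\<Oplus>k\<in>F. \<pi> k x) = (\<Oplus>k\<in>{k. \<pi> k x \<noteq> \<zero>}. \<pi> k x)"
      by (rule add.finprod_mono_neutral_cong_left[symmetric]) (use F(1) sub pc in auto)
    with F(3) have "x = (\<Oplus>k\<in>{k. \<pi> k x \<noteq> \<zero>}. \<pi> k x)" by (rule trans)
    with finite_subset[OF sub F(1)] mem[OF x]
    show "(\<forall>k. \<pi> k x \<in> C k) \<and> finite {k. \<pi> k x \<noteq> \<zero>} \<and> x = (\<Oplus>k\<in>{k. \<pi> k x \<noteq> \<zero>}. \<pi> k x)"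
      by blast
  next
    fix f assume f: "(\<forall>k. f k \<in> C k) \<and> finite {k. f k \<noteq> \<zero>} \<and> x = (\<Oplus>k\<in>{k. f k \<noteq> \<zero>}. f k)"
    have fc: "\<And>k. f k \<in> carrier A" using car f by blast
    have z: "\<pi> k \<zero> = \<zero>" for k using hom[OF C(2), of k k] by simp
    have h: "\<pi> k (f i) = (if k = i then f i else \<zero>)" for k i using hom f by blast
    have "\<pi> k (\<Oplus>k\<in>F. f k) = (if k \<in> F then f k else \<zero>)" if "finite F" for k F
      using that
    proof (induction F rule: finite_induct)
      case (insert i F)
      have "\<pi> k (\<Oplus>k\<in>insert i F. f k) = \<pi> k (f i) \<oplus> \<pi> k (\<Oplus>k\<in>F. f k)"
        using insert.hyps fc by (simp add: add)
      with insert h fc show ?case by auto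
    qed (simp add: z)
    from this[of "{k. f k \<noteq> \<zero>}"] f have "\<pi> k x = f k" for k by auto
    then show "f = (\<lambda>k. \<pi> k x)" by auto
  qed
qed

context dg_algebra
begin

lemma mem_cohomology_class:
  "y \<in> cohomology_class A x \<longleftrightarrow> (\<exists>b\<in>coboundaries A. y = b \<oplus> x)"
  by (auto simp: cohomology_class_def a_r_coset_def' )

lemma cohomology_class_self: "x \<in> carrier A \<Longrightarrow> x \<in> cohomology_class A x"
  using coboundaries_closed(1) by (force simp: mem_cohomology_class)

lemma cohomology_class_eq_iff:
  assumes "x \<in> carrier A" "y \<in> carrier A"
  shows "cohomology_class A x = cohomology_class A y \<longleftrightarrow> x \<ominus> y \<in> coboundaries A"
proof
  assume "cohomology_class A x = cohomology_class A y"
  then obtain b where b: "b \<in> coboundaries A" "x = b \<oplus> y"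
    using cohomology_class_self[OF assms(1)] by (auto simp: mem_cohomology_class)
  then have "x \<ominus> y = b" using assms coboundaries_closed(2)[OF b(1)]
    by (simp add: a_minus_def a_assoc r_neg)
  with b show "x \<ominus> y \<in> coboundaries A" by simp
next
  have *: "cohomology_class A u \<subseteq> cohomology_class A v"
    if uv: "u \<in> carrier A" "v \<in> carrier A" "u \<ominus> v \<in> coboundaries A" for u v
  proof
    fix w assume "w \<in> cohomology_class A u"
    then obtain b where b: "b \<in> coboundaries A" "w = b \<oplus> u" by (auto simp: mem_cohomology_class)
    have "w = (b \<oplus> (u \<ominus> v)) \<oplus> v"
      using b(2) uv coboundaries_closed(2)[OF b(1)] by (simp add: a_minus_def a_assoc l_neg)
    then show "w \<in> cohomology_class A v"
      using coboundaries_closed(4)[OF b(1) uv(3)] by (auto simp: mem_cohomology_class)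
  qed
  assume xy: "x \<ominus> y \<in> coboundaries A"
  have "y \<ominus> x = \<ominus> (x \<ominus> y)" using assms by (simp add: a_minus_def minus_add a_comm)
  then have "y \<ominus> x \<in> coboundaries A" using coboundaries_closed(5)[OF xy] by simp
  with * xy assms show "cohomology_class A x = cohomology_class A y" by blast
qed

lemma cohomology_class_zero: "cohomology_class A \<zero> = coboundaries A"
  using coboundaries_closed(2) by (auto simp: mem_cohomology_class)

lemma cohomology_class_eq_zero_iff:
  "x \<in> carrier A \<Longrightarrow> cohomology_class A x = coboundaries A \<longleftrightarrow> x \<in> coboundaries A"
  using cohomology_class_eq_iff[of x \<zero>] by (simp add: cohomology_class_zero a_minus_def)

lemma ring_cocycles: "ring (A\<lparr>carrier := cocycles A\<rparr>)"
  by (rule subring_is_ring, rule subringI) (auto simp: cocycles_closed cocycles_mult)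

lemma ideal_coboundaries: "ideal (coboundaries A) (A\<lparr>carrier := cocycles A\<rparr>)"
proof -
  interpret Z: ring "A\<lparr>carrier := cocycles A\<rparr>" by (rule ring_cocycles)
  show ?thesis
  proof (rule idealI[OF ring_cocycles])
    have inv: "\<ominus>\<^bsub>A\<lparr>carrier := cocycles A\<rparr>\<^esub> x = \<ominus> x" if "x \<in> coboundaries A" for x
      using Z.minus_equality[of "\<ominus> x" x] that coboundaries_closed(3)[OF that]
        cocycles_closed(3,5) by (simp add: l_neg)
    show "subgroup (coboundaries A) (add_monoid (A\<lparr>carrier := cocycles A\<rparr>))"
    proof (rule Z.add.subgroupI)
      show "\<ominus>\<^bsub>A\<lparr>carrier := cocycles A\<rparr>\<^esub> x \<in> coboundaries A"
        if "x \<in> coboundaries A" for x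
        using inv[OF that] coboundaries_closed(5)[OF that] by simp
    qed (use coboundaries_closed in auto)
  qed (simp_all add: coboundaries_mult)
qed

lemma cohomology_ring_hom:
  "cohomology_class A \<in> ring_hom (A\<lparr>carrier := cocycles A\<rparr>) (A\<lparr>carrier := cocycles A\<rparr> Quot coboundaries A)"
proof -
  interpret I: ideal "coboundaries A" "A\<lparr>carrier := cocycles A\<rparr>" by (rule ideal_coboundaries)
  have "cohomology_class A = (+>\<^bsub>A\<lparr>carrier := cocycles A\<rparr>\<^esub>) (coboundaries A)"
    by (simp add: fun_eq_iff cohomology_class_def a_r_coset_def' )
  with I.rcos_ring_hom show ?thesis by simp
qed

lemma carrier_cohomology: "carrier (cohomology A) = cohomology_class A ` cocycles A"
  by (auto simp: cohomology_def FactRing_def A_RCOSETS_def' cohomology_class_def a_r_coset_def' )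

lemma zero_cohomology: "\<zero>\<^bsub>cohomology A\<^esub> = coboundaries A"
  by (simp add: cohomology_def FactRing_def)

lemma hcomp_cohomology:
  "hcomp (cohomology A) k = cohomology_class A ` (cocycles A \<inter> hcomp A k)"
  by (simp add: cohomology_def Let_def)

lemma differential_cohomology: "differential (cohomology A) U = coboundaries A"
  by (simp add: cohomology_def Let_def FactRing_def)

lemma one_cohomology: "\<one>\<^bsub>cohomology A\<^esub> = cohomology_class A \<one>"
  using ring_hom_one[OF cohomology_ring_hom] by (simp add: cohomology_def Let_def)

lemma add_cohomology: "x \<in> cocycles A \<Longrightarrow> y \<in> cocycles A \<Longrightarrow>
    cohomology_class A x \<oplus>\<^bsub>cohomology A\<^esub> cohomology_class A y = cohomology_class A (x \<oplus> y)"
  using ring_hom_add[OF cohomology_ring_hom, of x y] by (simp add: cohomology_def Let_def)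

lemma mult_cohomology: "x \<in> cocycles A \<Longrightarrow> y \<in> cocycles A \<Longrightarrow>
    cohomology_class A x \<otimes>\<^bsub>cohomology A\<^esub> cohomology_class A y = cohomology_class A (x \<otimes> y)"
  using ring_hom_mult[OF cohomology_ring_hom, of x y] by (simp add: cohomology_def Let_def)

lemma Union_cohomology_class:
  assumes x: "x \<in> carrier A"
    and g: "\<And>b. b \<in> coboundaries A \<Longrightarrow> h (b \<oplus> x) = h x"
  shows "(\<Union>y\<in>cohomology_class A x. h y) = h x"
proof -
  have "h y = h x" if y: "y \<in> cohomology_class A x" for y
  proof -
    obtain b where "b \<in> coboundaries A" "y = b \<oplus> x"
      using y unfolding mem_cohomology_class by blast
    then show ?thesis using g by blast
  qed
  then show ?thesis using cohomology_class_self[OF x] by blast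
qed

lemma add_minus_cancel: "b \<in> carrier A \<Longrightarrow> x \<in> carrier A \<Longrightarrow> b \<oplus> x \<ominus> x = b"
  by (simp add: a_minus_def a_assoc r_neg)

lemma smult_cohomology:
  assumes x: "x \<in> cocycles A"
  shows "r \<odot>\<^bsub>cohomology A\<^esub> cohomology_class A x = cohomology_class A (r \<odot> x)"
proof -
  have xc: "x \<in> carrier A" using x cocycles_closed by blast
  have "r \<odot>\<^bsub>cohomology A\<^esub> cohomology_class A x =
      (\<Union>y\<in>cohomology_class A x. cohomology_class A (r \<odot> y))"
    by (simp add: cohomology_def Let_def)
  also have "\<dots> = cohomology_class A (r \<odot> x)"
  proof (rule Union_cohomology_class[OF xc])
    fix b assume b: "b \<in> coboundaries A"
    then have bc: "b \<in> carrier A" by (rule coboundaries_closed)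
    show "cohomology_class A (r \<odot> (b \<oplus> x)) = cohomology_class A (r \<odot> x)"
      using xc bc coboundaries_closed(6)[OF b, of r]
      by (subst cohomology_class_eq_iff) (simp_all add: smult_add_right add_minus_cancel)
  qed
  finally show ?thesis .
qed

lemma ring_cohomology: "ring (cohomology A)"
proof -
  interpret I: ideal "coboundaries A" "A\<lparr>carrier := cocycles A\<rparr>" by (rule ideal_coboundaries)
  show ?thesis by (rule ring_transfer[OF I.quotient_is_ring]) (simp_all add: cohomology_def Let_def)
qed

lemma finsum_cohomology:
  assumes "finite F" "\<And>i. i \<in> F \<Longrightarrow> g i \<in> cocycles A"
  shows "(\<Oplus>\<^bsub>cohomology A\<^esub>i\<in>F. cohomology_class A (g i)) = cohomology_class A (\<Oplus>i\<in>F. g i)"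
    "(\<Oplus>i\<in>F. g i) \<in> cocycles A"
proof -
  interpret H: ring "cohomology A" by (rule ring_cohomology)
  have "(\<Oplus>\<^bsub>cohomology A\<^esub>i\<in>F. cohomology_class A (g i)) = cohomology_class A (\<Oplus>i\<in>F. g i)
      \<and> (\<Oplus>i\<in>F. g i) \<in> cocycles A"
    using assms
  proof (induction F rule: finite_induct)
    case empty
    then show ?case by (simp add: zero_cohomology cohomology_class_zero cocycles_closed)
  next
    case (insert i F)
    have "g \<in> F \<rightarrow> carrier A" "(\<lambda>i. cohomology_class A (g i)) \<in> F \<rightarrow> carrier (cohomology A)"
      using insert.prems cocycles_closed(3) by (auto simp: carrier_cohomology)
    with insert show ?case
      by (simp add: carrier_cohomology add_cohomology cocycles_closed)
  qed
  then show "(\<Oplus>\<^bsub>cohomology A\<^esub>i\<in>F. cohomology_class A (g i)) = cohomology_class A (\<Oplus>i\<in>F. g i)"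
    "(\<Oplus>i\<in>F. g i) \<in> cocycles A" by blast+
qed

lemma dg_algebra_cohomology: "dg_algebra (cohomology A)"
proof -
  interpret H: ring "cohomology A" by (rule ring_cohomology)
  let ?H = "cohomology A" and ?c = "cohomology_class A"
  have zero: "\<zero>\<^bsub>?H\<^esub> = ?c \<zero>" by (simp add: zero_cohomology cohomology_class_zero)
  have car: "\<exists>x. U = ?c x \<and> x \<in> cocycles A \<and> x \<in> carrier A" if "U \<in> carrier ?H" for U
    using that cocycles_closed(3) by (auto simp: carrier_cohomology)
  have hom: "\<exists>x. U = ?c x \<and> x \<in> cocycles A \<and> x \<in> hcomp A k \<and> x \<in> carrier A"
    if "U \<in> hcomp ?H k" for U k
    using that cocycles_closed(3) by (auto simp: hcomp_cohomology)
  note ops = add_cohomology mult_cohomology smult_cohomology cocycles_closed cocycles_mult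
  show ?thesis
  proof (intro dg_algebra.intro dg_algebra_axioms.intro ring_cohomology)
    show "r \<odot>\<^bsub>?H\<^esub> U \<in> carrier ?H" if "U \<in> carrier ?H" for r U
      using car[OF that] by (auto simp: ops carrier_cohomology)
    show "(r + s) \<odot>\<^bsub>?H\<^esub> U = r \<odot>\<^bsub>?H\<^esub> U \<oplus>\<^bsub>?H\<^esub> s \<odot>\<^bsub>?H\<^esub> U" if "U \<in> carrier ?H" for r s U
      using car[OF that] by (auto simp: ops smult_add_left)
    show "r \<odot>\<^bsub>?H\<^esub> (U \<oplus>\<^bsub>?H\<^esub> W) = r \<odot>\<^bsub>?H\<^esub> U \<oplus>\<^bsub>?H\<^esub> r \<odot>\<^bsub>?H\<^esub> W"
      if "U \<in> carrier ?H" "W \<in> carrier ?H" for r U W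
      using car[OF that(1)] car[OF that(2)] by (auto simp: ops smult_add_right)
    show "r \<odot>\<^bsub>?H\<^esub> (s \<odot>\<^bsub>?H\<^esub> U) = (r * s) \<odot>\<^bsub>?H\<^esub> U" if "U \<in> carrier ?H" for r s U
      using car[OF that] by (auto simp: ops smult_smult)
    show "1 \<odot>\<^bsub>?H\<^esub> U = U" if "U \<in> carrier ?H" for U
      using car[OF that] by (auto simp: ops)
    show "(r \<odot>\<^bsub>?H\<^esub> U) \<otimes>\<^bsub>?H\<^esub> W = r \<odot>\<^bsub>?H\<^esub> (U \<otimes>\<^bsub>?H\<^esub> W)"
      if "U \<in> carrier ?H" "W \<in> carrier ?H" for r U W
      using car[OF that(1)] car[OF that(2)] by (auto simp: ops smult_mult_left)
    show "U \<otimes>\<^bsub>?H\<^esub> (r \<odot>\<^bsub>?H\<^esub> W) = r \<odot>\<^bsub>?H\<^esub> (U \<otimes>\<^bsub>?H\<^esub> W)"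
      if "U \<in> carrier ?H" "W \<in> carrier ?H" for r U W
      using car[OF that(1)] car[OF that(2)] by (auto simp: ops smult_mult_right)
    show hc: "U \<in> carrier ?H" if "U \<in> hcomp ?H k" for U k
      using hom[OF that] by (auto simp: carrier_cohomology)
    show hz: "\<zero>\<^bsub>?H\<^esub> \<in> hcomp ?H k" for k
      by (simp add: zero hcomp_cohomology cocycles_closed)
    show "r \<odot>\<^bsub>?H\<^esub> U \<in> hcomp ?H k" if "U \<in> hcomp ?H k" for r U k
      using hom[OF that] by (auto simp: ops hcomp_cohomology)
    show "U \<oplus>\<^bsub>?H\<^esub> W \<in> hcomp ?H k" if "U \<in> hcomp ?H k" "W \<in> hcomp ?H k" for U W k
      using hom[OF that(1)] hom[OF that(2)] by (auto simp: ops hcomp_cohomology)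
    show "\<one>\<^bsub>?H\<^esub> \<in> hcomp ?H 0"
      using one_hcomp by (auto simp: one_cohomology hcomp_cohomology cocycles_closed)
    show "U \<otimes>\<^bsub>?H\<^esub> W \<in> hcomp ?H (i + j)" if "U \<in> hcomp ?H i" "W \<in> hcomp ?H j" for U W i j
      using hom[OF that(1)] hom[OF that(2)] mult_hcomp by (auto simp: ops hcomp_cohomology)
    show "U \<otimes>\<^bsub>?H\<^esub> W = (- 1) ^ (i * j) \<odot>\<^bsub>?H\<^esub> (W \<otimes>\<^bsub>?H\<^esub> U)"
      if "U \<in> hcomp ?H i" "W \<in> hcomp ?H j" for U W i j
      using hom[OF that(1)] hom[OF that(2)] graded_commute[of _ i _ j] by (auto simp: ops)
    show "differential ?H (U \<oplus>\<^bsub>?H\<^esub> W) = differential ?H U \<oplus>\<^bsub>?H\<^esub> differential ?H W" for U W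
      by (simp add: differential_cohomology flip: zero_cohomology)
    have s0: "r \<odot>\<^bsub>?H\<^esub> \<zero>\<^bsub>?H\<^esub> = \<zero>\<^bsub>?H\<^esub>" for r by (simp add: zero ops)
    then show "differential ?H (r \<odot>\<^bsub>?H\<^esub> U) = r \<odot>\<^bsub>?H\<^esub> differential ?H U" for r U
      by (simp add: differential_cohomology flip: zero_cohomology)
    show "differential ?H U \<in> hcomp ?H (Suc k)" for U k
      using hz[of "Suc k"] by (simp add: differential_cohomology zero_cohomology)
    show "differential ?H (differential ?H U) = \<zero>\<^bsub>?H\<^esub>" for U
      by (simp add: differential_cohomology zero_cohomology)
    show "differential ?H (U \<otimes>\<^bsub>?H\<^esub> W) = differential ?H U \<otimes>\<^bsub>?H\<^esub> W \<oplus>\<^bsub>?H\<^esub>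
        (- 1) ^ i \<odot>\<^bsub>?H\<^esub> (U \<otimes>\<^bsub>?H\<^esub> differential ?H W)"
      if "U \<in> hcomp ?H i" "W \<in> carrier ?H" for U W i
      using hc[OF that(1)] that(2) by (simp add: differential_cohomology s0 flip: zero_cohomology)
    \<comment> \<open>The projections of the cohomology are induced by those of the algebra.\<close>
    define \<pi> where "\<pi> k U = (\<Union>x\<in>U. ?c (component A k x))" for k U
    have \<pi>: "\<pi> k (?c x) = ?c (component A k x)" if "x \<in> cocycles A" for k x
      unfolding \<pi>_def
    proof (rule Union_cohomology_class)
      show xc: "x \<in> carrier A" using that by (rule cocycles_closed)
      fix b assume b: "b \<in> coboundaries A"
      then have bc: "b \<in> carrier A" by (rule coboundaries_closed)
      show "?c (component A k (b \<oplus> x)) = ?c (component A k x)"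
        using xc bc coboundaries_closed(7)[OF b, of k]
        by (subst cohomology_class_eq_iff) (simp_all add: component_add add_minus_cancel)
    qed
    fix U assume "U \<in> carrier ?H"
    then show "\<exists>!f. (\<forall>k. f k \<in> hcomp ?H k) \<and> finite {k. f k \<noteq> \<zero>\<^bsub>?H\<^esub>} \<and>
        U = (\<Oplus>\<^bsub>?H\<^esub>k\<in>{k. f k \<noteq> \<zero>\<^bsub>?H\<^esub>}. f k)"
    proof (rule direct_sum_of_projections[OF H.abelian_monoid_axioms, where \<pi> = \<pi>, rotated -1])
      show "hcomp ?H k \<subseteq> carrier ?H" for k using hc by blast
      show "\<zero>\<^bsub>?H\<^esub> \<in> hcomp ?H k" for k by (rule hz)
      show "\<pi> k (U \<oplus>\<^bsub>?H\<^esub> W) = \<pi> k U \<oplus>\<^bsub>?H\<^esub> \<pi> k W"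
        if "U \<in> carrier ?H" "W \<in> carrier ?H" for k U W
        using car[OF that(1)] car[OF that(2)] by (auto simp: ops \<pi> component_add)
      show "\<pi> k U \<in> hcomp ?H k" if "U \<in> carrier ?H" for k U
        using car[OF that] by (auto simp: \<pi> hcomp_cohomology ops)
      show "\<pi> k U = (if k = j then U else \<zero>\<^bsub>?H\<^esub>)" if "U \<in> hcomp ?H j" for j k U
        using hom[OF that] by (auto simp: \<pi> component_homogeneous zero)
      assume "U \<in> carrier ?H"
      then obtain x where x: "U = ?c x" "x \<in> cocycles A" "x \<in> carrier A" using car by blast
      obtain F where F: "finite F" "\<forall>k. k \<notin> F \<longrightarrow> component A k x = \<zero>"
        "x = (\<Oplus>k\<in>F. component A k x)"
        using component_decomposition(1)[OF x(3)] by blast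
      have \<pi>U: "\<pi> k U = ?c (component A k x)" for k using x \<pi> by simp
      have "U = ?c (\<Oplus>k\<in>F. component A k x)" using x(1) arg_cong[OF F(3), of ?c] by (rule trans)
      also have "\<dots> = (\<Oplus>\<^bsub>?H\<^esub>k\<in>F. \<pi> k U)"
        unfolding \<pi>U
        by (rule finsum_cohomology(1)[symmetric]) (simp_all add: F(1) cocycles_closed(7)[OF x(2)])
      finally have "U = (\<Oplus>\<^bsub>?H\<^esub>k\<in>F. \<pi> k U)" .
      then show "\<exists>F. finite F \<and> (\<forall>k. k \<notin> F \<longrightarrow> \<pi> k U = \<zero>\<^bsub>?H\<^esub>) \<and> U = (\<Oplus>\<^bsub>?H\<^esub>k\<in>F. \<pi> k U)"
        using F(1,2) \<pi>U zero by (intro exI[of _ F] conjI) simp_all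
    qed
  qed
qed

end


section \<open>Quasi-isomorphisms\<close>

locale dga_quasi_iso = A: dg_algebra A + B: dg_algebra B
  for A :: "'a dga" and B :: "'b dga" and f :: "'a \<Rightarrow> 'b" +
  assumes quasi_isomorphism: "quasi_isomorphism A B f"
begin

lemma ring_hom_f: "f \<in> ring_hom A B"
  and f_smult: "x \<in> carrier A \<Longrightarrow> f (r \<odot>\<^bsub>A\<^esub> x) = r \<odot>\<^bsub>B\<^esub> f x"
  and f_hcomp: "x \<in> hcomp A k \<Longrightarrow> f x \<in> hcomp B k"
  and f_d: "x \<in> carrier A \<Longrightarrow> f (differential A x) = differential B (f x)"
  using quasi_isomorphism by (auto simp: quasi_isomorphism_def dga_hom_def image_subset_iff)

lemma f_closed [simp, intro]: "x \<in> carrier A \<Longrightarrow> f x \<in> carrier B"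
  and f_add: "x \<in> carrier A \<Longrightarrow> y \<in> carrier A \<Longrightarrow> f (x \<oplus>\<^bsub>A\<^esub> y) = f x \<oplus>\<^bsub>B\<^esub> f y"
  and f_mult: "x \<in> carrier A \<Longrightarrow> y \<in> carrier A \<Longrightarrow> f (x \<otimes>\<^bsub>A\<^esub> y) = f x \<otimes>\<^bsub>B\<^esub> f y"
  using ring_hom_f by (auto simp: ring_hom_def)

lemma f_zero [simp]: "f \<zero>\<^bsub>A\<^esub> = \<zero>\<^bsub>B\<^esub>"
  using f_smult[of "\<zero>\<^bsub>A\<^esub>" 0] B.smult_0[OF f_closed[OF A.zero_closed]] by simp

lemma f_minus: "x \<in> carrier A \<Longrightarrow> f (\<ominus>\<^bsub>A\<^esub> x) = \<ominus>\<^bsub>B\<^esub> f x"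
  using f_smult[of x "-1"] by (simp add: A.smult_minus_one B.smult_minus_one)

lemma f_diff: "x \<in> carrier A \<Longrightarrow> y \<in> carrier A \<Longrightarrow> f (x \<ominus>\<^bsub>A\<^esub> y) = f x \<ominus>\<^bsub>B\<^esub> f y"
  by (simp add: a_minus_def f_add f_minus)

lemma f_finsum:
  "finite F \<Longrightarrow> g \<in> F \<rightarrow> carrier A \<Longrightarrow> f (\<Oplus>\<^bsub>A\<^esub>i\<in>F. g i) = (\<Oplus>\<^bsub>B\<^esub>i\<in>F. f (g i))"
proof (induction F rule: finite_induct)
  case (insert i F)
  then have "(\<lambda>i. f (g i)) \<in> F \<rightarrow> carrier B" by auto
  with insert show ?case by (simp add: f_add Pi_def)
qed simp

lemma f_cocycles: "x \<in> cocycles A \<Longrightarrow> f x \<in> cocycles B"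
  using f_d[of x] by (simp add: cocycles_def)

lemma f_coboundaries: "x \<in> coboundaries A \<Longrightarrow> f x \<in> coboundaries B"
  by (auto simp: coboundaries_def f_d)

lemma f_component:
  assumes x: "x \<in> carrier A"
  shows "component B k (f x) = f (component A k x)"
proof -
  obtain F where F: "finite F" "\<forall>k. k \<notin> F \<longrightarrow> component A k x = \<zero>\<^bsub>A\<^esub>"
    "x = (\<Oplus>\<^bsub>A\<^esub>k\<in>F. component A k x)"
    using A.component_decomposition(1)[OF x] by blast
  have "f x = (\<Oplus>\<^bsub>B\<^esub>k\<in>F. f (component A k x))"
    by (rule trans[OF arg_cong[OF F(3), of f] f_finsum]) (use F(1) x in auto)
  from B.component_eq[OF _ F(1) _ this] show ?thesis
    using F(2) x f_hcomp by auto
qed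

lemma cohomology_map_class:
  assumes x: "x \<in> cocycles A"
  shows "cohomology_map A B f (cohomology_class A x) = cohomology_class B (f x)"
  unfolding cohomology_map_def
proof (rule A.Union_cohomology_class)
  show xc: "x \<in> carrier A" using x by (rule A.cocycles_closed)
  fix b assume b: "b \<in> coboundaries A"
  then have bc: "b \<in> carrier A" by (rule A.coboundaries_closed)
  show "cohomology_class B (f (b \<oplus>\<^bsub>A\<^esub> x)) = cohomology_class B (f x)"
    using xc bc f_coboundaries[OF b]
    by (subst B.cohomology_class_eq_iff) (simp_all add: f_add B.add_minus_cancel)
qed

lemma exact_if_image_exact:
  assumes x: "x \<in> cocycles A" and fx: "f x \<in> coboundaries B"
  shows "x \<in> coboundaries A"
proof -
  have xc: "x \<in> carrier A" using x by (rule A.cocycles_closed)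
  have "cohomology_class B (f x) = cohomology_class B (f \<zero>\<^bsub>A\<^esub>)"
    using fx xc by (simp add: B.cohomology_class_eq_zero_iff B.cohomology_class_zero)
  then have "cohomology_map A B f (cohomology_class A x) =
      cohomology_map A B f (cohomology_class A \<zero>\<^bsub>A\<^esub>)"
    using x by (simp add: cohomology_map_class A.cocycles_closed)
  moreover have "inj_on (cohomology_map A B f) (carrier (cohomology A))"
    using quasi_isomorphism by (simp add: quasi_isomorphism_def bij_betw_def)
  ultimately have "cohomology_class A x = cohomology_class A \<zero>\<^bsub>A\<^esub>"
    using x A.cocycles_closed(1) by (auto simp: inj_on_def A.carrier_cohomology)
  with xc show ?thesis by (simp add: A.cohomology_class_eq_zero_iff A.cohomology_class_zero)
qed

lemma homogeneous_preimage:
  assumes y: "y \<in> cocycles B" "y \<in> hcomp B k"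
  obtains x where "x \<in> cocycles A" "x \<in> hcomp A k" "y \<ominus>\<^bsub>B\<^esub> f x \<in> coboundaries B"
proof -
  have "cohomology_class B y \<in> cohomology_map A B f ` carrier (cohomology A)"
    using quasi_isomorphism y by (simp add: quasi_isomorphism_def bij_betw_def B.carrier_cohomology)
  then obtain U where U: "U \<in> carrier (cohomology A)" "cohomology_class B y = cohomology_map A B f U"
    by blast
  from U(1) obtain x where x': "x \<in> cocycles A" "U = cohomology_class A x"
    unfolding A.carrier_cohomology by blast
  then have x: "x \<in> cocycles A" "cohomology_class B y = cohomology_class B (f x)"
    using U(2) by (simp_all add: cohomology_map_class)
  have c: "x \<in> carrier A" "y \<in> carrier B"
    using A.cocycles_closed(3)[OF x(1)] B.cocycles_closed(3)[OF y(1)] .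
  then have "y \<ominus>\<^bsub>B\<^esub> f x \<in> coboundaries B" using x(2) by (simp add: B.cohomology_class_eq_iff)
  then have "component B k (y \<ominus>\<^bsub>B\<^esub> f x) \<in> coboundaries B" by (rule B.coboundaries_closed)
  then have "y \<ominus>\<^bsub>B\<^esub> f (component A k x) \<in> coboundaries B"
    using c y(2) by (simp add: a_minus_def B.component_add B.component_minus
      B.component_homogeneous f_component)
  then show ?thesis by (rule that[OF A.cocycles_closed(7)[OF x(1)] A.component_hcomp[OF c(1)]])
qed

end

lemma quasi_isomorphism_id:
  assumes "dg_algebra A"
  shows "quasi_isomorphism A A id"
proof -
  interpret dg_algebra A by fact
  have "cohomology_map A A id U = U" if "U \<in> carrier (cohomology A)" for U
  proof -
    obtain x where x: "U = cohomology_class A x" "x \<in> cocycles A"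
      using \<open>U \<in> carrier (cohomology A)\<close> by (auto simp: carrier_cohomology)
    have xc: "x \<in> carrier A" using x(2) by (rule cocycles_closed)
    have "(\<Union>y\<in>cohomology_class A x. cohomology_class A (id y)) = cohomology_class A (id x)"
    proof (rule Union_cohomology_class[OF xc])
      fix b assume "b \<in> coboundaries A"
      then show "cohomology_class A (id (b \<oplus>\<^bsub>A\<^esub> x)) = cohomology_class A (id x)"
        using xc coboundaries_closed(2)[of b]
        by (subst cohomology_class_eq_iff) (simp_all add: add_minus_cancel)
    qed
    with x show ?thesis by (simp add: cohomology_map_def)
  qed
  then have "bij_betw (cohomology_map A A id) (carrier (cohomology A)) (carrier (cohomology A))"
    by (subst bij_betw_cong[where g = id]) auto
  then show ?thesis by (auto simp: quasi_isomorphism_def dga_hom_def ring_hom_def)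
qed

section \<open>Massey products and formality\<close>

lemma massey_degree_diag [simp]: "massey_degree ps i i = ps ! i"
  by (simp add: massey_degree_def)

lemma massey_degree_less:
  assumes pos: "\<And>l. l < n \<Longrightarrow> 1 \<le> ps ! l" and "i \<le> j" "j < n"
  shows "j - i < (\<Sum>l=i..j. ps ! l)"
proof -
  have "j - i < (\<Sum>l=i..j. 1)" using \<open>i \<le> j\<close> by simp
  also have "\<dots> \<le> (\<Sum>l=i..j. ps ! l)" using assms by (intro sum_mono) auto
  finally show ?thesis .
qed

lemma massey_degree_pos:
  assumes "\<And>l. l < n \<Longrightarrow> 1 \<le> ps ! l" "i \<le> j" "j < n"
  shows "0 < massey_degree ps i j"
  using massey_degree_less[of n ps i j] assms by (simp add: massey_degree_def)

lemma massey_degree_split: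
  assumes pos: "\<And>l. l < n \<Longrightarrow> 1 \<le> ps ! l" and "i \<le> k" "k < j" "j < n"
  shows "massey_degree ps i k + massey_degree ps (Suc k) j = Suc (massey_degree ps i j)"
proof -
  have "{i..j} = {i..k} \<union> {Suc k..j}" "{i..k} \<inter> {Suc k..j} = {}" using assms by auto
  then have "(\<Sum>l=i..j. ps ! l) = (\<Sum>l=i..k. ps ! l) + (\<Sum>l=Suc k..j. ps ! l)"
    by (simp add: sum.union_disjoint)
  moreover have "k - i < (\<Sum>l=i..k. ps ! l)" "j - Suc k < (\<Sum>l=Suc k..j. ps ! l)"
    using assms massey_degree_less[OF pos] by auto
  ultimately show ?thesis using assms by (simp add: massey_degree_def)
qed

text \<open>A full defining system also has the entry \<open>(0, n - 1)\<close>, whose differential is the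
  representative of the Massey product; so the product contains 0 if and only if there is a full
  defining system.\<close>

definition full_defining_system :: "'a dga \<Rightarrow> nat list \<Rightarrow> nat \<Rightarrow> (nat \<Rightarrow> nat \<Rightarrow> 'a) \<Rightarrow> bool" where
  "full_defining_system A ps n m \<longleftrightarrow> (\<forall>i j. i \<le> j \<and> j < n \<longrightarrow>
     m i j \<in> hcomp A (massey_degree ps i j) \<and> differential A (m i j) = massey_sum A ps m i j)"

lemma sign_Suc:
  assumes "p + q = Suc r"
  shows "(- 1 :: real) ^ q = - ((- 1) ^ (r + p))"
proof -
  have "Suc (r + p) = q + 2 * p" using assms by simp
  then have "(- 1 :: real) ^ Suc (r + p) = (- 1) ^ (q + 2 * p)" by (rule arg_cong)
  then show ?thesis by (simp add: power_add power_mult)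
qed

lemma sign_Suc_add:
  assumes "p + q = Suc r" "p = Suc k"
  shows "(- 1 :: real) ^ r * (- 1) ^ k = (- 1) ^ q"
proof -
  have "r = q + k" using assms by simp
  then show ?thesis by (simp add: power_add mult.assoc)
qed

context dg_algebra
begin

abbreviation (input) massey_term ::
  "nat list \<Rightarrow> (nat \<Rightarrow> nat \<Rightarrow> 'a) \<Rightarrow> nat \<Rightarrow> nat \<Rightarrow> nat \<Rightarrow> 'a" where
  "massey_term ps m i j k \<equiv> ((- 1) ^ massey_degree ps i k \<odot> m i k) \<otimes> m (Suc k) j"

lemma massey_sum_cong:
  assumes "\<And>k. i \<le> k \<Longrightarrow> k < j \<Longrightarrow> m i k = m' i k"
    "\<And>k. i \<le> k \<Longrightarrow> k < j \<Longrightarrow> m (Suc k) j = m' (Suc k) j"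
    "\<And>k. i \<le> k \<Longrightarrow> k < j \<Longrightarrow> m' i k \<in> carrier A"
    "\<And>k. i \<le> k \<Longrightarrow> k < j \<Longrightarrow> m' (Suc k) j \<in> carrier A"
  shows "massey_sum A ps m i j = massey_sum A ps m' i j"
  unfolding massey_sum_def by (rule add.finprod_cong') (use assms in auto)

lemma massey_sum_diag [simp]: "massey_sum A ps m i i = \<zero>"
  by (simp add: massey_sum_def)

lemma massey_sum_hcomp:
  assumes pos: "\<And>l. l < n \<Longrightarrow> 1 \<le> ps ! l" and ij: "i \<le> j" "j < n"
    and m: "\<And>a b. i \<le> a \<Longrightarrow> a \<le> b \<Longrightarrow> b \<le> j \<Longrightarrow> (a, b) \<noteq> (i, j) \<Longrightarrow>
      m a b \<in> hcomp A (massey_degree ps a b)"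
  shows "massey_sum A ps m i j \<in> hcomp A (Suc (massey_degree ps i j))"
  unfolding massey_sum_def
proof (rule hcomp_finsum)
  fix k assume k: "k \<in> {i..<j}"
  then have "massey_term ps m i j k \<in> hcomp A (massey_degree ps i k + massey_degree ps (Suc k) j)"
    using ij m[of i k] m[of "Suc k" j] by (intro mult_hcomp hcomp_closed) auto
  then show "massey_term ps m i j k \<in> hcomp A (Suc (massey_degree ps i j))"
    using massey_degree_split[OF pos, of n i k j] k ij by simp
qed simp

lemma finsum_split_at:
  assumes "i \<le> j" "j < l" "\<And>k. g k \<in> carrier A"
  shows "(\<Oplus>k\<in>{i..<l}. g k) = (\<Oplus>k\<in>{i..<j}. g k) \<oplus> (g j \<oplus> (\<Oplus>k\<in>{Suc j..<l}. g k))"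
proof -
  have "{i..<l} = {i..<j} \<union> insert j {Suc j..<l}" using assms by auto
  moreover have "(\<Oplus>k\<in>{i..<j} \<union> insert j {Suc j..<l}. g k) =
      (\<Oplus>k\<in>{i..<j}. g k) \<oplus> (\<Oplus>k\<in>insert j {Suc j..<l}. g k)"
    by (rule add.finprod_Un_disjoint) (use assms in auto)
  moreover have "(\<Oplus>k\<in>insert j {Suc j..<l}. g k) = g j \<oplus> (\<Oplus>k\<in>{Suc j..<l}. g k)"
    by (rule add.finprod_insert) (use assms in auto)
  ultimately show ?thesis by simp
qed

lemma finsum_eq_zero: "(\<And>k. k \<in> F \<Longrightarrow> g k = \<zero>) \<Longrightarrow> (\<Oplus>k\<in>F. g k) = \<zero>"
  by (rule add.finprod_one_eqI) simp

lemma finsum_triangle_swap: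
  assumes g: "\<And>s t. g s t \<in> carrier A"
  shows "(\<Oplus>t\<in>{i..<j::nat}. \<Oplus>s\<in>{i..<t}. g s t) = (\<Oplus>s\<in>{i..<j}. \<Oplus>t\<in>{Suc s..<j}. g s t)"
proof (induction j)
  case (Suc j)
  show ?case
  proof (cases "i \<le> j")
    case True
    have ivl: "{i..<Suc j} = insert j {i..<j}" using True by auto
    have "(\<Oplus>s\<in>{i..<j}. \<Oplus>t\<in>{Suc s..<Suc j}. g s t) =
        (\<Oplus>s\<in>{i..<j}. g s j \<oplus> (\<Oplus>t\<in>{Suc s..<j}. g s t))"
    proof (rule add.finprod_cong')
      fix s assume "s \<in> {i..<j}"
      then have "{Suc s..<Suc j} = insert j {Suc s..<j}" by auto
      then show "(\<Oplus>t\<in>{Suc s..<Suc j}. g s t) = g s j \<oplus> (\<Oplus>t\<in>{Suc s..<j}. g s t)"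
        using g by simp
    qed (use g in auto)
    also have "\<dots> = (\<Oplus>s\<in>{i..<j}. g s j) \<oplus> (\<Oplus>s\<in>{i..<j}. \<Oplus>t\<in>{Suc s..<j}. g s t)"
      by (rule finsum_addf) (use g in auto)
    finally show ?thesis using Suc g by (simp add: ivl)
  qed simp
qed simp

lemma massey_sum_closed_form:
  assumes pos: "\<And>l. l < n \<Longrightarrow> 1 \<le> ps ! l" and ij: "i \<le> j" "j < n"
    and m: "\<And>a b. i \<le> a \<Longrightarrow> a \<le> b \<Longrightarrow> b \<le> j \<Longrightarrow> (a, b) \<noteq> (i, j) \<Longrightarrow>
      m a b \<in> hcomp A (massey_degree ps a b) \<and> differential A (m a b) = massey_sum A ps m a b"
  shows "differential A (massey_sum A ps m i j) = \<zero>"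
proof -
  let ?D = "massey_degree ps"
  \<comment> \<open>Entries outside the triangle are irrelevant; they are replaced by 0 to make every product
    well defined.\<close>
  define m' where "m' a b = (if i \<le> a \<and> a \<le> b \<and> b \<le> j \<and> (a, b) \<noteq> (i, j) then m a b else \<zero>)" for a b
  have h: "m' a b \<in> hcomp A (?D a b)" for a b using m by (auto simp: m'_def)
  have c [simp]: "m' a b \<in> carrier A" for a b using h hcomp_carrier by blast
  have S: "massey_sum A ps m i j = massey_sum A ps m' i j"
    by (rule massey_sum_cong[OF _ _ c c]) (use ij in \<open>auto simp: m'_def\<close>)
  have d: "differential A (m' a b) = massey_sum A ps m' a b"
    if "i \<le> a" "a \<le> b" "b \<le> j" "(a, b) \<noteq> (i, j)" for a b
  proof -
    have "massey_sum A ps m a b = massey_sum A ps m' a b"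
      by (rule massey_sum_cong[OF _ _ c c]) (use that in \<open>auto simp: m'_def\<close>)
    then show ?thesis using m[OF that] that by (simp add: m'_def)
  qed
  define g where "g s t = ((- 1) ^ (?D i t + ?D i s)) \<odot> (m' i s \<otimes> m' (Suc s) t \<otimes> m' (Suc t) j)" for s t
  have gc [simp]: "g s t \<in> carrier A" for s t by (simp add: g_def)
  have "differential A (massey_term ps m' i j t) =
      (\<Oplus>s\<in>{i..<t}. g s t) \<oplus> (\<Oplus>s\<in>{Suc t..<j}. \<ominus> g t s)" if t: "t \<in> {i..<j}" for t
  proof -
    have dt: "differential A (m' i t) = massey_sum A ps m' i t"
        "differential A (m' (Suc t) j) = massey_sum A ps m' (Suc t) j"
      by (rule d; use t ij in auto)+
    have Sc: "massey_sum A ps m' i t \<in> carrier A" "massey_sum A ps m' (Suc t) j \<in> carrier A"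
      unfolding dt[symmetric] by simp_all
    have "differential A (massey_term ps m' i j t) =
        (- 1) ^ ?D i t \<odot> (massey_sum A ps m' i t \<otimes> m' (Suc t) j) \<oplus>
        m' i t \<otimes> massey_sum A ps m' (Suc t) j"
      using leibniz[OF hcomp_closed(2)[OF h], of "m' (Suc t) j" "(- 1) ^ ?D i t" i t] Sc
      by (simp add: differential_smult smult_mult_left smult_smult dt)
    moreover have "(- 1) ^ ?D i t \<odot> (massey_sum A ps m' i t \<otimes> m' (Suc t) j) = (\<Oplus>s\<in>{i..<t}. g s t)"
      unfolding massey_sum_def
    proof -
      have "(\<Oplus>s\<in>{i..<t}. massey_term ps m' i t s) \<otimes> m' (Suc t) j =
          (\<Oplus>s\<in>{i..<t}. massey_term ps m' i t s \<otimes> m' (Suc t) j)"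
        by (rule finsum_ldistr) auto
      then have "(- 1) ^ ?D i t \<odot> ((\<Oplus>s\<in>{i..<t}. massey_term ps m' i t s) \<otimes> m' (Suc t) j) =
          (\<Oplus>s\<in>{i..<t}. (- 1) ^ ?D i t \<odot> (massey_term ps m' i t s \<otimes> m' (Suc t) j))"
        using finsum_smult[of "{i..<t}" "\<lambda>s. massey_term ps m' i t s \<otimes> m' (Suc t) j" "(- 1) ^ ?D i t"]
        by auto
      also have "\<dots> = (\<Oplus>s\<in>{i..<t}. g s t)"
        by (rule add.finprod_cong') (auto simp: g_def smult_mult_left smult_smult power_add)
      finally show "(- 1) ^ ?D i t \<odot> ((\<Oplus>s\<in>{i..<t}. massey_term ps m' i t s) \<otimes> m' (Suc t) j) =
          (\<Oplus>s\<in>{i..<t}. g s t)" .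
    qed
    moreover have "m' i t \<otimes> massey_sum A ps m' (Suc t) j = (\<Oplus>s\<in>{Suc t..<j}. \<ominus> g t s)"
      unfolding massey_sum_def
    proof (rule trans[OF finsum_rdistr add.finprod_cong'])
      fix s assume s: "s \<in> {Suc t..<j}"
      then have "?D i t + ?D (Suc t) s = Suc (?D i s)"
        using massey_degree_split[OF pos, of n i t s] t ij by simp
      then have "(- 1 :: real) ^ ?D (Suc t) s = - ((- 1) ^ (?D i s + ?D i t))"
        by (rule sign_Suc)
      then show "m' i t \<otimes> massey_term ps m' (Suc t) j s = \<ominus> g t s"
        by (simp add: g_def smult_mult_left smult_mult_right smult_minus_left m_assoc l_minus r_minus)
    qed simp_all
    ultimately show ?thesis by simp
  qed
  then have "differential A (massey_sum A ps m' i j) =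
      (\<Oplus>t\<in>{i..<j}. (\<Oplus>s\<in>{i..<t}. g s t) \<oplus> (\<Oplus>s\<in>{Suc t..<j}. \<ominus> g t s))"
    unfolding massey_sum_def
    by (intro trans[OF d_finsum add.finprod_cong']) auto
  also have "\<dots> = (\<Oplus>t\<in>{i..<j}. \<Oplus>s\<in>{i..<t}. g s t) \<oplus> (\<Oplus>t\<in>{i..<j}. \<Oplus>s\<in>{Suc t..<j}. \<ominus> g t s)"
    by (rule finsum_addf) auto
  also have "\<dots> = (\<Oplus>t\<in>{i..<j}. \<Oplus>s\<in>{Suc t..<j}. g t s) \<oplus> (\<Oplus>t\<in>{i..<j}. \<Oplus>s\<in>{Suc t..<j}. \<ominus> g t s)"
    by (simp add: finsum_triangle_swap)
  also have "\<dots> = (\<Oplus>t\<in>{i..<j}. (\<Oplus>s\<in>{Suc t..<j}. g t s) \<oplus> (\<Oplus>s\<in>{Suc t..<j}. \<ominus> g t s))"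
    by (rule finsum_addf[symmetric]) auto
  also have "\<dots> = \<zero>"
  proof (rule finsum_eq_zero)
    fix t
    have "(\<Oplus>s\<in>{Suc t..<j}. g t s) \<oplus> (\<Oplus>s\<in>{Suc t..<j}. \<ominus> g t s) =
        (\<Oplus>s\<in>{Suc t..<j}. g t s \<oplus> \<ominus> g t s)"
      by (rule finsum_addf[symmetric]) auto
    then show "(\<Oplus>s\<in>{Suc t..<j}. g t s) \<oplus> (\<Oplus>s\<in>{Suc t..<j}. \<ominus> g t s) = \<zero>"
      by (simp add: r_neg)
  qed
  finally show ?thesis by (simp add: S)
qed

end

text \<open>A defining system is a strictly upper triangular matrix \<open>m\<close> with \<open>dm = m\<^sup>- m\<close>, where the
  bar multiplies each entry by the sign of its degree. Conjugation by the elementary unipotent matrix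
  with the single entry \<open>c\<close>, corrected by the differential of that matrix, changes the entry
  \<open>(i, j)\<close> by \<open>dc\<close> and otherwise only entries that belong to longer index intervals.\<close>

definition gauge_move ::
  "'a dga \<Rightarrow> nat \<Rightarrow> nat \<Rightarrow> nat \<Rightarrow> 'a \<Rightarrow> (nat \<Rightarrow> nat \<Rightarrow> 'a) \<Rightarrow> nat \<Rightarrow> nat \<Rightarrow> 'a" where
  "gauge_move A i j k c m a b =
     (if a = i \<and> b = j then m i j \<oplus>\<^bsub>A\<^esub> differential A c
      else if a = i \<and> j < b then m i b \<ominus>\<^bsub>A\<^esub> ((- 1) ^ k \<odot>\<^bsub>A\<^esub> c) \<otimes>\<^bsub>A\<^esub> m (Suc j) b
      else if a < i \<and> b = j then m a j \<oplus>\<^bsub>A\<^esub> m a (i - 1) \<otimes>\<^bsub>A\<^esub> c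
      else m a b)"

context dg_algebra
begin

lemma gauge_move_sum:
  assumes "a \<le> b" "\<And>t. t \<in> {a..<b} \<Longrightarrow> massey_term ps m' a b t = massey_term ps m a b t \<oplus> E t"
    and "\<And>t. E t \<in> carrier A" "\<And>t. t \<in> {a..<b} \<Longrightarrow> massey_term ps m a b t \<in> carrier A"
  shows "massey_sum A ps m' a b = massey_sum A ps m a b \<oplus> (\<Oplus>t\<in>{a..<b}. E t)"
proof -
  have "massey_sum A ps m' a b = (\<Oplus>t\<in>{a..<b}. massey_term ps m a b t \<oplus> E t)"
    unfolding massey_sum_def by (rule add.finprod_cong') (use assms in auto)
  also have "\<dots> = massey_sum A ps m a b \<oplus> (\<Oplus>t\<in>{a..<b}. E t)"
    unfolding massey_sum_def by (rule finsum_addf) (use assms in auto)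
  finally show ?thesis .
qed

lemma full_defining_system_gauge_move:
  assumes m: "full_defining_system A ps n m"
    and pos: "\<And>l. l < n \<Longrightarrow> 1 \<le> ps ! l" and ij: "i \<le> j" "j < n"
    and c: "c \<in> hcomp A k" and k: "massey_degree ps i j = Suc k"
  shows "full_defining_system A ps n (gauge_move A i j k c m)"
proof -
  let ?D = "massey_degree ps" and ?m = "gauge_move A i j k c m"
  have mh: "m a b \<in> hcomp A (?D a b)" and md: "differential A (m a b) = massey_sum A ps m a b"
    if "a \<le> b" "b < n" for a b using m that by (auto simp: full_defining_system_def)
  have mc [simp]: "m a b \<in> carrier A" if "a \<le> b" "b < n" for a b
    using mh[OF that] by (rule hcomp_carrier)
  have cc [simp]: "c \<in> carrier A" using c by (rule hcomp_carrier)
  have dc: "differential A c \<in> hcomp A (?D i j)" using differential_hcomp[OF c] k by simp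
  have Sc [simp]: "massey_sum A ps m a b \<in> carrier A" if "a \<le> b" "b < n" for a b
    using mc[OF that] d_closed md[OF that] by metis
  show ?thesis unfolding full_defining_system_def
  proof (intro allI impI)
    fix a b assume ab: "a \<le> b \<and> b < n"
    then have Tc: "massey_term ps m a b t \<in> carrier A" if "t \<in> {a..<b}" for t using that by simp
    have degl: "?D a t + ?D (Suc t) b = Suc (?D a b)" if "a \<le> t" "t < b" for t
      using massey_degree_split[OF pos, of n a t b] that ab by simp
    consider (eq) "a = i" "b = j" | (row) "a = i" "j < b" | (col) "a < i" "b = j"
      | (cross) "a < i" "j < b" | (none) "\<not> (a \<le> i \<and> j \<le> b)" by linarith
    then show "?m a b \<in> hcomp A (?D a b) \<and> differential A (?m a b) = massey_sum A ps ?m a b"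
    proof cases
      case eq
      have "massey_sum A ps ?m i j = massey_sum A ps m i j"
        by (rule massey_sum_cong) (use ij in \<open>auto simp: gauge_move_def\<close>)
      with eq ij mh[of i j] dc show ?thesis
        by (simp add: gauge_move_def differential_add differential_differential md)
    next
      case row
      define E where "E t = (if t < j then \<zero> else if t = j then (- 1) ^ ?D i j \<odot> (differential A c \<otimes> m (Suc j) b)
        else if t < b then \<ominus> (c \<otimes> massey_term ps m (Suc j) b t) else \<zero>)" for t
      have Ec: "E t \<in> carrier A" for t using row ab ij by (auto simp: E_def)
      have "massey_term ps ?m a b t = massey_term ps m a b t \<oplus> E t" if t: "t \<in> {a..<b}" for t
      proof -
        consider "t < j" | "t = j" | "j < t" by linarith
        then show ?thesis
        proof cases
          case 1
          then show ?thesis using t row ab Tc[OF t] by (simp add: gauge_move_def E_def)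
        next
          case 2
          then show ?thesis using t row ab ij
            by (simp add: gauge_move_def E_def smult_add_right l_distr smult_mult_left)
        next
          case 3
          have "?D i j + ?D (Suc j) t = Suc (?D i t)"
            using massey_degree_split[OF pos, of n i j t] 3 ij t ab by simp
          then have "(- 1 :: real) ^ ?D i t * (- 1) ^ k = (- 1) ^ ?D (Suc j) t"
            using k by (rule sign_Suc_add)
          moreover have "?m a t = m a t \<ominus> ((- 1) ^ k \<odot> c) \<otimes> m (Suc j) t"
            "?m (Suc t) b = m (Suc t) b" "E t = \<ominus> (c \<otimes> massey_term ps m (Suc j) b t)"
            using 3 t row ij by (simp_all add: gauge_move_def E_def)
          ultimately show ?thesis using 3 t row ab ij
            by (simp add: a_minus_def smult_add_right l_distr smult_mult_left smult_mult_right
                smult_smult smult_minus_right m_assoc l_minus)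
        qed
      qed
      from gauge_move_sum[OF _ this Ec Tc] ab
      have "massey_sum A ps ?m a b = massey_sum A ps m a b \<oplus> (\<Oplus>t\<in>{a..<b}. E t)" by simp
      also have "(\<Oplus>t\<in>{a..<b}. E t) = (\<Oplus>t\<in>{a..<j}. E t) \<oplus> (E j \<oplus> (\<Oplus>t\<in>{Suc j..<b}. E t))"
        by (rule finsum_split_at) (use row ij Ec in auto)
      also have "(\<Oplus>t\<in>{a..<j}. E t) = \<zero>" by (rule finsum_eq_zero) (simp add: E_def)
      also have "(\<Oplus>t\<in>{Suc j..<b}. E t) = \<ominus> (c \<otimes> massey_sum A ps m (Suc j) b)"
      proof -
        have "\<ominus> (c \<otimes> massey_sum A ps m (Suc j) b) = (\<ominus> c) \<otimes> massey_sum A ps m (Suc j) b"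
          using row ab by (simp add: l_minus)
        also have "\<dots> = (\<Oplus>t\<in>{Suc j..<b}. (\<ominus> c) \<otimes> massey_term ps m (Suc j) b t)"
          unfolding massey_sum_def by (rule finsum_rdistr) (use ab in auto)
        also have "\<dots> = (\<Oplus>t\<in>{Suc j..<b}. E t)"
          by (rule add.finprod_cong') (use ab Ec in \<open>auto simp: E_def l_minus\<close>)
        finally show ?thesis by simp
      qed
      finally have S: "massey_sum A ps ?m a b = massey_sum A ps m a b \<oplus>
        (\<zero> \<oplus> (E j \<oplus> \<ominus> (c \<otimes> massey_sum A ps m (Suc j) b)))" .
      have "k + ?D (Suc j) b = ?D i b" using degl[of j] row ij k by simp
      then have h: "((- 1) ^ k \<odot> c) \<otimes> m (Suc j) b \<in> hcomp A (?D i b)"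
        using mult_hcomp[OF hcomp_closed(2)[OF c, of "(- 1) ^ k"] mh[of "Suc j" b]] row ab by simp
      have "differential A (((- 1) ^ k \<odot> c) \<otimes> m (Suc j) b) =
          (- 1) ^ k \<odot> (differential A c \<otimes> m (Suc j) b) \<oplus> c \<otimes> massey_sum A ps m (Suc j) b"
        using leibniz[OF hcomp_closed(2)[OF c], of "m (Suc j) b" "(- 1) ^ k"] row ab
        by (simp add: differential_smult smult_mult_left smult_smult md)
      moreover have "differential A (?m a b) =
          massey_sum A ps m a b \<ominus> differential A (((- 1) ^ k \<odot> c) \<otimes> m (Suc j) b)"
        using row ab hcomp_carrier[OF h] by (simp add: gauge_move_def d_diff md)
      ultimately have "differential A (?m a b) = massey_sum A ps ?m a b"
        unfolding S using row ab ij k by (simp add: E_def a_minus_def minus_add smult_minus_left)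
      with row h mh[of i b] ab show ?thesis by (simp add: gauge_move_def)
    next
      case col
      then obtain p where p: "i = Suc p" "a \<le> p" by (cases i) auto
      have pb: "p < b" using p col ij by simp
      define E where "E t = (if t < p then massey_term ps m a p t \<otimes> c else if t = p then
        (- 1) ^ ?D a p \<odot> (m a p \<otimes> differential A c) else \<zero>)" for t
      have Ec': "E t \<in> carrier A" if "a \<le> t" for t using p col ab ij that by (auto simp: E_def)
      define E' where "E' t = (if a \<le> t then E t else \<zero>)" for t
      have Ec: "E' t \<in> carrier A" for t using Ec' by (simp add: E'_def)
      have "massey_term ps ?m a b t = massey_term ps m a b t \<oplus> E' t" if t: "t \<in> {a..<b}" for t
      proof -
        consider "t < p" | "t = p" | "p < t" by linarith
        then show ?thesis
          using t p col ab ij Tc[OF t]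
          by cases (simp_all add: gauge_move_def E_def E'_def r_distr smult_mult_left m_assoc)
      qed
      from gauge_move_sum[OF _ this Ec Tc] ab
      have "massey_sum A ps ?m a b = massey_sum A ps m a b \<oplus> (\<Oplus>t\<in>{a..<b}. E' t)" by simp
      also have "(\<Oplus>t\<in>{a..<b}. E' t) = (\<Oplus>t\<in>{a..<p}. E' t) \<oplus> (E' p \<oplus> (\<Oplus>t\<in>{Suc p..<b}. E' t))"
        by (rule finsum_split_at) (use p pb Ec in auto)
      also have "(\<Oplus>t\<in>{Suc p..<b}. E' t) = \<zero>" by (rule finsum_eq_zero) (simp add: E_def E'_def)
      also have "(\<Oplus>t\<in>{a..<p}. E' t) = massey_sum A ps m a p \<otimes> c"
      proof -
        have "massey_sum A ps m a p \<otimes> c = (\<Oplus>t\<in>{a..<p}. massey_term ps m a p t \<otimes> c)"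
          unfolding massey_sum_def by (rule finsum_ldistr) (use p pb ab in auto)
        also have "\<dots> = (\<Oplus>t\<in>{a..<p}. E' t)"
          by (rule add.finprod_cong') (use Ec in \<open>auto simp: E_def E'_def\<close>)
        finally show ?thesis by simp
      qed
      finally have S: "massey_sum A ps ?m a b = massey_sum A ps m a b \<oplus>
        (massey_sum A ps m a p \<otimes> c \<oplus> (E' p \<oplus> \<zero>))" .
      have "?D a p + k = ?D a b" using degl[of p] col p pb k by simp
      then have h: "m a p \<otimes> c \<in> hcomp A (?D a b)"
        using mult_hcomp[OF mh[of a p] c] p pb ab by simp
      have "differential A (m a p \<otimes> c) = massey_sum A ps m a p \<otimes> c \<oplus>
          (- 1) ^ ?D a p \<odot> (m a p \<otimes> differential A c)"
        using leibniz[OF mh[of a p], of c] p pb ab by (simp add: md)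
      then have "differential A (?m a b) = massey_sum A ps ?m a b"
        unfolding S using p pb col ab ij hcomp_carrier[OF h]
        by (simp add: gauge_move_def differential_add md E_def E'_def)
      with col p h mh[of a b] ab show ?thesis by (simp add: gauge_move_def)
    next
      case cross
      then obtain p where p: "i = Suc p" "a \<le> p" by (cases i) auto
      have pb: "p < j" "p < b" "j < b" using p cross ij by auto
      define x where "x = m a p \<otimes> c \<otimes> m (Suc j) b"
      have xc [simp]: "x \<in> carrier A" using p pb ab ij by (simp add: x_def)
      define E where "E t = (if t = p then \<ominus> ((- 1) ^ ?D a j \<odot> x)
        else if t = j then (- 1) ^ ?D a j \<odot> x else \<zero>)" for t
      have Ec: "E t \<in> carrier A" for t by (simp add: E_def)
      have "?D a p + ?D i j = Suc (?D a j)"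
        using massey_degree_split[OF pos, of n a p j] p pb ij by simp
      then have Daj: "?D a j = ?D a p + k" using k by simp
      have "massey_term ps ?m a b t = massey_term ps m a b t \<oplus> E t" if t: "t \<in> {a..<b}" for t
      proof -
        consider "t = p" | "t = j" | "t \<noteq> p" "t \<noteq> j" by linarith
        then show ?thesis
        proof cases
          case 1
          then show ?thesis using t p pb cross ab ij
            by (simp add: gauge_move_def E_def x_def a_minus_def r_distr smult_mult_left
                smult_mult_right smult_smult smult_minus_right m_assoc r_minus Daj power_add mult.commute
                smult_add_right)
        next
          case 2
          then show ?thesis using t p pb cross ab ij
            by (simp add: gauge_move_def E_def x_def l_distr smult_mult_left smult_add_right m_assoc)
        next
          case 3
          then show ?thesis using t p pb cross ab ij Tc[OF t]
            by (auto simp add: gauge_move_def E_def)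
        qed
      qed
      from gauge_move_sum[OF _ this Ec Tc] ab
      have "massey_sum A ps ?m a b = massey_sum A ps m a b \<oplus> (\<Oplus>t\<in>{a..<b}. E t)" by simp
      also have "(\<Oplus>t\<in>{a..<b}. E t) = (\<Oplus>t\<in>{a..<p}. E t) \<oplus> (E p \<oplus> (\<Oplus>t\<in>{Suc p..<b}. E t))"
        by (rule finsum_split_at) (use p pb Ec in auto)
      also have "(\<Oplus>t\<in>{Suc p..<b}. E t) = (\<Oplus>t\<in>{Suc p..<j}. E t) \<oplus> (E j \<oplus> (\<Oplus>t\<in>{Suc j..<b}. E t))"
        by (rule finsum_split_at) (use p pb Ec in auto)
      also have "(\<Oplus>t\<in>{a..<p}. E t) = \<zero>" by (rule finsum_eq_zero) (use pb in \<open>simp add: E_def\<close>)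
      also have "(\<Oplus>t\<in>{Suc p..<j}. E t) = \<zero>" by (rule finsum_eq_zero) (simp add: E_def)
      also have "(\<Oplus>t\<in>{Suc j..<b}. E t) = \<zero>" by (rule finsum_eq_zero) (use pb in \<open>simp add: E_def\<close>)
      finally have "massey_sum A ps ?m a b = massey_sum A ps m a b"
        using ab pb by (simp add: E_def l_neg)
      with cross ab mh[of a b] show ?thesis by (simp add: gauge_move_def md)
    next
      case none
      have "massey_sum A ps ?m a b = massey_sum A ps m a b"
        by (rule massey_sum_cong) (use none ab ij in \<open>auto simp: gauge_move_def\<close>)
      moreover have "?m a b = m a b" using none ij by (auto simp: gauge_move_def)
      ultimately show ?thesis using ab mh md by simp
    qed
  qed
qed

end

lemma interval_rank_less:
  fixes i j i' j' n :: nat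
  assumes "j - i < j' - i'" "i < n"
  shows "(j - i) * n + i < (j' - i') * n + i'"
proof -
  have "(j - i) * n + i < Suc (j - i) * n" using assms by simp
  also have "\<dots> \<le> (j' - i') * n" using assms by (intro mult_le_mono1) simp
  finally show ?thesis by simp
qed

context dga_quasi_iso
begin

lemma f_massey_sum:
  assumes "\<And>k. i \<le> k \<Longrightarrow> k < j \<Longrightarrow> a i k \<in> carrier A \<and> f (a i k) = b i k"
    and "\<And>k. i \<le> k \<Longrightarrow> k < j \<Longrightarrow> a (Suc k) j \<in> carrier A \<and> f (a (Suc k) j) = b (Suc k) j"
  shows "f (massey_sum A ps a i j) = massey_sum B ps b i j"
proof -
  have "f (massey_sum A ps a i j) = (\<Oplus>\<^bsub>B\<^esub>k\<in>{i..<j}.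
      f (((- 1) ^ massey_degree ps i k \<odot>\<^bsub>A\<^esub> a i k) \<otimes>\<^bsub>A\<^esub> a (Suc k) j))"
    unfolding massey_sum_def by (rule f_finsum) (use assms in auto)
  also have "\<dots> = massey_sum B ps b i j"
    unfolding massey_sum_def
  proof (rule B.add.finprod_cong')
    fix k assume k: "k \<in> {i..<j}"
    then have "a i k \<in> carrier A" "a (Suc k) j \<in> carrier A" "f (a i k) = b i k"
      "f (a (Suc k) j) = b (Suc k) j" using assms by auto
    then show "f (((- 1) ^ massey_degree ps i k \<odot>\<^bsub>A\<^esub> a i k) \<otimes>\<^bsub>A\<^esub> a (Suc k) j) =
        ((- 1) ^ massey_degree ps i k \<odot>\<^bsub>B\<^esub> b i k) \<otimes>\<^bsub>B\<^esub> b (Suc k) j"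
      by (simp add: f_mult f_smult)
  next
    have "b i k \<in> carrier B" "b (Suc k) j \<in> carrier B" if "k \<in> {i..<j}" for k
      using that assms f_closed by (metis atLeastLessThan_iff)+
    then show "(\<lambda>k. ((- 1) ^ massey_degree ps i k \<odot>\<^bsub>B\<^esub> b i k) \<otimes>\<^bsub>B\<^esub> b (Suc k) j) \<in> {i..<j} \<rightarrow> carrier B"
      by auto
  qed simp
  finally show ?thesis .
qed

text \<open>A lift of the entry \<open>(i, j)\<close> up to a coboundary: injectivity in cohomology makes the
  required differential exact in the source, surjectivity corrects the primitive by a cocycle.\<close>

lemma lift_entry:
  assumes S: "S \<in> cocycles A" "S \<in> hcomp A (Suc (Suc k))"
    and b: "b \<in> hcomp B (Suc k)" "f S = differential B b"
  obtains x c where "x \<in> hcomp A (Suc k)" "differential A x = S" "c \<in> hcomp B k"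
    "f x = b \<oplus>\<^bsub>B\<^esub> differential B c"
proof -
  have bc: "b \<in> carrier B" using b(1) by (rule B.hcomp_carrier)
  have "S \<in> coboundaries A"
    using exact_if_image_exact[OF S(1)] b(2) bc by (auto simp: coboundaries_def)
  then obtain u where u: "u \<in> hcomp A (Suc k)" "S = differential A u"
    using A.homogeneous_primitive S(2) by blast
  have uc: "u \<in> carrier A" using u(1) by (rule A.hcomp_carrier)
  have "f u \<ominus>\<^bsub>B\<^esub> b \<in> cocycles B"
    using u(2) uc b(2) bc
    by (simp add: cocycles_def B.d_diff f_d[symmetric])
  moreover have "f u \<ominus>\<^bsub>B\<^esub> b \<in> hcomp B (Suc k)" using f_hcomp[OF u(1)] b(1) by simp
  ultimately obtain z where z: "z \<in> cocycles A" "z \<in> hcomp A (Suc k)"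
    "f u \<ominus>\<^bsub>B\<^esub> b \<ominus>\<^bsub>B\<^esub> f z \<in> coboundaries B"
    using homogeneous_preimage by blast
  have zc: "z \<in> carrier A" "differential A z = \<zero>\<^bsub>A\<^esub>" using z(1) by (auto simp: cocycles_def)
  have "f u \<ominus>\<^bsub>B\<^esub> b \<ominus>\<^bsub>B\<^esub> f z \<in> hcomp B (Suc k)" using f_hcomp u(1) b(1) z(2) by simp
  then obtain c where c: "c \<in> hcomp B k" "f u \<ominus>\<^bsub>B\<^esub> b \<ominus>\<^bsub>B\<^esub> f z = differential B c"
    using B.homogeneous_primitive z(3) by blast
  show ?thesis
  proof (rule that)
    show "u \<ominus>\<^bsub>A\<^esub> z \<in> hcomp A (Suc k)" using u(1) z(2) by simp
    show "differential A (u \<ominus>\<^bsub>A\<^esub> z) = S"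
      using u(2) uc zc by (simp add: A.d_diff) (simp add: a_minus_def)
    show "c \<in> hcomp B k" by (rule c)
    have "f (u \<ominus>\<^bsub>A\<^esub> z) = b \<oplus>\<^bsub>B\<^esub> (f u \<ominus>\<^bsub>B\<^esub> b \<ominus>\<^bsub>B\<^esub> f z)"
      using uc zc bc B.add_diff_self[of b "f u"]
      by (simp add: f_diff) (simp add: a_minus_def flip: B.a_assoc)
    with c(2) show "f (u \<ominus>\<^bsub>A\<^esub> z) = b \<oplus>\<^bsub>B\<^esub> differential B c" by simp
  qed
qed

text \<open>The intervals are treated in the order of their length. Before the entry \<open>(i, j)\<close> is
  lifted, \<open>f\<close> maps the lifts of all shorter entries exactly to the system in the target; the
  coboundary by which \<open>f\<close> misses the entry \<open>(i, j)\<close> is absorbed by a gauge move in the target,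
  which leaves the entries already treated alone.\<close>

lemma lift_full_defining_system:
  assumes pos: "\<And>l. l < n \<Longrightarrow> 1 \<le> ps ! l"
    and x: "\<And>i. i < n \<Longrightarrow> x i \<in> cocycles A \<inter> hcomp A (ps ! i)"
    and b: "full_defining_system B ps n b"
    and bx: "\<And>i. i < n \<Longrightarrow> b i i \<ominus>\<^bsub>B\<^esub> f (x i) \<in> coboundaries B"
  obtains a where "full_defining_system A ps n a" "\<And>i. i < n \<Longrightarrow> a i i = x i"
proof -
  let ?r = "\<lambda>i j. (j - i) * n + i"
  define lifted where "lifted r a b \<longleftrightarrow> full_defining_system B ps n b \<and>
      (\<forall>i<n. b i i \<ominus>\<^bsub>B\<^esub> f (x i) \<in> coboundaries B) \<and>
      (\<forall>i j. i \<le> j \<and> j < n \<and> ?r i j < r \<longrightarrow> a i j \<in> hcomp A (massey_degree ps i j) \<and>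
        differential A (a i j) = massey_sum A ps a i j \<and> f (a i j) = b i j \<and> (i = j \<longrightarrow> a i j = x i))"
    for r a b
  have shorter: "?r i' j' < ?r i j" if "i \<le> i'" "i' \<le> j'" "j' \<le> j" "(i', j') \<noteq> (i, j)" "j < n" for i j i' j'
    using that by (intro interval_rank_less) auto
  have "\<exists>a b. lifted r a b" for r
  proof (induction r)
    case 0
    show ?case using b bx by (auto simp: lifted_def)
  next
    case (Suc r)
    then obtain a b where ab: "lifted r a b" by blast
    show ?case
    proof (cases "\<exists>i j. i \<le> j \<and> j < n \<and> ?r i j = r")
      case False
      with ab have "lifted (Suc r) a b" by (auto simp: lifted_def less_Suc_eq)
      then show ?thesis by blast
    next
      case True
      then obtain i j where ij: "i \<le> j" "j < n" "?r i j = r" by blast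
      obtain k where k: "massey_degree ps i j = Suc k"
        using massey_degree_pos[OF pos ij(1,2)] by (cases "massey_degree ps i j") auto
      have b: "full_defining_system B ps n b" using ab by (simp add: lifted_def)
      have lift: "a p q \<in> hcomp A (massey_degree ps p q) \<and>
          differential A (a p q) = massey_sum A ps a p q \<and> f (a p q) = b p q \<and> (p = q \<longrightarrow> a p q = x p)"
        if "p \<le> q" "q < n" "?r p q < r" for p q
        using ab that unfolding lifted_def by blast
      have a: "a i' j' \<in> hcomp A (massey_degree ps i' j') \<and>
          differential A (a i' j') = massey_sum A ps a i' j' \<and> f (a i' j') = b i' j'"
        if "i \<le> i'" "i' \<le> j'" "j' \<le> j" "(i', j') \<noteq> (i, j)" for i' j'
        using lift[of i' j'] shorter[OF that ij(2)] that ij by auto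
      have ac: "a i' j' \<in> carrier A" if "i \<le> i'" "i' \<le> j'" "j' \<le> j" "(i', j') \<noteq> (i, j)" for i' j'
        using a[OF that] A.hcomp_carrier by blast
      define S where "S = massey_sum A ps a i j"
      have Sh: "S \<in> hcomp A (Suc (Suc k))"
        unfolding S_def k[symmetric] by (rule A.massey_sum_hcomp[OF pos ij(1,2)]) (use a in auto)
      have Sz: "S \<in> cocycles A"
        using A.massey_sum_closed_form[OF pos ij(1,2), of a] a A.hcomp_carrier[OF Sh]
        by (simp add: cocycles_def S_def)
      have bij: "b i j \<in> hcomp B (Suc k)" "differential B (b i j) = massey_sum B ps b i j"
        using b ij unfolding full_defining_system_def k[symmetric] by blast+
      have fS: "f S = differential B (b i j)"
        unfolding S_def bij(2) by (rule f_massey_sum) (use a ac ij in auto)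
      obtain u c where uc: "u \<in> hcomp A (Suc k)" "differential A u = S" "c \<in> hcomp B k"
        "f u = b i j \<oplus>\<^bsub>B\<^esub> differential B c" "i = j \<longrightarrow> u = x i"
      proof (cases "i = j")
        case True
        have xi: "x i \<in> cocycles A" "x i \<in> hcomp A (Suc k)" using x[of i] ij k True by auto
        have c: "x i \<in> carrier A" "b i i \<in> carrier B"
          using xi(1) bij(1) B.hcomp_carrier True by (auto simp: cocycles_def)
        have "b i i \<ominus>\<^bsub>B\<^esub> f (x i) \<in> coboundaries B" using ab ij by (auto simp: lifted_def)
        then have "\<ominus>\<^bsub>B\<^esub> (b i i \<ominus>\<^bsub>B\<^esub> f (x i)) \<in> coboundaries B" by (rule B.coboundaries_closed)
        moreover have "\<ominus>\<^bsub>B\<^esub> (b i i \<ominus>\<^bsub>B\<^esub> f (x i)) = f (x i) \<ominus>\<^bsub>B\<^esub> b i i"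
          using c by (simp add: B.minus_diff)
        ultimately have "f (x i) \<ominus>\<^bsub>B\<^esub> b i i \<in> coboundaries B" by simp
        moreover have "f (x i) \<ominus>\<^bsub>B\<^esub> b i i \<in> hcomp B (Suc k)"
          using f_hcomp[OF xi(2)] bij(1) True by simp
        ultimately obtain c' where c': "c' \<in> hcomp B k" "f (x i) \<ominus>\<^bsub>B\<^esub> b i i = differential B c'"
          using B.homogeneous_primitive by blast
        have "f (x i) = b i i \<oplus>\<^bsub>B\<^esub> (f (x i) \<ominus>\<^bsub>B\<^esub> b i i)"
          using c by (simp add: B.add_diff_self)
        with c' have "f (x i) = b i i \<oplus>\<^bsub>B\<^esub> differential B c'" by simp
        with that[of "x i" c'] xi c'(1) True show ?thesis by (simp add: cocycles_def S_def)
      next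
        case False
        then show ?thesis using lift_entry[OF Sz Sh bij(1) fS] that by metis
      qed
      define a' where "a' = (\<lambda>p q. if (p, q) = (i, j) then u else a p q)"
      define b' where "b' = gauge_move B i j k c b"
      have b'_old: "b' p q = b p q" if "p \<le> q" "q < n" "?r p q < r" for p q
      proof -
        have "\<not> (p \<le> i \<and> j \<le> q)"
        proof
          assume pq: "p \<le> i \<and> j \<le> q"
          then have "?r i j < ?r p q \<or> (p, q) = (i, j)" using shorter[of p i j q] ij that by auto
          with that ij show False by auto
        qed
        then show ?thesis using ij by (auto simp: b'_def gauge_move_def)
      qed
      have sum': "massey_sum A ps a' p q = massey_sum A ps a p q"
        if pq: "p \<le> q" "q < n" "?r p q < r \<or> (p, q) = (i, j)" for p q
      proof -
        have *: "(p', q') \<noteq> (i, j) \<and> a p' q' \<in> carrier A"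
          if "p \<le> p'" "p' \<le> q'" "q' \<le> q" "(p', q') \<noteq> (p, q)" for p' q'
        proof -
          have "?r p' q' < ?r p q" using shorter that pq by blast
          with pq(3) ij have r': "?r p' q' < r" by auto
          then have "a p' q' \<in> hcomp A (massey_degree ps p' q')"
            using lift[of p' q'] that pq by auto
          with r' ij show ?thesis using A.hcomp_carrier by auto
        qed
        show ?thesis
        proof (rule A.massey_sum_cong)
          fix k assume k: "p \<le> k" "k < q"
          show "a' p k = a p k" "a p k \<in> carrier A" using *[of p k] k by (auto simp: a'_def)
          show "a' (Suc k) q = a (Suc k) q" "a (Suc k) q \<in> carrier A"
            using *[of "Suc k" q] k by (auto simp: a'_def)
        qed
      qed
      have "full_defining_system B ps n b'"
        unfolding b'_def by (rule B.full_defining_system_gauge_move[OF b pos ij(1,2) uc(3) k])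
      moreover have "b' p p \<ominus>\<^bsub>B\<^esub> f (x p) \<in> coboundaries B" if "p < n" for p
      proof (cases "i = j \<and> p = i")
        case True
        then have "b' p p = f (x p)" using uc ij by (simp add: b'_def gauge_move_def)
        moreover have "f (x p) \<in> carrier B" using x[OF that] A.hcomp_carrier by blast
        ultimately have "b' p p \<ominus>\<^bsub>B\<^esub> f (x p) = \<zero>\<^bsub>B\<^esub>" by (simp add: a_minus_def B.r_neg)
        then show ?thesis by (simp add: B.coboundaries_closed)
      next
        case False
        then have "b' p p = b p p" using ij by (auto simp: b'_def gauge_move_def)
        with ab that show ?thesis by (simp add: lifted_def)
      qed
      moreover have "a' p q \<in> hcomp A (massey_degree ps p q) \<and>
          differential A (a' p q) = massey_sum A ps a' p q \<and> f (a' p q) = b' p q \<and> (p = q \<longrightarrow> a' p q = x p)"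
        if pq: "p \<le> q" "q < n" "?r p q < Suc r" for p q
      proof (cases "(p, q) = (i, j)")
        case True
        with uc k sum'[of i j] ij show ?thesis
          by (auto simp: a'_def b'_def gauge_move_def S_def)
      next
        case False
        have "?r p q \<noteq> ?r i j"
        proof
          assume eq: "?r p q = ?r i j"
          have "\<not> q - p < j - i" "\<not> j - i < q - p"
            using interval_rank_less[of q p j i n] interval_rank_less[of j i q p n] eq pq ij by auto
          then have "q - p = j - i" by simp
          with eq pq ij False show False by auto
        qed
        with pq ij have "?r p q < r" by simp
        moreover have "a' p q = a p q" using False by (auto simp: a'_def)
        ultimately show ?thesis using lift[of p q] pq sum'[of p q] b'_old[of p q] by auto
      qed
      ultimately have "lifted (Suc r) a' b'" unfolding lifted_def by blast
      then show ?thesis by blast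
    qed
  qed
  from this[of "Suc (n * n + n)"] obtain a b where ab: "lifted (Suc (n * n + n)) a b" by blast
  have rank: "?r i j < Suc (n * n + n)" if "i \<le> j" "j < n" for i j
  proof -
    have "(j - i) * n \<le> n * n" using that by (intro mult_le_mono1) simp
    with that show ?thesis by linarith
  qed
  have lift: "a i j \<in> hcomp A (massey_degree ps i j) \<and> differential A (a i j) = massey_sum A ps a i j
      \<and> (i = j \<longrightarrow> a i j = x i)" if "i \<le> j" "j < n" for i j
    using ab rank[OF that] that unfolding lifted_def by blast
  show ?thesis
  proof (rule that)
    show "full_defining_system A ps n a" using lift by (simp add: full_defining_system_def)
    show "a i i = x i" if "i < n" for i using lift[of i i] that by simp
  qed
qed

lemma push_full_defining_system:
  assumes "full_defining_system A ps n a"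
  shows "full_defining_system B ps n (\<lambda>i j. f (a i j))"
  unfolding full_defining_system_def
proof (intro allI impI)
  fix i j assume ij: "i \<le> j \<and> j < n"
  have a: "a p q \<in> hcomp A (massey_degree ps p q)" "differential A (a p q) = massey_sum A ps a p q"
    "a p q \<in> carrier A" if "p \<le> q" "q < n" for p q
    using assms that A.hcomp_carrier by (auto simp: full_defining_system_def)
  have "f (massey_sum A ps a i j) = massey_sum B ps (\<lambda>i j. f (a i j)) i j"
    by (rule f_massey_sum) (use a ij in auto)
  then show "f (a i j) \<in> hcomp B (massey_degree ps i j) \<and>
      differential B (f (a i j)) = massey_sum B ps (\<lambda>i j. f (a i j)) i j"
    using a ij f_hcomp by (simp add: f_d[symmetric])
qed

end

text \<open>If the algebra has zero differential, a full defining system has the given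
  classes on the diagonal and 0 elsewhere. The following property expresses this
  in a form that is invariant under quasi-isomorphisms.\<close>

definition massey_trivial :: "nat list \<Rightarrow> nat \<Rightarrow> 'a dga \<Rightarrow> bool" where
  "massey_trivial ps n A \<longleftrightarrow> (\<forall>x. (\<forall>i<n. x i \<in> cocycles A \<inter> hcomp A (ps ! i)) \<and>
     (\<forall>i. Suc i < n \<longrightarrow> x i \<otimes>\<^bsub>A\<^esub> x (Suc i) \<in> coboundaries A) \<longrightarrow>
     (\<exists>m. full_defining_system A ps n m \<and> (\<forall>i<n. m i i \<ominus>\<^bsub>A\<^esub> x i \<in> coboundaries A)))"

lemma massey_trivialE:
  assumes "massey_trivial ps n A" "\<And>i. i < n \<Longrightarrow> x i \<in> cocycles A" "\<And>i. i < n \<Longrightarrow> x i \<in> hcomp A (ps ! i)"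
    "\<And>i. Suc i < n \<Longrightarrow> x i \<otimes>\<^bsub>A\<^esub> x (Suc i) \<in> coboundaries A"
  obtains m where "full_defining_system A ps n m" "\<And>i. i < n \<Longrightarrow> m i i \<ominus>\<^bsub>A\<^esub> x i \<in> coboundaries A"
  using assms unfolding massey_trivial_def by blast

lemma (in dga_quasi_iso) massey_trivial_iff:
  assumes pos: "\<And>l. l < n \<Longrightarrow> 1 \<le> ps ! l"
  shows "massey_trivial ps n A \<longleftrightarrow> massey_trivial ps n B"
proof
  assume B: "massey_trivial ps n B"
  show "massey_trivial ps n A" unfolding massey_trivial_def
  proof (intro allI impI, elim conjE)
    fix x assume x: "\<forall>i<n. x i \<in> cocycles A \<inter> hcomp A (ps ! i)"
      and xx: "\<forall>i. Suc i < n \<longrightarrow> x i \<otimes>\<^bsub>A\<^esub> x (Suc i) \<in> coboundaries A"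
    have xc: "x i \<in> carrier A" if "i < n" for i using x that A.hcomp_carrier by blast
    have "f (x i) \<otimes>\<^bsub>B\<^esub> f (x (Suc i)) \<in> coboundaries B" if "Suc i < n" for i
      using f_coboundaries xx that xc by (metis Suc_lessD f_mult)
    then obtain m where m: "full_defining_system B ps n m"
        "\<And>i. i < n \<Longrightarrow> m i i \<ominus>\<^bsub>B\<^esub> f (x i) \<in> coboundaries B"
      by (rule massey_trivialE[OF B, of "\<lambda>i. f (x i)", rotated -2]) (use x f_cocycles f_hcomp in auto)
    obtain a where a: "full_defining_system A ps n a" "\<And>i. i < n \<Longrightarrow> a i i = x i"
      using lift_full_defining_system[OF pos _ m(1)] x m(2) by blast
    have "a i i \<ominus>\<^bsub>A\<^esub> x i \<in> coboundaries A" if "i < n" for i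
      using a(2)[OF that] xc[OF that] by (simp add: a_minus_def A.r_neg A.coboundaries_closed)
    with a(1) show "\<exists>m. full_defining_system A ps n m \<and> (\<forall>i<n. m i i \<ominus>\<^bsub>A\<^esub> x i \<in> coboundaries A)" by blast
  qed
next
  assume A: "massey_trivial ps n A"
  show "massey_trivial ps n B" unfolding massey_trivial_def
  proof (intro allI impI, elim conjE)
    fix y assume y: "\<forall>i<n. y i \<in> cocycles B \<inter> hcomp B (ps ! i)"
      and yy: "\<forall>i. Suc i < n \<longrightarrow> y i \<otimes>\<^bsub>B\<^esub> y (Suc i) \<in> coboundaries B"
    have "\<forall>i. \<exists>x. i < n \<longrightarrow> x \<in> cocycles A \<and> x \<in> hcomp A (ps ! i) \<and> y i \<ominus>\<^bsub>B\<^esub> f x \<in> coboundaries B"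
      using homogeneous_preimage y by (metis IntD1 IntD2)
    then obtain x where x: "\<And>i. i < n \<Longrightarrow> x i \<in> cocycles A" "\<And>i. i < n \<Longrightarrow> x i \<in> hcomp A (ps ! i)"
      "\<And>i. i < n \<Longrightarrow> y i \<ominus>\<^bsub>B\<^esub> f (x i) \<in> coboundaries B" by metis
    have c: "x i \<in> carrier A" "y i \<in> carrier B" "f (x i) \<in> carrier B" if "i < n" for i
      using x(1)[OF that] y that by (auto simp: cocycles_def)
    have "x i \<otimes>\<^bsub>A\<^esub> x (Suc i) \<in> coboundaries A" if i: "Suc i < n" for i
    proof (rule exact_if_image_exact)
      show "x i \<otimes>\<^bsub>A\<^esub> x (Suc i) \<in> cocycles A" using x(1) i by (intro A.cocycles_mult) auto
      let ?u = "y i \<ominus>\<^bsub>B\<^esub> f (x i)" and ?v = "y (Suc i) \<ominus>\<^bsub>B\<^esub> f (x (Suc i))"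
      have 1: "?u \<otimes>\<^bsub>B\<^esub> f (x (Suc i)) \<in> coboundaries B" "y i \<otimes>\<^bsub>B\<^esub> ?v \<in> coboundaries B"
        using i y by (auto intro: B.coboundaries_mult(1)[OF x(3) f_cocycles[OF x(1)]]
          B.coboundaries_mult(2)[OF x(3)])
      have "f (x i \<otimes>\<^bsub>A\<^esub> x (Suc i)) =
          y i \<otimes>\<^bsub>B\<^esub> y (Suc i) \<ominus>\<^bsub>B\<^esub> y i \<otimes>\<^bsub>B\<^esub> ?v \<ominus>\<^bsub>B\<^esub> ?u \<otimes>\<^bsub>B\<^esub> f (x (Suc i))"
        using c[of i] c[of "Suc i"] i by (simp add: f_mult B.mult_diff_telescope)
      then show "f (x i \<otimes>\<^bsub>A\<^esub> x (Suc i)) \<in> coboundaries B"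
        using 1 yy i by (simp add: B.coboundaries_minus)
    qed
    then obtain m where m: "full_defining_system A ps n m"
        "\<And>i. i < n \<Longrightarrow> m i i \<ominus>\<^bsub>A\<^esub> x i \<in> coboundaries A"
      using massey_trivialE[OF A x(1,2)] by blast
    have "f (m i i) \<ominus>\<^bsub>B\<^esub> y i \<in> coboundaries B" if i: "i < n" for i
    proof -
      have mc: "m i i \<in> carrier A"
        using m(1) i A.hcomp_carrier by (auto simp: full_defining_system_def)
      have "f (m i i) \<ominus>\<^bsub>B\<^esub> y i = f (m i i \<ominus>\<^bsub>A\<^esub> x i) \<ominus>\<^bsub>B\<^esub> (y i \<ominus>\<^bsub>B\<^esub> f (x i))"
        using c[OF i] mc by (simp add: f_diff B.diff_telescope)
      then show ?thesis using f_coboundaries[of "m i i \<ominus>\<^bsub>A\<^esub> x i"] m(2) x(3) i B.coboundaries_minus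
        by simp
    qed
    with push_full_defining_system[OF m(1)]
    show "\<exists>m. full_defining_system B ps n m \<and> (\<forall>i<n. m i i \<ominus>\<^bsub>B\<^esub> y i \<in> coboundaries B)" by blast
  qed
qed

lemma massey_trivial_quasi_linked:
  assumes "dg_algebra A" "dg_algebra B" "quasi_linked A B" "\<And>l. l < n \<Longrightarrow> 1 \<le> ps ! l"
  shows "massey_trivial ps n A \<longleftrightarrow> massey_trivial ps n B"
  using assms(3) unfolding quasi_linked_def
proof (elim disjE exE)
  fix f assume "quasi_isomorphism A B f"
  then interpret dga_quasi_iso A B f
    using assms by (simp add: dga_quasi_iso_def dga_quasi_iso_axioms_def)
  show ?thesis by (rule massey_trivial_iff[OF assms(4)])
next
  fix f assume "quasi_isomorphism B A f"
  then interpret dga_quasi_iso B A f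
    using assms by (simp add: dga_quasi_iso_def dga_quasi_iso_axioms_def)
  show ?thesis using massey_trivial_iff[OF assms(4)] by blast
qed

lemma (in dg_algebra) massey_trivial_cohomology:
  assumes pos: "\<And>l. l < n \<Longrightarrow> 1 \<le> ps ! l"
  shows "massey_trivial ps n (cohomology A)"
  unfolding massey_trivial_def
proof (intro allI impI, elim conjE)
  let ?H = "cohomology A"
  interpret H: dg_algebra ?H by (rule dg_algebra_cohomology)
  have d: "differential ?H U = \<zero>\<^bsub>?H\<^esub>" for U by (simp add: differential_cohomology zero_cohomology)
  fix x assume x: "\<forall>i<n. x i \<in> cocycles ?H \<inter> hcomp ?H (ps ! i)"
    and xx: "\<forall>i. Suc i < n \<longrightarrow> x i \<otimes>\<^bsub>?H\<^esub> x (Suc i) \<in> coboundaries ?H"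
  have xc: "x i \<in> carrier ?H" if "i < n" for i using x that by (auto simp: cocycles_def)
  have xx0: "x i \<otimes>\<^bsub>?H\<^esub> x (Suc i) = \<zero>\<^bsub>?H\<^esub>" if "Suc i < n" for i
    using xx that d by (auto simp: coboundaries_def)
  define m where "m i j = (if i = j then x i else \<zero>\<^bsub>?H\<^esub>)" for i j :: nat
  have "massey_sum ?H ps m i j = \<zero>\<^bsub>?H\<^esub>" if "i \<le> j" "j < n" for i j
    unfolding massey_sum_def
  proof (rule H.finsum_eq_zero)
    fix k assume k: "k \<in> {i..<j}"
    consider "k = i" "Suc k = j" | "k \<noteq> i" | "Suc k \<noteq> j" by blast
    then show "((- 1) ^ massey_degree ps i k \<odot>\<^bsub>?H\<^esub> m i k) \<otimes>\<^bsub>?H\<^esub> m (Suc k) j = \<zero>\<^bsub>?H\<^esub>"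
    proof cases
      case 1
      then have "((- 1) ^ massey_degree ps i k \<odot>\<^bsub>?H\<^esub> m i k) \<otimes>\<^bsub>?H\<^esub> m (Suc k) j =
          (- 1) ^ massey_degree ps i k \<odot>\<^bsub>?H\<^esub> (x i \<otimes>\<^bsub>?H\<^esub> x (Suc i))"
        using that k xc by (auto simp: m_def H.smult_mult_left)
      then show ?thesis using xx0[of i] 1 that by simp
    qed (use k that xc in \<open>auto simp: m_def\<close>)
  qed
  then have "full_defining_system ?H ps n m"
    using x by (auto simp: full_defining_system_def d m_def)
  moreover have "m i i \<ominus>\<^bsub>?H\<^esub> x i \<in> coboundaries ?H" if "i < n" for i
    using xc[OF that] by (simp add: m_def a_minus_def H.r_neg H.coboundaries_closed)
  ultimately show "\<exists>m. full_defining_system ?H ps n m \<and> (\<forall>i<n. m i i \<ominus>\<^bsub>?H\<^esub> x i \<in> coboundaries ?H)"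
    by blast
qed

lemma formal_imp_massey_trivial:
  fixes A :: "'a dga"
  assumes A: "dg_algebra A" and formal: "formal TYPE('c) A" and pos: "\<And>l. l < n \<Longrightarrow> 1 \<le> ps ! l"
  shows "massey_trivial ps n A"
proof -
  interpret dg_algebra A by (rule A)
  have H: "massey_trivial ps n (cohomology A)" using massey_trivial_cohomology pos by blast
  note link = massey_trivial_quasi_linked[where n = n and ps = ps, OF _ _ _ pos]
  show ?thesis
    using formal unfolding formal_def
  proof (elim disjE exE conjE)
    assume "quasi_linked A (cohomology A)"
    then show ?thesis using link[OF A dg_algebra_cohomology] H by simp
  next
    fix Bs :: "'c dga list"
    assume Bs: "Bs \<noteq> []" "\<forall>B\<in>set Bs. cdga B" "quasi_linked A (hd Bs)"
      "successively quasi_linked Bs" "quasi_linked (last Bs) (cohomology A)"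
    have dg: "dg_algebra B" if "B \<in> set Bs" for B using Bs(2) that cdga_imp_dg_algebra by blast
    have "massey_trivial ps n (hd Cs) \<longleftrightarrow> massey_trivial ps n (last Cs)"
      if "Cs \<noteq> []" "set Cs \<subseteq> set Bs" "successively quasi_linked Cs" for Cs
      using that
    proof (induction Cs rule: induct_list012)
      case (3 B C Cs)
      then have "massey_trivial ps n B \<longleftrightarrow> massey_trivial ps n C"
        by (intro link dg) auto
      with 3 show ?case by simp
    qed auto
    from this[OF Bs(1) _ Bs(4)] have "massey_trivial ps n (hd Bs) \<longleftrightarrow> massey_trivial ps n (last Bs)" by simp
    moreover have "massey_trivial ps n A \<longleftrightarrow> massey_trivial ps n (hd Bs)"
      using Bs by (intro link A dg) auto
    moreover have "massey_trivial ps n (last Bs) \<longleftrightarrow> massey_trivial ps n (cohomology A)"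
      using Bs by (intro link dg_algebra_cohomology dg) auto
    ultimately show ?thesis using H by simp
  qed
qed

context dg_algebra
begin

lemma full_defining_system_of_trivial_product:
  assumes len: "length cs = n" "2 \<le> n" and pos: "\<And>l. l < n \<Longrightarrow> 1 \<le> ps ! l"
    and cs: "\<And>i. i < n \<Longrightarrow> cs ! i = cohomology_class A (x i)"
    and x: "\<And>i. i < n \<Longrightarrow> x i \<in> cocycles A \<inter> hcomp A (ps ! i)"
    and zero: "\<zero>\<^bsub>cohomology A\<^esub> \<in> massey_product A ps cs"
  obtains m where "full_defining_system A ps n m" "\<And>i. i < n \<Longrightarrow> m i i = x i"
proof -
  obtain m where m: "defining_system A ps cs m"
    and z: "cohomology_class A (massey_sum A ps m 0 (n - 1)) = coboundaries A"
    using zero len by (auto simp: massey_product_def zero_cohomology)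
  have comp: "massey_component A ps i j = hcomp A (massey_degree ps i j)" if "i \<le> j" "j < n" for i j
    using massey_degree_less[OF pos that] by (simp add: massey_component_def)
  have mij: "m i j \<in> hcomp A (massey_degree ps i j)" "differential A (m i j) = massey_sum A ps m i j"
    if "i \<le> j" "j < n" "(i, j) \<noteq> (0, n - 1)" for i j
    using m that comp[OF that(1,2)] len by (auto simp: defining_system_def)
  let ?S = "massey_sum A ps m 0 (n - 1)"
  have Sh: "?S \<in> hcomp A (Suc (massey_degree ps 0 (n - 1)))"
    by (rule massey_sum_hcomp[OF pos]) (use mij len in auto)
  then have "?S \<in> coboundaries A" using z hcomp_carrier by (simp add: cohomology_class_eq_zero_iff)
  then obtain u where u: "u \<in> hcomp A (massey_degree ps 0 (n - 1))" "?S = differential A u"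
    using homogeneous_primitive Sh by blast
  define m' where "m' i j = (if (i, j) = (0, n - 1) then u else m i j)" for i j
  have sum: "massey_sum A ps m' i j = massey_sum A ps m i j" if "i \<le> j" "j < n" for i j
  proof (rule massey_sum_cong)
    fix k assume k: "i \<le> k" "k < j"
    have kn: "k < n - 1" using k that by simp
    then show "m' i k = m i k" "m' (Suc k) j = m (Suc k) j" by (auto simp: m'_def)
    show "m i k \<in> carrier A" "m (Suc k) j \<in> carrier A"
      using mij(1)[of i k, THEN hcomp_carrier] mij(1)[of "Suc k" j, THEN hcomp_carrier] k kn that by auto
  qed
  have m': "full_defining_system A ps n m'" unfolding full_defining_system_def
  proof (intro allI impI)
    fix i j assume ij: "i \<le> j \<and> j < n"
    show "m' i j \<in> hcomp A (massey_degree ps i j) \<and> differential A (m' i j) = massey_sum A ps m' i j"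
      using sum[of i j] ij mij[of i j] u by (cases "(i, j) = (0, n - 1)") (auto simp: m'_def)
  qed
  have m'x: "m' i i \<ominus> x i \<in> coboundaries A" if i: "i < n" for i
  proof -
    have "m' i i = m i i" using len by (auto simp: m'_def)
    moreover have "m i i \<in> carrier A" using mij[of i i] i len hcomp_carrier by force
    moreover have "cohomology_class A (m i i) = cohomology_class A (x i)"
      using m i cs[OF i] len by (auto simp: defining_system_def)
    ultimately show ?thesis using x[OF i] hcomp_carrier by (auto simp: cohomology_class_eq_iff)
  qed
  interpret dga_quasi_iso A A id
    using quasi_isomorphism_id[OF dg_algebra_axioms] dg_algebra_axioms
    by (simp add: dga_quasi_iso_def dga_quasi_iso_axioms_def)
  show ?thesis
    using lift_full_defining_system[OF pos x m'] m'x that by auto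
qed

lemma massey_product_contains_zero:
  assumes len: "length cs = n" "2 \<le> n" and pos: "\<And>l. l < n \<Longrightarrow> 1 \<le> ps ! l"
    and m: "full_defining_system A ps n m"
    and cs: "\<And>i. i < n \<Longrightarrow> cs ! i = cohomology_class A (m i i)"
  shows "\<zero>\<^bsub>cohomology A\<^esub> \<in> massey_product A ps cs"
proof -
  have comp: "massey_component A ps i j = hcomp A (massey_degree ps i j)" if "i \<le> j" "j < n" for i j
    using massey_degree_less[OF pos that] by (simp add: massey_component_def)
  have "defining_system A ps cs m"
    using m cs comp len by (auto simp: defining_system_def full_defining_system_def)
  moreover have corner: "m 0 (n - 1) \<in> hcomp A (massey_degree ps 0 (n - 1))"
    "differential A (m 0 (n - 1)) = massey_sum A ps m 0 (n - 1)"
    using m len by (auto simp: full_defining_system_def)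
  have "massey_sum A ps m 0 (n - 1) = differential A (m 0 (n - 1))" "m 0 (n - 1) \<in> carrier A"
    using corner hcomp_carrier by auto
  then have "massey_sum A ps m 0 (n - 1) \<in> coboundaries A" by (auto simp: coboundaries_def)
  then have "cohomology_class A (massey_sum A ps m 0 (n - 1)) = \<zero>\<^bsub>cohomology A\<^esub>"
    using coboundaries_closed(2) by (simp add: cohomology_class_eq_zero_iff zero_cohomology)
  ultimately show ?thesis using len by (auto simp: massey_product_def)
qed

text \<open>All Massey products of classes of positive degree vanish on a formal algebra.\<close>

theorem formal_imp_massey_product_trivial:
  assumes formal: "formal TYPE('c) A"
    and ps: "\<forall>p\<in>set ps. 1 \<le> p"
    and x: "\<And>i. i < length cs \<Longrightarrow> x i \<in> cocycles A \<inter> hcomp A (ps ! i)"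
    and cs: "\<And>i. i < length cs \<Longrightarrow> cs ! i = cohomology_class A (x i)"
  shows "\<not> massey_nontrivial A ps cs"
proof
  assume nontriv: "massey_nontrivial A ps cs"
  define n where "n = length cs"
  have n: "3 \<le> n" "length ps = n"
    using nontriv by (auto simp: massey_nontrivial_def massey_defined_def n_def)
  then have pos: "1 \<le> ps ! l" if "l < n" for l using ps that by (auto intro: bspec nth_mem)
  obtain m where m: "defining_system A ps cs m"
    using nontriv by (auto simp: massey_nontrivial_def massey_defined_def)
  have xc: "x i \<in> carrier A" if "i < n" for i using x that hcomp_carrier by (auto simp: n_def)
  have "x i \<otimes> x (Suc i) \<in> coboundaries A" if i: "Suc i < n" for i
  proof -
    have comp: "massey_component A ps p q = hcomp A (massey_degree ps p q)" if "p \<le> q" "q < n" for p q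
      using massey_degree_less[OF pos that] by (simp add: massey_component_def)
    have mh: "m p q \<in> hcomp A (massey_degree ps p q)" "differential A (m p q) = massey_sum A ps m p q"
      if "p \<le> q" "q < n" "(p, q) \<noteq> (0, n - 1)" for p q
      using m that comp[OF that(1,2)] by (auto simp: defining_system_def n_def)
    have mc: "m p q \<in> carrier A" "differential A (m p q) = massey_sum A ps m p q"
      if "p \<le> q" "q < n" "(p, q) \<noteq> (0, n - 1)" for p q
      using mh[OF that] hcomp_carrier by blast+
    have diag: "m p p \<ominus> x p \<in> coboundaries A \<and> m p p \<in> cocycles A" if p: "p < n" for p
    proof -
      have "cohomology_class A (m p p) = cohomology_class A (x p)"
        using m p cs by (auto simp: defining_system_def n_def)
      moreover have "(p, p) \<noteq> (0, n - 1)" using n by auto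
      ultimately show ?thesis
        using mc[of p p] p xc[of p] by (simp add: cohomology_class_eq_iff cocycles_def)
    qed
    have ms: "m i i \<in> carrier A" "m (Suc i) (Suc i) \<in> carrier A" "m i (Suc i) \<in> carrier A"
      "differential A (m i (Suc i)) = massey_sum A ps m i (Suc i)"
      by (rule mc; use i n in auto)+
    let ?s = "(- 1 :: real) ^ (ps ! i)"
    have "differential A (m i (Suc i)) = (?s \<odot> m i i) \<otimes> m (Suc i) (Suc i)"
      using ms by (simp add: massey_sum_def)
    then have "m i i \<otimes> m (Suc i) (Suc i) = differential A (?s \<odot> m i (Suc i))"
      using ms by (simp add: differential_smult smult_mult_left smult_smult)
    then have 1: "m i i \<otimes> m (Suc i) (Suc i) \<in> coboundaries A"
      using ms by (auto simp: coboundaries_def)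
    have 2: "(m i i \<ominus> x i) \<otimes> x (Suc i) \<in> coboundaries A"
      "m i i \<otimes> (m (Suc i) (Suc i) \<ominus> x (Suc i)) \<in> coboundaries A"
      using diag[of i] diag[of "Suc i"] i x[of "Suc i"]
      by (auto intro: coboundaries_mult(1) coboundaries_mult(2) simp: n_def)
    have "x i \<otimes> x (Suc i) = m i i \<otimes> m (Suc i) (Suc i) \<ominus>
        m i i \<otimes> (m (Suc i) (Suc i) \<ominus> x (Suc i)) \<ominus> (m i i \<ominus> x i) \<otimes> x (Suc i)"
      using ms xc[of i] xc[of "Suc i"] i by (simp add: mult_diff_telescope)
    then show ?thesis using 1 2 by (simp add: coboundaries_minus)
  qed
  moreover have "massey_trivial ps n A"
    by (rule formal_imp_massey_trivial[OF dg_algebra_axioms formal pos])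
  ultimately obtain m where m: "full_defining_system A ps n m"
      "\<And>i. i < n \<Longrightarrow> m i i \<ominus> x i \<in> coboundaries A"
    using massey_trivialE[of ps n A x] x unfolding n_def by blast
  have "cs ! i = cohomology_class A (m i i)" if i: "i < n" for i
  proof -
    have "m i i \<in> carrier A" using m(1) i hcomp_carrier by (auto simp: full_defining_system_def)
    then show ?thesis
      using m(2)[OF i] i xc[OF i] cs[of i] cohomology_class_eq_iff[of "m i i" "x i"]
      by (simp add: n_def)
  qed
  then have "\<zero>\<^bsub>cohomology A\<^esub> \<in> massey_product A ps cs"
    using massey_product_contains_zero[OF n_def[symmetric] _ pos m(1)] n by auto
  with nontriv show False by (simp add: massey_nontrivial_def)
qed

end

section \<open>Smooth functions and means along lines\<close>

abbreviation dir_deriv :: "'v::euclidean_space \<Rightarrow> ('v \<Rightarrow> real) \<Rightarrow> 'v \<Rightarrow> real" where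
  "dir_deriv v f \<equiv> (\<lambda>p. frechet_derivative f (at p) v)"

lemma smooth_differentiable: "smooth f \<Longrightarrow> f differentiable (at p)"
  unfolding smooth_def by (metis k_times_cont_diff.simps(2))

lemma smooth_dir_deriv: "smooth f \<Longrightarrow> smooth (dir_deriv v f)"
  unfolding smooth_def by (metis k_times_cont_diff.simps(2))

lemma smooth_continuous: "smooth f \<Longrightarrow> continuous_on S f"
  unfolding smooth_def by (metis continuous_on_subset k_times_cont_diff.simps(1) top_greatest)

lemma smooth_has_derivative: "smooth f \<Longrightarrow> (f has_derivative frechet_derivative f (at p)) (at p)"
  using smooth_differentiable frechet_derivative_works by blast

lemma linear_dir_deriv: "smooth f \<Longrightarrow> linear (\<lambda>v. dir_deriv v f p)"
  by (rule linear_frechet_derivative[OF smooth_differentiable])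

text \<open>Smoothness is coinductive: a class of differentiable functions that is closed under
  directional derivatives consists of smooth functions.\<close>

lemma smooth_coinduct:
  assumes "P f" and d: "\<And>f p. P f \<Longrightarrow> f differentiable (at p)"
    and step: "\<And>f v. P f \<Longrightarrow> P (dir_deriv v f)"
  shows "smooth f"
proof -
  have "k_times_cont_diff k f" if "P f" for k f
    using that
  proof (induction k arbitrary: f)
    case 0
    then show ?case using differentiable_imp_continuous_on[of f UNIV] d
      by (simp add: differentiable_on_def)
  qed (use d step in auto)
  with \<open>P f\<close> show ?thesis by (simp add: smooth_def)
qed

lemma dir_deriv_eqI: "(f has_derivative f') (at p) \<Longrightarrow> dir_deriv v f p = f' v"
  using frechet_derivative_at by metis

lemma dir_deriv_const [simp]: "dir_deriv v (\<lambda>_. c) = (\<lambda>_. 0)"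
  using dir_deriv_eqI[OF has_derivative_const] by (simp add: fun_eq_iff)

lemma dir_deriv_add:
  "smooth f \<Longrightarrow> smooth g \<Longrightarrow> dir_deriv v (\<lambda>p. f p + g p) = (\<lambda>p. dir_deriv v f p + dir_deriv v g p)"
  by (rule ext) (rule dir_deriv_eqI[OF has_derivative_add[OF smooth_has_derivative smooth_has_derivative]])

lemma dir_deriv_cmult:
  "smooth f \<Longrightarrow> dir_deriv v (\<lambda>p. c * f p) = (\<lambda>p. c * dir_deriv v f p)"
  by (rule ext) (rule dir_deriv_eqI[OF has_derivative_mult_right[OF smooth_has_derivative]])

lemma dir_deriv_mult:
  "smooth f \<Longrightarrow> smooth g \<Longrightarrow>
    dir_deriv v (\<lambda>p. f p * g p) = (\<lambda>p. f p * dir_deriv v g p + dir_deriv v f p * g p)"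
  by (rule ext) (rule dir_deriv_eqI[OF has_derivative_mult[OF smooth_has_derivative smooth_has_derivative]])

lemma smooth_const [simp, intro]: "smooth (\<lambda>_. c)"
  by (rule smooth_coinduct[where P = "\<lambda>f. \<exists>c. f = (\<lambda>_. c)"]) auto

lemma k_times_cont_diff_add:
  "k_times_cont_diff k f \<Longrightarrow> k_times_cont_diff k g \<Longrightarrow> k_times_cont_diff k (\<lambda>p. f p + g p)"
proof (induction k arbitrary: f g)
  case (Suc k)
  then have d: "\<And>p. f differentiable (at p)" "\<And>p. g differentiable (at p)" by simp_all
  have "dir_deriv v (\<lambda>p. f p + g p) = (\<lambda>p. dir_deriv v f p + dir_deriv v g p)" for v
    by (rule ext) (rule dir_deriv_eqI[OF has_derivative_add[OF
      d(1)[unfolded frechet_derivative_works] d(2)[unfolded frechet_derivative_works]]])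
  with Suc d show ?case by simp
qed (simp add: continuous_on_add)

lemma smooth_add [intro]: "smooth f \<Longrightarrow> smooth g \<Longrightarrow> smooth (\<lambda>p. f p + g p)"
  by (simp add: smooth_def k_times_cont_diff_add)

lemma smooth_sum [intro]: "(\<And>i. i \<in> I \<Longrightarrow> smooth (f i)) \<Longrightarrow> smooth (\<lambda>p. \<Sum>i\<in>I. f i p)"
  by (induction I rule: infinite_finite_induct) (simp_all add: smooth_add)

lemma smooth_mult [intro]:
  assumes "smooth f" "smooth g"
  shows "smooth (\<lambda>p. f p * g p)"
proof -
  have "k_times_cont_diff k (\<lambda>p. f p * g p)" if "smooth f" "smooth g" for k and f g :: "'a \<Rightarrow> real"
    using that
  proof (induction k arbitrary: f g)
    case 0
    then show ?case by (simp add: continuous_on_mult smooth_continuous)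
  next
    case (Suc k)
    then show ?case
      by (simp add: smooth_differentiable dir_deriv_mult k_times_cont_diff_add smooth_dir_deriv)
  qed
  with assms show ?thesis by (simp add: smooth_def)
qed

lemma smooth_cmult [intro]: "smooth f \<Longrightarrow> smooth (\<lambda>p. c * f p)"
  by (intro smooth_mult smooth_const)

lemma dir_deriv_comp_affine:
  assumes "smooth f" "linear L"
  shows "dir_deriv v (\<lambda>p. f (a + L p)) = (\<lambda>p. dir_deriv (L v) f (a + L p))"
    "(\<lambda>p. f (a + L p)) differentiable (at p)"
proof -
  have L: "((\<lambda>p. a + L p) has_derivative L) (at p)" for p
    using assms(2) by (auto intro!: derivative_eq_intros linear_imp_has_derivative)
  have "((\<lambda>p. f (a + L p)) has_derivative (\<lambda>v. frechet_derivative f (at (a + L p)) (L v))) (at p)" for p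
    using has_derivative_compose[OF L smooth_has_derivative[OF assms(1)]] .
  note der = this
  show "dir_deriv v (\<lambda>p. f (a + L p)) = (\<lambda>p. dir_deriv (L v) f (a + L p))"
    by (rule ext) (rule dir_deriv_eqI[OF der])
  show "(\<lambda>p. f (a + L p)) differentiable (at p)"
    using der unfolding differentiable_def by blast
qed

lemma smooth_comp_affine:
  assumes "smooth f" "linear L"
  shows "smooth (\<lambda>p. f (a + L p))"
proof (rule smooth_coinduct[where P = "\<lambda>h. \<exists>f. smooth f \<and> h = (\<lambda>p. f (a + L p))"])
  fix h p v assume "\<exists>f. smooth f \<and> h = (\<lambda>p. f (a + L p))"
  then obtain f where f: "smooth f" "h = (\<lambda>p. f (a + L p))" by blast
  then show "h differentiable (at p)" using dir_deriv_comp_affine(2)[OF f(1) assms(2)] by simp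
  show "\<exists>f. smooth f \<and> dir_deriv v h = (\<lambda>p. f (a + L p))"
    using f smooth_dir_deriv dir_deriv_comp_affine(1)[OF f(1) assms(2)] by auto
qed (use assms in blast)

lemma dir_deriv_diff:
  "smooth f \<Longrightarrow> smooth g \<Longrightarrow> dir_deriv v (\<lambda>p. f p - g p) = (\<lambda>p. dir_deriv v f p - dir_deriv v g p)"
  by (rule ext) (rule dir_deriv_eqI[OF has_derivative_diff[OF smooth_has_derivative smooth_has_derivative]])

lemma smooth_linear:
  assumes "linear (f :: 'v::euclidean_space \<Rightarrow> real)"
  shows "smooth f" "dir_deriv v f = (\<lambda>_. f v)"
proof -
  have d: "(f has_derivative f) (at p)" for p using assms by (rule linear_imp_has_derivative)
  show *: "dir_deriv v f = (\<lambda>_. f v)" for v by (rule ext) (rule dir_deriv_eqI[OF d])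
  show "smooth f"
    by (rule smooth_coinduct[where P = "\<lambda>g. g = f \<or> (\<exists>c. g = (\<lambda>_. c))"])
      (use d * in \<open>auto simp: differentiable_def intro: has_derivative_const\<close>)
qed

definition line_mean :: "(real \<Rightarrow> real) \<Rightarrow> real \<Rightarrow> 'v::euclidean_space \<Rightarrow> ('v \<Rightarrow> real) \<Rightarrow> 'v \<Rightarrow> real" where
  "line_mean w T e f p = integral {0..T} (\<lambda>t. w t * f (p + t *\<^sub>R e))"

lemma continuous_along_line:
  fixes f :: "'v::euclidean_space \<Rightarrow> real"
  assumes "smooth f" "continuous_on UNIV w"
  shows "continuous_on S (\<lambda>t. w t * f (p + t *\<^sub>R e))"
proof -
  have "continuous_on S (\<lambda>t. f (p + t *\<^sub>R e))"
    by (rule continuous_on_compose2[OF smooth_continuous[OF assms(1), of UNIV]])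
      (auto intro!: continuous_intros)
  then show ?thesis using continuous_on_subset[OF assms(2)] by (intro continuous_intros) auto
qed

lemma integrable_along_line:
  fixes f :: "'v::euclidean_space \<Rightarrow> real"
  assumes "smooth f" "continuous_on UNIV w"
  shows "(\<lambda>t. w t * f (p + t *\<^sub>R e)) integrable_on {0..T}"
  by (intro integrable_continuous_interval continuous_along_line assms)

lemma line_mean_derivative:
  fixes f :: "'v::euclidean_space \<Rightarrow> real"
  assumes f: "smooth f" and w: "continuous_on UNIV w"
  shows "dir_deriv v (line_mean w T e f) = line_mean w T e (dir_deriv v f)"
    "line_mean w T e f differentiable (at p)"
proof -
  let ?B = "\<lambda>p t. w t *\<^sub>R Blinfun (frechet_derivative f (at (p + t *\<^sub>R e)))"
  have bl: "bounded_linear (frechet_derivative f (at q))" for q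
    using smooth_has_derivative[OF f] by (rule has_derivative_bounded_linear)
  have app: "blinfun_apply (?B p t) v = w t * dir_deriv v f (p + t *\<^sub>R e)" for p t v
    using bl by (simp add: blinfun.scaleR_left bounded_linear_Blinfun_apply)
  have cont: "continuous_on S (\<lambda>(p, t). ?B p t)" for S :: "('v \<times> real) set"
  proof (rule continuous_on_blinfun_componentwise)
    fix i :: 'v
    have "continuous_on S (\<lambda>x. w (snd x) * dir_deriv i f (fst x + snd x *\<^sub>R e))"
      by (intro continuous_intros continuous_on_compose2[OF w]
          continuous_on_compose2[OF smooth_continuous[OF smooth_dir_deriv[OF f], of UNIV]]) auto
    then show "continuous_on S (\<lambda>x. blinfun_apply (case x of (p, t) \<Rightarrow> ?B p t) i)"
      by (simp add: case_prod_beta app)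
  qed
  have der: "((\<lambda>q. w t * f (q + t *\<^sub>R e)) has_derivative blinfun_apply (?B p t)) (at p within UNIV)" for p t
  proof -
    have shift: "((\<lambda>q. q + t *\<^sub>R e) has_derivative (\<lambda>v. v)) (at p)" by (auto intro!: derivative_eq_intros)
    have "((\<lambda>q. f (q + t *\<^sub>R e)) has_derivative frechet_derivative f (at (p + t *\<^sub>R e))) (at p)"
      using has_derivative_compose[OF shift smooth_has_derivative[OF f]] by simp
    then have "((\<lambda>q. w t * f (q + t *\<^sub>R e)) has_derivative
        (\<lambda>v. w t * frechet_derivative f (at (p + t *\<^sub>R e)) v)) (at p)"
      by (rule has_derivative_mult_right)
    moreover have "blinfun_apply (?B p t) = (\<lambda>v. w t * frechet_derivative f (at (p + t *\<^sub>R e)) v)"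
      by (rule ext) (rule app)
    ultimately show ?thesis by simp
  qed
  have L: "(line_mean w T e f has_derivative blinfun_apply (integral (cbox 0 T) (?B p))) (at p)" for p
    using leibniz_rule[of UNIV 0 T "\<lambda>p t. w t * f (p + t *\<^sub>R e)" ?B p, OF der]
      integrable_along_line[OF f w] cont
    by (simp add: line_mean_def[abs_def])
  have "blinfun_apply (integral (cbox 0 T) (?B p)) v = line_mean w T e (dir_deriv v f) p" for p v
  proof -
    have "?B p integrable_on cbox 0 T"
    proof (rule integrable_continuous)
      have "continuous_on (cbox 0 T) (\<lambda>t. (\<lambda>(p, t). ?B p t) (p, t))"
        by (rule continuous_on_compose2[OF cont[of UNIV]]) (auto intro!: continuous_intros)
      then show "continuous_on (cbox 0 T) (?B p)" by simp
    qed
    then have "integral (cbox 0 T) ((\<lambda>b. blinfun_apply b v) \<circ> ?B p) =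
        blinfun_apply (integral (cbox 0 T) (?B p)) v"
      by (rule integral_linear) (rule blinfun.bounded_linear_left)
    then show ?thesis by (simp add: line_mean_def o_def app)
  qed
  then show "dir_deriv v (line_mean w T e f) = line_mean w T e (dir_deriv v f)"
    by (intro ext) (rule trans[OF dir_deriv_eqI[OF L]])
  show "line_mean w T e f differentiable (at p)" using L unfolding differentiable_def by blast
qed

lemma smooth_line_mean:
  fixes f :: "'v::euclidean_space \<Rightarrow> real"
  assumes "smooth f" "continuous_on UNIV w"
  shows "smooth (line_mean w T e f)"
  by (rule smooth_coinduct[where P = "\<lambda>h. \<exists>f. smooth f \<and> h = line_mean w T e f"])
    (auto simp: assms line_mean_derivative[OF _ assms(2)] intro: assms smooth_dir_deriv)

lemma has_vector_derivative_along_line: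
  fixes f :: "'v::euclidean_space \<Rightarrow> real"
  assumes "smooth f"
  shows "((\<lambda>t. f (p + t *\<^sub>R e)) has_vector_derivative dir_deriv e f (p + t *\<^sub>R e)) (at t within S)"
proof -
  have line: "((\<lambda>t. p + t *\<^sub>R e) has_derivative (\<lambda>s. s *\<^sub>R e)) (at t within S)"
    by (auto intro!: derivative_eq_intros)
  have "((\<lambda>t. f (p + t *\<^sub>R e)) has_derivative
      (\<lambda>s. frechet_derivative f (at (p + t *\<^sub>R e)) (s *\<^sub>R e))) (at t within S)"
    by (rule has_derivative_compose[OF line smooth_has_derivative[OF assms]])
  then show ?thesis
    using linear_dir_deriv[OF assms] by (simp add: has_vector_derivative_def linear_cmul)
qed

lemma line_mean_dir_deriv:
  fixes f :: "'v::euclidean_space \<Rightarrow> real"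
  assumes "smooth f" "0 \<le> T"
  shows "line_mean (\<lambda>_. 1) T e (dir_deriv e f) p = f (p + T *\<^sub>R e) - f p"
    "line_mean (\<lambda>t. t) T e (dir_deriv e f) p = T * f (p + T *\<^sub>R e) - line_mean (\<lambda>_. 1) T e f p"
proof -
  note D = has_vector_derivative_along_line[OF assms(1), of p e]
  show "line_mean (\<lambda>_. 1) T e (dir_deriv e f) p = f (p + T *\<^sub>R e) - f p"
    using fundamental_theorem_of_calculus[OF assms(2) D] by (simp add: line_mean_def integral_unique)
  have "((\<lambda>t. t * f (p + t *\<^sub>R e)) has_vector_derivative
      (1 * f (p + t *\<^sub>R e) + t * dir_deriv e f (p + t *\<^sub>R e))) (at t within S)" for t S
    using has_vector_derivative_mult[OF has_vector_derivative_id D] by (simp add: add.commute)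
  from fundamental_theorem_of_calculus[OF assms(2) this]
  have "integral {0..T} (\<lambda>t. 1 * f (p + t *\<^sub>R e) + t * dir_deriv e f (p + t *\<^sub>R e)) = T * f (p + T *\<^sub>R e)"
    by (simp add: integral_unique)
  moreover have "integral {0..T} (\<lambda>t. 1 * f (p + t *\<^sub>R e) + t * dir_deriv e f (p + t *\<^sub>R e)) =
      line_mean (\<lambda>_. 1) T e f p + line_mean (\<lambda>t. t) T e (dir_deriv e f) p"
    unfolding line_mean_def
    by (rule integral_add) (intro integrable_along_line smooth_dir_deriv assms continuous_intros)+
  ultimately show "line_mean (\<lambda>t. t) T e (dir_deriv e f) p =
      T * f (p + T *\<^sub>R e) - line_mean (\<lambda>_. 1) T e f p" by linarith
qed

text \<open>The increment of \<open>f\<close> in direction \<open>v\<close> is the integral of its derivative. Differentiating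
  this in direction \<open>w\<close> under the integral sign, and comparing with the increment of the
  \<open>w\<close>-derivative, shows that both mixed derivatives have the same integrals.\<close>

lemma dir_deriv_commute:
  fixes f :: "'v::euclidean_space \<Rightarrow> real"
  assumes f: "smooth f"
  shows "dir_deriv v (dir_deriv w f) = dir_deriv w (dir_deriv v f)"
proof
  fix q
  let ?vw = "dir_deriv v (dir_deriv w f)" and ?wv = "dir_deriv w (dir_deriv v f)"
  have s: "smooth ?vw" "smooth ?wv" by (intro smooth_dir_deriv f)+
  have eq: "line_mean (\<lambda>_. 1) T v ?vw q = line_mean (\<lambda>_. 1) T v ?wv q" if "0 \<le> T" for T
  proof -
    have "line_mean (\<lambda>_. 1) T v (dir_deriv v f) = (\<lambda>q. f (T *\<^sub>R v + q) + (- 1) * f q)"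
      using line_mean_dir_deriv(1)[OF f that] by (simp add: fun_eq_iff add.commute)
    moreover have eq: "dir_deriv w (\<lambda>q. f (T *\<^sub>R v + q) + (- 1) * f q) =
        (\<lambda>q. dir_deriv w f (T *\<^sub>R v + q) + (- 1) * dir_deriv w f q)"
      unfolding dir_deriv_add[OF smooth_comp_affine[OF f linear_ident] smooth_cmult[OF f]]
        fun_cong[OF dir_deriv_cmult[OF f]] fun_cong[OF dir_deriv_comp_affine(1)[OF f linear_ident]] ..
    ultimately have "dir_deriv w (line_mean (\<lambda>_. 1) T v (dir_deriv v f)) q =
        dir_deriv w f (T *\<^sub>R v + q) + (- 1) * dir_deriv w f q"
      using fun_cong[OF eq, of q] by simp
    then have "line_mean (\<lambda>_. 1) T v ?wv q = dir_deriv w f (T *\<^sub>R v + q) - dir_deriv w f q"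
      using fun_cong[OF line_mean_derivative(1)[where f = "dir_deriv v f" and w = "\<lambda>_. 1" and v = w
        and T = T and e = v, OF smooth_dir_deriv[OF f] continuous_on_const], of q] by simp
    then show ?thesis
      using line_mean_dir_deriv(1)[OF smooth_dir_deriv[OF f] that] by (simp add: add.commute)
  qed
  let ?g = "\<lambda>t. ?vw (q + t *\<^sub>R v) - ?wv (q + t *\<^sub>R v)"
  have cont: "continuous_on {0..1} ?g"
    using continuous_along_line[OF s(1), of "\<lambda>_. 1"] continuous_along_line[OF s(2), of "\<lambda>_. 1"]
    by (auto intro!: continuous_intros)
  have "integral {0..T} ?g = 0" if "T \<in> {0..1}" for T
  proof -
    have "integral {0..T} ?g = line_mean (\<lambda>_. 1) T v ?vw q - line_mean (\<lambda>_. 1) T v ?wv q"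
      unfolding line_mean_def
      using integral_diff[OF integrable_along_line[OF s(1), of "\<lambda>_. 1"] integrable_along_line[OF s(2), of "\<lambda>_. 1"]]
      by simp
    with eq that show ?thesis by simp
  qed
  then have "((\<lambda>T. 0 :: real) has_vector_derivative ?g 0) (at 0 within {0..1})"
    using integral_has_vector_derivative[OF cont, of 0] has_vector_derivative_transform[of 0 "{0..1}"]
    by (metis (no_types, lifting) atLeastAtMost_iff order_refl zero_le_one)
  then have "?g 0 = 0"
    using vector_derivative_unique_within_closed_interval[of 0 1 0 "\<lambda>_. 0 :: real" "?g 0" 0]
      has_vector_derivative_const by fastforce
  then show "?vw q = ?wv q" by simp
qed

section \<open>Exterior algebra on lists of vectors\<close>

definition lwedge :: "('v list \<Rightarrow> real) \<Rightarrow> ('v list \<Rightarrow> real) \<Rightarrow> 'v list \<Rightarrow> real" where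
  "lwedge f g vs = (\<Sum>S\<in>Pow {..<length vs}.
     shuffle_sign (length vs) S * f (nths vs S) * g (nths vs (- S)))"

lemma wedge_eq_lwedge: "(\<omega> \<and>\<^sub>w \<eta>) p = lwedge (\<omega> p) (\<eta> p)"
  by (simp add: wedge_def lwedge_def fun_eq_iff)

definition contract :: "'v \<Rightarrow> ('v list \<Rightarrow> real) \<Rightarrow> 'v list \<Rightarrow> real" where
  "contract v f = (\<lambda>vs. f (v # vs))"

definition grading_sign :: "('v list \<Rightarrow> real) \<Rightarrow> 'v list \<Rightarrow> real" where
  "grading_sign f = (\<lambda>vs. (- 1) ^ length vs * f vs)"

lemma shuffle_sign_Suc:
  assumes "T \<subseteq> {..<n}"
  shows "shuffle_sign (Suc n) (insert 0 (Suc ` T)) = shuffle_sign n T"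
    "shuffle_sign (Suc n) (Suc ` T) = (- 1) ^ card T * shuffle_sign n T"
proof -
  let ?I = "{(i, j). i \<in> T \<and> j \<in> {..<n} - T \<and> j < i}"
  have fin: "finite T" "finite ?I"
    using finite_subset[OF assms] finite_subset[of ?I "T \<times> {..<n}"] by auto
  have S: "(i, j) \<in> map_prod Suc Suc ` ?I \<longleftrightarrow> (\<exists>a b. i = Suc a \<and> j = Suc b \<and> (a, b) \<in> ?I)" for i j
    by auto
  have 1: "{(i, j). i \<in> insert 0 (Suc ` T) \<and> j \<in> {..<Suc n} - insert 0 (Suc ` T) \<and> j < i} = map_prod Suc Suc ` ?I"
    using S by (auto simp: less_Suc_eq_0_disj)
  have 2: "{(i, j). i \<in> Suc ` T \<and> j \<in> {..<Suc n} - Suc ` T \<and> j < i} =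
      map_prod Suc Suc ` ?I \<union> (\<lambda>i. (Suc i, 0)) ` T"
    using S by (auto simp: less_Suc_eq_0_disj)
  have c: "card (map_prod Suc Suc ` ?I) = card ?I"
    by (rule card_image) (auto simp: inj_on_def)
  have "card (map_prod Suc Suc ` ?I \<union> (\<lambda>i. (Suc i, 0)) ` T) = card ?I + card ((\<lambda>i. (Suc i, 0::nat)) ` T)"
    unfolding c[symmetric] using fin by (intro card_Un_disjoint) auto
  also have "card ((\<lambda>i. (Suc i, 0::nat)) ` T) = card T" by (rule card_image) (auto simp: inj_on_def)
  finally show "shuffle_sign (Suc n) (insert 0 (Suc ` T)) = shuffle_sign n T"
    "shuffle_sign (Suc n) (Suc ` T) = (- 1) ^ card T * shuffle_sign n T"
    by (simp_all only: shuffle_sign_def 1 2 c power_add mult.commute)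
qed

lemma Pow_lessThan_Suc:
  "Pow {..<Suc n} = (\<lambda>T. insert 0 (Suc ` T)) ` Pow {..<n} \<union> image Suc ` Pow {..<n}"
proof -
  have *: "{..<Suc n} = insert 0 (Suc ` {..<n})" by (rule lessThan_Suc_eq_insert_0)
  have "Pow (Suc ` {..<n}) = image Suc ` Pow {..<n}" by (simp add: image_Pow_surj)
  then show ?thesis unfolding * Pow_insert by (auto simp: image_image)
qed

text \<open>Sorting the shuffles by the side that receives the first vector gives a recursion on lists:
  contraction is an antiderivation. All algebraic laws follow from it by induction.\<close>

lemma lwedge_Nil [simp]: "lwedge f g [] = f [] * g []"
  by (simp add: lwedge_def shuffle_sign_def)

lemma lwedge_Cons:
  "lwedge f g (v # vs) = lwedge (contract v f) g vs + lwedge (grading_sign f) (contract v g) vs"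
proof -
  let ?n = "length vs"
  let ?t = "\<lambda>S. shuffle_sign (Suc ?n) S * f (nths (v # vs) S) * g (nths (v # vs) (- S))"
  have inj: "inj_on (\<lambda>T. insert 0 (Suc ` T)) (Pow {..<?n})" "inj_on (image Suc) (Pow {..<?n})"
    by (auto simp: inj_on_def)
  have disj: "(\<lambda>T. insert 0 (Suc ` T)) ` Pow {..<?n} \<inter> image Suc ` Pow {..<?n} = {}" by auto
  have "lwedge f g (v # vs) = (\<Sum>T\<in>Pow {..<?n}. ?t (insert 0 (Suc ` T))) + (\<Sum>T\<in>Pow {..<?n}. ?t (Suc ` T))"
    unfolding lwedge_def length_Cons Pow_lessThan_Suc
    by (subst sum.union_disjoint) (simp_all only: finite_imageI finite_Pow_iff finite_lessThan disj
        sum.reindex[OF inj(1)] sum.reindex[OF inj(2)] o_def)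
  moreover have "?t (insert 0 (Suc ` T)) = shuffle_sign ?n T * contract v f (nths vs T) * g (nths vs (- T))"
    if "T \<in> Pow {..<?n}" for T
  proof -
    have "{j. Suc j \<in> insert 0 (Suc ` T)} = T" "{j. Suc j \<in> - insert 0 (Suc ` T)} = - T" by auto
    with that shuffle_sign_Suc(1)[of T ?n] show ?thesis by (simp add: nths_Cons contract_def)
  qed
  moreover have "?t (Suc ` T) = shuffle_sign ?n T * grading_sign f (nths vs T) * contract v g (nths vs (- T))"
    if T: "T \<in> Pow {..<?n}" for T
  proof -
    have "{j. Suc j \<in> Suc ` T} = T" "{j. Suc j \<in> - (Suc ` T)} = - T" by auto
    moreover have "length (nths vs T) = card T"
      using T by (auto simp: length_nths intro!: arg_cong[of _ _ card])
    ultimately show ?thesis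
      using T shuffle_sign_Suc(2)[of T ?n] by (simp add: nths_Cons contract_def grading_sign_def)
  qed
  ultimately show ?thesis by (simp add: lwedge_def)
qed

lemma contract_lwedge:
  "contract v (lwedge f g) = lwedge (contract v f) g + lwedge (grading_sign f) (contract v g)"
  by (simp add: contract_def[of v "lwedge f g"] fun_eq_iff lwedge_Cons)

lemma lwedge_add_left: "lwedge (f + g) h = lwedge f h + lwedge g h"
  and lwedge_add_right: "lwedge h (f + g) = lwedge h f + lwedge h g"
  by (simp_all add: lwedge_def fun_eq_iff sum.distrib algebra_simps)

abbreviation (input) scale :: "real \<Rightarrow> ('v list \<Rightarrow> real) \<Rightarrow> 'v list \<Rightarrow> real" where
  "scale r f \<equiv> (\<lambda>vs. r * f vs)"

lemma lwedge_scale_left: "lwedge (scale r f) g = scale r (lwedge f g)"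
  and lwedge_scale_right: "lwedge f (scale r g) = scale r (lwedge f g)"
  by (simp_all add: lwedge_def fun_eq_iff sum_distrib_left algebra_simps)

lemma lwedge_zero_left [simp]: "lwedge 0 g = 0"
  and lwedge_zero_right [simp]: "lwedge f 0 = 0"
  by (simp_all add: lwedge_def fun_eq_iff)

lemma lwedge_uminus_left: "lwedge (- f) g = - lwedge f g"
  and lwedge_uminus_right: "lwedge f (- g) = - lwedge f g"
  by (simp_all add: lwedge_def fun_eq_iff sum_negf)

lemma lwedge_diff_left: "lwedge (f - g) h = lwedge f h - lwedge g h"
  and lwedge_diff_right: "lwedge h (f - g) = lwedge h f - lwedge h g"
  by (simp_all add: lwedge_def fun_eq_iff sum_subtractf algebra_simps)

lemma contract_add: "contract v (f + g) = contract v f + contract v g"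
  and contract_uminus: "contract v (- f) = - contract v f"
  and contract_zero [simp]: "contract v 0 = 0"
  and contract_scale: "contract v (scale r f) = scale r (contract v f)"
  by (simp_all add: contract_def fun_eq_iff)

lemma contract_diff: "contract v (f - g) = contract v f - contract v g"
  and grading_sign_diff: "grading_sign (f - g) = grading_sign f - grading_sign g"
  by (simp_all add: contract_def grading_sign_def fun_eq_iff algebra_simps)

lemma grading_sign_add: "grading_sign (f + g) = grading_sign f + grading_sign g"
  and grading_sign_uminus: "grading_sign (- f) = - grading_sign f"
  and grading_sign_zero [simp]: "grading_sign 0 = 0"
  and grading_sign_scale: "grading_sign (scale r f) = scale r (grading_sign f)"
  and grading_sign_grading_sign [simp]: "grading_sign (grading_sign f) = f"
  and contract_grading_sign: "contract v (grading_sign f) = - grading_sign (contract v f)"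
  by (simp_all add: grading_sign_def contract_def fun_eq_iff algebra_simps)

lemma grading_sign_lwedge: "grading_sign (lwedge f g) = lwedge (grading_sign f) (grading_sign g)"
proof
  show "grading_sign (lwedge f g) vs = lwedge (grading_sign f) (grading_sign g) vs" for vs
  proof (induction vs arbitrary: f g)
    case (Cons v vs)
    have "grading_sign (lwedge f g) (v # vs) = - grading_sign (lwedge (contract v f) g) vs
        - grading_sign (lwedge (grading_sign f) (contract v g)) vs"
      by (simp add: grading_sign_def lwedge_Cons algebra_simps)
    also have "\<dots> = lwedge (grading_sign f) (grading_sign g) (v # vs)"
      by (simp add: Cons lwedge_Cons contract_grading_sign lwedge_uminus_left lwedge_uminus_right)
    finally show ?case .
  qed (simp add: grading_sign_def)
qed

lemma lwedge_assoc: "lwedge (lwedge f g) h = lwedge f (lwedge g h)"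
proof
  show "lwedge (lwedge f g) h vs = lwedge f (lwedge g h) vs" for vs
  proof (induction vs arbitrary: f g h)
    case (Cons v vs)
    then show ?case
      by (simp add: lwedge_Cons contract_lwedge lwedge_add_left lwedge_add_right grading_sign_lwedge)
  qed simp
qed

definition unit_form :: "'v list \<Rightarrow> real" where
  "unit_form vs = (if vs = [] then 1 else 0)"

lemma contract_unit [simp]: "contract v unit_form = 0"
  and grading_sign_unit [simp]: "grading_sign unit_form = unit_form"
  by (simp_all add: contract_def unit_form_def grading_sign_def fun_eq_iff)

lemma lwedge_unit [simp]: "lwedge unit_form f = f" "lwedge f unit_form = f"
proof -
  have "lwedge unit_form f vs = f vs \<and> lwedge f unit_form vs = f vs" for vs
  proof (induction vs arbitrary: f)
    case (Cons v vs)
    then show ?case by (simp add: lwedge_Cons contract_def[of v f])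
  qed (simp add: unit_form_def)
  then show "lwedge unit_form f = f" "lwedge f unit_form = f" by auto
qed

definition of_degree :: "nat \<Rightarrow> ('v list \<Rightarrow> real) \<Rightarrow> bool" where
  "of_degree k f \<longleftrightarrow> (\<forall>vs. length vs \<noteq> k \<longrightarrow> f vs = 0)"

lemma of_degree_contract: "of_degree (Suc k) f \<Longrightarrow> of_degree k (contract v f)"
  and of_degree_contract_0: "of_degree 0 f \<Longrightarrow> contract v f = 0"
  by (auto simp: of_degree_def contract_def)

lemma grading_sign_of_degree: "of_degree k f \<Longrightarrow> grading_sign f = scale ((- 1) ^ k) f"
  unfolding of_degree_def grading_sign_def fun_eq_iff by (metis mult_zero_right)

lemma of_degree_lwedge:
  assumes "of_degree i f" "of_degree j g"
  shows "of_degree (i + j) (lwedge f g)"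
  unfolding of_degree_def
proof (intro allI impI)
  fix vs :: "'a list" assume "length vs \<noteq> i + j"
  then show "lwedge f g vs = 0" using assms
  proof (induction vs arbitrary: f g i j)
    case Nil
    then show ?case by (auto simp: of_degree_def)
  next
    case (Cons v vs)
    have "lwedge (contract v f) g vs = 0"
      using Cons.prems of_degree_contract_0[of f v]
      by (cases i) (auto intro!: Cons.IH[of "i - 1" j] of_degree_contract)
    moreover have "lwedge (grading_sign f) (contract v g) vs = 0"
      using Cons.prems of_degree_contract_0[of g v]
      by (cases j) (auto intro!: Cons.IH[of i "j - 1"] of_degree_contract simp: of_degree_def grading_sign_def contract_def)
    ultimately show ?case by (simp add: lwedge_Cons)
  qed
qed

lemma lwedge_commute:
  assumes "of_degree i f" "of_degree j g"
  shows "lwedge f g = scale ((- 1) ^ (i * j)) (lwedge g f)"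
proof
  fix vs
  show "lwedge f g vs = scale ((- 1) ^ (i * j)) (lwedge g f) vs" using assms
  proof (induction vs arbitrary: f g i j)
    case Nil
    then show ?case by (cases "i = 0"; cases "j = 0") (auto simp: of_degree_def)
  next
    case (Cons v vs)
    have 1: "lwedge (contract v f) g vs = (- 1) ^ (i * j) * lwedge (grading_sign g) (contract v f) vs"
    proof (cases i)
      case 0
      with Cons.prems show ?thesis by (simp add: of_degree_contract_0)
    next
      case (Suc i')
      with Cons.prems Cons.IH[of i' "contract v f" j g] show ?thesis
        by (simp add: of_degree_contract grading_sign_of_degree lwedge_scale_left power_add)
    qed
    have 2: "lwedge (grading_sign f) (contract v g) vs = (- 1) ^ (i * j) * lwedge (contract v g) f vs"
    proof (cases j)
      case 0
      with Cons.prems show ?thesis by (simp add: of_degree_contract_0)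
    next
      case (Suc j')
      with Cons.prems Cons.IH[of i f j' "contract v g"] show ?thesis
        by (simp add: of_degree_contract grading_sign_of_degree lwedge_scale_left power_add)
    qed
    show ?case by (simp add: lwedge_Cons 1 2 algebra_simps)
  qed
qed

definition multilinear :: "('v::real_vector list \<Rightarrow> real) \<Rightarrow> bool" where
  "multilinear f \<longleftrightarrow> (\<forall>us vs. linear (\<lambda>v. f (us @ v # vs)))"

lemma multilinear_contract: "multilinear f \<Longrightarrow> multilinear (contract v f)"
  unfolding multilinear_def contract_def
proof (intro allI)
  fix us vs assume "\<forall>us vs. linear (\<lambda>v. f (us @ v # vs))"
  then have "linear (\<lambda>w. f ((v # us) @ w # vs))" by blast
  then show "linear (\<lambda>w. f (v # us @ w # vs))" by simp
qed

lemma adjacent_swap: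
  assumes "multilinear f" and adj: "\<And>us v vs. f (us @ v # v # vs) = 0"
  shows "f (us @ v # w # vs) = - f (us @ w # v # vs)"
proof -
  have l: "linear (\<lambda>v. f (us @ v # vs))" for us vs using assms(1) by (simp add: multilinear_def)
  have "0 = f (us @ (v + w) # (v + w) # vs)" using adj by simp
  also have "\<dots> = f (us @ v # (v + w) # vs) + f (us @ w # (v + w) # vs)"
    using linear_add[OF l] by blast
  also have "f (us @ v # (v + w) # vs) = f ((us @ [v]) @ v # vs) + f ((us @ [v]) @ w # vs)"
    using linear_add[OF l[of "us @ [v]" vs], of v w] by simp
  also have "f (us @ w # (v + w) # vs) = f ((us @ [w]) @ v # vs) + f ((us @ [w]) @ w # vs)"
    using linear_add[OF l[of "us @ [w]" vs], of v w] by simp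
  finally show ?thesis using adj[of us v vs] adj[of us w vs] by simp
qed

lemma alternating_iff:
  "alternating f \<longleftrightarrow> multilinear f \<and> (\<forall>us v vs. f (us @ v # v # vs) = 0)"
proof
  assume "alternating f"
  then show "multilinear f \<and> (\<forall>us v vs. f (us @ v # v # vs) = 0)"
    by (auto simp: alternating_def multilinear_def)
next
  assume f: "multilinear f \<and> (\<forall>us v vs. f (us @ v # v # vs) = 0)"
  have "f (us @ v # ws @ v # vs) = 0" for us v ws vs
  proof (induction ws arbitrary: us)
    case (Cons w ws)
    have "f (us @ v # w # ws @ v # vs) = - f (us @ w # v # ws @ v # vs)"
      by (rule adjacent_swap) (use f in blast)+
    also have "f (us @ w # v # ws @ v # vs) = 0" using Cons[of "us @ [w]"] by simp
    finally show ?case by simp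
  qed (use f in simp)
  then have "f vs = 0" if "\<not> distinct vs" for vs
    using not_distinct_decomp[OF that] by force
  with f show "alternating f" by (simp add: alternating_def multilinear_def)
qed

lemma alternating_adjacent: "alternating f \<Longrightarrow> f (us @ v # v # vs) = 0"
  by (simp add: alternating_iff)

lemma alternating_contract: "alternating f \<Longrightarrow> alternating (contract v f)"
  using multilinear_contract[of f v] alternating_adjacent[of f "v # us" for us]
  by (simp add: alternating_iff) (simp add: contract_def)

lemma alternating_contract_contract:
  "alternating f \<Longrightarrow> contract v (contract w f) = - contract w (contract v f)"
proof
  assume "alternating f"
  then have "f ([] @ w # v # vs) = - f ([] @ v # w # vs)" for vs
    by (intro adjacent_swap) (simp_all add: alternating_iff)
  then show "contract v (contract w f) vs = (- contract w (contract v f)) vs" for vs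
    by (simp add: contract_def)
qed

lemma alternating_contract_twice: "alternating f \<Longrightarrow> contract v (contract v f) = 0"
  using alternating_adjacent[of f "[]"] by (simp add: contract_def fun_eq_iff)

lemma alternating_zero [simp]: "alternating 0"
  and alternating_add: "alternating f \<Longrightarrow> alternating g \<Longrightarrow> alternating (f + g)"
  and alternating_unit [simp]: "alternating unit_form"
  by (auto simp: alternating_def unit_form_def linear_compose_add linear_zero)

lemma alternating_scale: "alternating f \<Longrightarrow> alternating (scale r f)"
  using linear_compose_scale_right[of "\<lambda>v. f (us @ v # vs)" r for us vs]
  by (simp add: alternating_def)

lemma alternating_uminus: "alternating f \<Longrightarrow> alternating (- f)"
  using alternating_scale[of f "-1"] by (simp add: fun_Compl_def)

lemma alternating_grading_sign:
  assumes "alternating f"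
  shows "alternating (grading_sign f)"
proof -
  have "linear (\<lambda>v. (- 1) ^ k * f (us @ v # vs))" for k us vs
    using linear_compose_scale_right[of "\<lambda>v. f (us @ v # vs)" "(- 1) ^ k"] assms
    by (simp add: alternating_def)
  from this[of "length (us @ vs) + 1" us vs for us vs] show ?thesis
    using assms by (simp add: alternating_def grading_sign_def)
qed

lemma linear_lwedge_left:
  assumes "\<And>xs. linear (\<lambda>v. F v xs)"
  shows "linear (\<lambda>v. lwedge (F v) g vs)"
  by (intro linearI) (simp_all add: lwedge_def linear_add[OF assms] linear_cmul[OF assms]
      sum.distrib sum_distrib_left algebra_simps)

lemma linear_lwedge_right:
  assumes "\<And>xs. linear (\<lambda>v. F v xs)"
  shows "linear (\<lambda>v. lwedge g (F v) vs)"
  by (intro linearI) (simp_all add: lwedge_def linear_add[OF assms] linear_cmul[OF assms]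
      sum.distrib sum_distrib_left algebra_simps)

lemma alternating_lwedge:
  assumes "alternating f" "alternating g"
  shows "alternating (lwedge f g)"
proof -
  have lin: "linear (\<lambda>v. lwedge f g (us @ v # vs))" for us vs
    using assms
  proof (induction us arbitrary: f g)
    case Nil
    have "linear (\<lambda>v. contract v h xs)" if "alternating h" for h xs
      using that[unfolded alternating_def, THEN conjunct1, rule_format, of "[]" xs]
      by (simp add: contract_def)
    with Nil show ?case
      by (auto simp: lwedge_Cons intro!: linear_compose_add linear_lwedge_left linear_lwedge_right)
  next
    case (Cons u us)
    then show ?case
      by (auto simp: lwedge_Cons alternating_contract alternating_grading_sign
          intro!: linear_compose_add)
  qed
  have "lwedge f g (us @ v # v # vs) = 0" for us v vs
    using assms
  proof (induction us arbitrary: f g)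
    case Nil
    then show ?case
      by (simp add: lwedge_Cons contract_lwedge alternating_contract_twice contract_grading_sign
          grading_sign_zero lwedge_uminus_left)
  next
    case (Cons u us)
    then show ?case by (simp add: lwedge_Cons alternating_contract alternating_grading_sign)
  qed
  with lin show ?thesis by (simp add: alternating_iff multilinear_def)
qed

definition lpullback :: "('v \<Rightarrow> 'w) \<Rightarrow> ('w list \<Rightarrow> real) \<Rightarrow> 'v list \<Rightarrow> real" where
  "lpullback L f = (\<lambda>vs. f (map L vs))"

lemma contract_lpullback: "contract v (lpullback L f) = lpullback L (contract (L v) f)"
  and grading_sign_lpullback: "grading_sign (lpullback L f) = lpullback L (grading_sign f)"
  by (simp_all add: contract_def lpullback_def grading_sign_def fun_eq_iff)

lemma lpullback_lwedge: "lpullback L (lwedge f g) = lwedge (lpullback L f) (lpullback L g)"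
proof
  show "lpullback L (lwedge f g) vs = lwedge (lpullback L f) (lpullback L g) vs" for vs
  proof (induction vs arbitrary: f g)
    case (Cons v vs)
    have "lpullback L (lwedge f g) (v # vs) =
        lpullback L (lwedge (contract (L v) f) g) vs + lpullback L (lwedge (grading_sign f) (contract (L v) g)) vs"
      by (simp add: lpullback_def lwedge_Cons)
    then show ?case by (simp add: Cons lwedge_Cons contract_lpullback grading_sign_lpullback)
  qed (simp add: lpullback_def)
qed

lemma alternating_lpullback:
  assumes "alternating f" "linear L"
  shows "alternating (lpullback L f)"
proof -
  have "linear (\<lambda>v. f (map L us @ L v # map L vs))" for us vs
    using linear_compose[OF assms(2), of "\<lambda>w. f (map L us @ w # map L vs)"] assms(1)
    by (simp add: alternating_def o_def)
  with assms(1) show ?thesis by (simp add: alternating_iff multilinear_def lpullback_def)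
qed

lemma alternating_long_zero:
  fixes f :: "'v::euclidean_space list \<Rightarrow> real"
  assumes f: "alternating f" and len: "DIM('v) < length vs"
  shows "f vs = 0"
proof (cases "distinct vs")
  case True
  then have "card (set vs) = length vs" by (rule distinct_card)
  then have "dependent (set vs)" using len independent_bound[of "set vs"] by force
  then obtain v where v: "v \<in> set vs" "v \<in> span (set vs - {v})" by (auto simp: dependent_def)
  obtain us ws where vs: "vs = us @ v # ws" using v(1) by (meson split_list)
  have lin: "linear (\<lambda>w. f (us @ w # ws))" using f by (simp add: alternating_def)
  have "f (us @ w # ws) = 0" if "w \<in> set vs - {v}" for w
    using that f by (auto simp: alternating_def vs)
  then have "f (us @ v # ws) = 0" using linear_eq_0_on_span[OF lin _ v(2)] by blast
  then show ?thesis by (simp add: vs)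
qed (use f in \<open>simp add: alternating_def\<close>)

section \<open>The exterior derivative\<close>

definition partial :: "'v::euclidean_space \<Rightarrow> 'v form \<Rightarrow> 'v form" where
  "partial v \<omega> = (\<lambda>p vs. dir_deriv v (\<lambda>q. \<omega> q vs) p)"

lemma smooth_formD:
  "smooth_form \<omega> \<Longrightarrow> alternating (\<omega> p)" "smooth_form \<omega> \<Longrightarrow> smooth (\<lambda>p. \<omega> p vs)"
  by (simp_all add: smooth_form_def)

lemma smooth_form_const: "alternating c \<Longrightarrow> smooth_form (\<lambda>_. c)"
  by (simp add: smooth_form_def)

lemma smooth_form_add: "smooth_form \<omega> \<Longrightarrow> smooth_form \<eta> \<Longrightarrow> smooth_form (\<lambda>p. \<omega> p + \<eta> p)"
  by (auto simp: smooth_form_def alternating_add smooth_add)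

lemma smooth_form_scale: "smooth_form \<omega> \<Longrightarrow> smooth_form (\<lambda>p. scale r (\<omega> p))"
  by (auto simp: smooth_form_def alternating_scale smooth_cmult)

lemma smooth_form_uminus: "smooth_form \<omega> \<Longrightarrow> smooth_form (\<lambda>p. - \<omega> p)"
  using smooth_form_scale[of \<omega> "-1"] by (simp add: fun_Compl_def)

lemma smooth_form_contract: "smooth_form \<omega> \<Longrightarrow> smooth_form (\<lambda>p. contract v (\<omega> p))"
  by (simp add: smooth_form_def alternating_contract) (simp add: contract_def)

lemma smooth_form_grading_sign: "smooth_form \<omega> \<Longrightarrow> smooth_form (\<lambda>p. grading_sign (\<omega> p))"
  by (simp add: smooth_form_def alternating_grading_sign) (auto simp: grading_sign_def)

lemma smooth_form_lwedge:
  "smooth_form \<omega> \<Longrightarrow> smooth_form \<eta> \<Longrightarrow> smooth_form (\<lambda>p. lwedge (\<omega> p) (\<eta> p))"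
  by (simp add: smooth_form_def alternating_lwedge)
    (auto simp: lwedge_def mult.assoc intro!: smooth_sum smooth_mult)

lemma smooth_form_partial:
  assumes "smooth_form \<omega>"
  shows "smooth_form (partial v \<omega>)"
proof -
  note s = smooth_formD(2)[OF assms]
  have "linear (\<lambda>w. dir_deriv v (\<lambda>q. \<omega> q (us @ w # vs)) p)" for p us vs
  proof (rule linearI)
    have l: "linear (\<lambda>w. \<omega> q (us @ w # vs))" for q
      using smooth_formD(1)[OF assms] by (simp add: alternating_def)
    show "dir_deriv v (\<lambda>q. \<omega> q (us @ (a + b) # vs)) p =
        dir_deriv v (\<lambda>q. \<omega> q (us @ a # vs)) p + dir_deriv v (\<lambda>q. \<omega> q (us @ b # vs)) p" for a b
      by (simp add: linear_add[OF l] fun_cong[OF dir_deriv_add[OF s s]])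
    show "dir_deriv v (\<lambda>q. \<omega> q (us @ (r *\<^sub>R a) # vs)) p = r *\<^sub>R dir_deriv v (\<lambda>q. \<omega> q (us @ a # vs)) p" for r a
      by (simp add: linear_cmul[OF l] fun_cong[OF dir_deriv_cmult[OF s]])
  qed
  with assms show ?thesis
    by (auto simp: smooth_form_def partial_def alternating_def smooth_dir_deriv)
qed

lemma partial_add:
  assumes "smooth_form \<omega>" "smooth_form \<eta>"
  shows "partial v (\<lambda>p. \<omega> p + \<eta> p) = (\<lambda>p. partial v \<omega> p + partial v \<eta> p)"
  by (simp add: partial_def fun_eq_iff
      fun_cong[OF dir_deriv_add[OF smooth_formD(2)[OF assms(1)] smooth_formD(2)[OF assms(2)]]])

lemma partial_scale:
  assumes "smooth_form \<omega>"
  shows "partial v (\<lambda>p. scale r (\<omega> p)) = (\<lambda>p. scale r (partial v \<omega> p))"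
  by (simp add: partial_def fun_eq_iff fun_cong[OF dir_deriv_cmult[OF smooth_formD(2)[OF assms]]])

lemma partial_uminus: "smooth_form \<omega> \<Longrightarrow> partial v (\<lambda>p. - \<omega> p) = (\<lambda>p. - partial v \<omega> p)"
  using partial_scale[of \<omega> v "-1"] by (simp add: fun_Compl_def)

lemma partial_const [simp]: "partial v (\<lambda>_. c) = (\<lambda>_. 0)"
  by (simp add: partial_def fun_eq_iff)

lemma partial_contract: "partial v (\<lambda>p. contract w (\<omega> p)) = (\<lambda>p. contract w (partial v \<omega> p))"
  by (simp add: partial_def contract_def)

lemma partial_grading_sign:
  assumes "smooth_form \<omega>"
  shows "partial v (\<lambda>p. grading_sign (\<omega> p)) = (\<lambda>p. grading_sign (partial v \<omega> p))"
  by (simp add: partial_def grading_sign_def fun_eq_iff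
      fun_cong[OF dir_deriv_cmult[OF smooth_formD(2)[OF assms]]])

lemma partial_lwedge:
  assumes \<omega>: "smooth_form \<omega>" and \<eta>: "smooth_form \<eta>"
  shows "partial v (\<lambda>p. lwedge (\<omega> p) (\<eta> p)) =
    (\<lambda>p. lwedge (partial v \<omega> p) (\<eta> p) + lwedge (\<omega> p) (partial v \<eta> p))"
proof (intro ext)
  fix p vs
  show "partial v (\<lambda>p. lwedge (\<omega> p) (\<eta> p)) p vs =
      (lwedge (partial v \<omega> p) (\<eta> p) + lwedge (\<omega> p) (partial v \<eta> p)) vs"
    using \<omega> \<eta>
  proof (induction vs arbitrary: \<omega> \<eta>)
    case Nil
    then show ?case
      by (simp add: partial_def
          fun_cong[OF dir_deriv_mult[OF smooth_formD(2)[OF Nil(1)] smooth_formD(2)[OF Nil(2)]]])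
  next
    case (Cons w vs)
    note s = smooth_form_contract smooth_form_grading_sign smooth_form_lwedge
    have "partial v (\<lambda>p. lwedge (\<omega> p) (\<eta> p)) p (w # vs) =
        partial v (\<lambda>p. lwedge (contract w (\<omega> p)) (\<eta> p) +
          lwedge (grading_sign (\<omega> p)) (contract w (\<eta> p))) p vs"
      by (simp add: partial_def lwedge_Cons)
    also have "\<dots> = partial v (\<lambda>p. lwedge (contract w (\<omega> p)) (\<eta> p)) p vs +
        partial v (\<lambda>p. lwedge (grading_sign (\<omega> p)) (contract w (\<eta> p))) p vs"
      by (subst partial_add) (simp_all add: s Cons.prems)
    also have "\<dots> = (lwedge (partial v \<omega> p) (\<eta> p) + lwedge (\<omega> p) (partial v \<eta> p)) (w # vs)"
      using Cons by (simp add: s lwedge_Cons partial_contract partial_grading_sign)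
    finally show ?case .
  qed
qed

lemma ext_derivative_Nil [simp]: "ext_derivative \<omega> p [] = 0"
  by (simp add: ext_derivative_def)

lemma ext_derivative_Cons:
  "ext_derivative \<omega> p (v # vs) = partial v \<omega> p vs - ext_derivative (\<lambda>q. contract v (\<omega> q)) p vs"
  by (simp add: ext_derivative_def partial_def contract_def sum.lessThan_Suc_shift sum_negf
      del: sum.lessThan_Suc)

lemma contract_ext_derivative:
  "contract v (ext_derivative \<omega> p) = partial v \<omega> p - ext_derivative (\<lambda>q. contract v (\<omega> q)) p"
  by (simp add: contract_def[of v "ext_derivative \<omega> p"] fun_eq_iff ext_derivative_Cons)

lemma ext_derivative_add:
  assumes "smooth_form \<omega>" "smooth_form \<eta>"
  shows "ext_derivative (\<lambda>p. \<omega> p + \<eta> p) = (\<lambda>p. ext_derivative \<omega> p + ext_derivative \<eta> p)"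
  by (simp add: ext_derivative_def fun_eq_iff sum.distrib distrib_left
      fun_cong[OF dir_deriv_add[OF smooth_formD(2)[OF assms(1)] smooth_formD(2)[OF assms(2)]]])

lemma ext_derivative_scale:
  assumes "smooth_form \<omega>"
  shows "ext_derivative (\<lambda>p. scale r (\<omega> p)) = (\<lambda>p. scale r (ext_derivative \<omega> p))"
  by (simp add: ext_derivative_def fun_eq_iff sum_distrib_left mult.left_commute
      fun_cong[OF dir_deriv_cmult[OF smooth_formD(2)[OF assms]]])

lemma ext_derivative_uminus: "smooth_form \<omega> \<Longrightarrow>
    ext_derivative (\<lambda>p. - \<omega> p) = (\<lambda>p. - ext_derivative \<omega> p)"
  using ext_derivative_scale[of \<omega> "-1"] by (simp add: fun_Compl_def)

lemma ext_derivative_zero [simp]: "ext_derivative (\<lambda>p. 0) = (\<lambda>p. 0)"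
  by (simp add: ext_derivative_def fun_eq_iff)

lemma partial_ext_derivative:
  assumes "smooth_form \<omega>"
  shows "partial v (ext_derivative \<omega>) = ext_derivative (partial v \<omega>)"
proof (intro ext)
  fix p vs
  show "partial v (ext_derivative \<omega>) p vs = ext_derivative (partial v \<omega>) p vs"
    using assms
  proof (induction vs arbitrary: \<omega>)
    case Nil
    then show ?case by (simp add: partial_def)
  next
    case (Cons w vs)
    let ?\<iota> = "\<lambda>q. contract w (\<omega> q)"
    have \<iota>: "smooth_form ?\<iota>" by (intro smooth_form_contract Cons.prems)
    have s1: "smooth (\<lambda>p. partial w \<omega> p vs)"
      by (intro smooth_formD smooth_form_partial Cons.prems)
    have s2: "smooth (\<lambda>p. ext_derivative ?\<iota> p vs)"
      unfolding ext_derivative_def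
      by (intro smooth_sum smooth_cmult smooth_dir_deriv smooth_formD \<iota>)
    have "partial v (ext_derivative \<omega>) p (w # vs) =
        dir_deriv v (\<lambda>p. partial w \<omega> p vs - ext_derivative ?\<iota> p vs) p"
      by (simp add: partial_def[of v "ext_derivative \<omega>"] ext_derivative_Cons)
    also have "\<dots> = dir_deriv v (\<lambda>p. partial w \<omega> p vs) p - partial v (ext_derivative ?\<iota>) p vs"
      using fun_cong[OF dir_deriv_diff[OF s1 s2]] by (simp add: partial_def[of v "ext_derivative ?\<iota>"])
    also have "dir_deriv v (\<lambda>p. partial w \<omega> p vs) p = partial w (partial v \<omega>) p vs"
      by (simp add: partial_def fun_cong[OF dir_deriv_commute[where v = v and w = w, OF smooth_formD(2)[OF Cons.prems]]])
    finally show ?case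
      using Cons.IH[OF \<iota>] by (simp add: ext_derivative_Cons partial_contract)
  qed
qed

lemma smooth_form_ext_derivative:
  assumes "smooth_form \<omega>"
  shows "smooth_form (ext_derivative \<omega>)"
proof -
  have lin: "linear (\<lambda>v. ext_derivative \<omega> p (us @ v # vs))" for p us vs
    using assms
  proof (induction us arbitrary: \<omega>)
    case Nil
    have l: "linear (\<lambda>v. \<omega> q (v # vs))" for q vs
      using smooth_formD(1)[OF Nil, of q, unfolded alternating_def, THEN conjunct1, rule_format, of "[]" vs]
      by simp
    have c: "contract (a + b) (\<omega> q) = contract a (\<omega> q) + contract b (\<omega> q)"
      "contract (r *\<^sub>R a) (\<omega> q) = scale r (contract a (\<omega> q))" for a b r q
      by (simp_all add: contract_def fun_eq_iff linear_add[OF l] linear_cmul[OF l])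
    have "linear (\<lambda>v. ext_derivative (\<lambda>q. contract v (\<omega> q)) p vs)"
      using ext_derivative_add[OF smooth_form_contract[OF Nil] smooth_form_contract[OF Nil]]
        ext_derivative_scale[OF smooth_form_contract[OF Nil]]
      by (intro linearI) (simp_all add: c)
    moreover have "linear (\<lambda>v. partial v \<omega> p vs)"
      using linear_dir_deriv[OF smooth_formD(2)[OF Nil]] by (simp add: partial_def)
    ultimately show ?case by (simp add: ext_derivative_Cons linear_compose_sub)
  next
    case (Cons u us)
    have "linear (\<lambda>v. partial u \<omega> p (us @ v # vs))"
      using smooth_formD(1)[OF smooth_form_partial[OF Cons.prems]] by (simp add: alternating_def)
    with Cons.IH[OF smooth_form_contract[OF Cons.prems]] show ?case
      by (simp add: ext_derivative_Cons linear_compose_sub)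
  qed
  have "ext_derivative \<omega> p (us @ v # v # vs) = 0" for p us v vs
    using assms
  proof (induction us arbitrary: \<omega>)
    case Nil
    have "ext_derivative (\<lambda>q. contract v (contract v (\<omega> q))) p vs = 0"
      using alternating_contract_twice[OF smooth_formD(1)[OF Nil]] by simp
    then show ?case by (simp add: ext_derivative_Cons partial_contract) (simp add: contract_def)
  next
    case (Cons u us)
    then show ?case
      using alternating_adjacent[OF smooth_formD(1)[OF smooth_form_partial[OF Cons.prems]]]
        smooth_form_contract[OF Cons.prems] by (simp add: ext_derivative_Cons)
  qed
  moreover have "smooth (\<lambda>p. ext_derivative \<omega> p vs)" for vs
    unfolding ext_derivative_def
    by (intro smooth_sum smooth_cmult smooth_dir_deriv smooth_formD assms)
  ultimately show ?thesis
    using lin by (simp add: smooth_form_def alternating_iff multilinear_def)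
qed

lemma ext_derivative_ext_derivative:
  assumes "smooth_form \<omega>"
  shows "ext_derivative (ext_derivative \<omega>) = (\<lambda>p. 0)"
proof (intro ext)
  fix p vs
  show "ext_derivative (ext_derivative \<omega>) p vs = 0 vs"
    using assms
  proof (induction vs arbitrary: \<omega>)
    case (Cons v vs)
    let ?\<iota> = "\<lambda>q. contract v (\<omega> q)"
    have \<iota>: "smooth_form ?\<iota>" by (intro smooth_form_contract Cons.prems)
    have "ext_derivative (\<lambda>q. contract v (ext_derivative \<omega> q)) =
        ext_derivative (\<lambda>q. partial v \<omega> q + (- ext_derivative ?\<iota> q))"
      by (simp add: contract_ext_derivative)
    also have "\<dots> = (\<lambda>q. ext_derivative (partial v \<omega>) q - ext_derivative (ext_derivative ?\<iota>) q)"
      using Cons.prems \<iota> by (subst ext_derivative_add)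
        (simp_all add: smooth_form_partial smooth_form_uminus smooth_form_ext_derivative ext_derivative_uminus)
    finally show ?case
      using Cons.IH[OF \<iota>] partial_ext_derivative[OF Cons.prems] by (simp add: ext_derivative_Cons)
  qed simp
qed

lemma ext_derivative_lwedge:
  assumes "smooth_form \<omega>" "smooth_form \<eta>"
  shows "ext_derivative (\<lambda>p. lwedge (\<omega> p) (\<eta> p)) =
    (\<lambda>p. lwedge (ext_derivative \<omega> p) (\<eta> p) + lwedge (grading_sign (\<omega> p)) (ext_derivative \<eta> p))"
proof (intro ext)
  fix p vs
  note s = smooth_form_contract smooth_form_grading_sign smooth_form_lwedge
  have sgn: "ext_derivative (\<lambda>q. grading_sign (\<omega> q)) p vs = - grading_sign (ext_derivative \<omega> p) vs"
    if "smooth_form \<omega>" for \<omega> :: "'a form" and vs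
    using that
  proof (induction vs arbitrary: \<omega>)
    case (Cons v vs)
    have "ext_derivative (\<lambda>q. grading_sign (\<omega> q)) p (v # vs) = partial v (\<lambda>q. grading_sign (\<omega> q)) p vs -
        ext_derivative (\<lambda>q. - grading_sign (contract v (\<omega> q))) p vs"
      by (simp add: ext_derivative_Cons contract_grading_sign)
    also have "\<dots> = grading_sign (partial v \<omega> p) vs + ext_derivative (\<lambda>q. grading_sign (contract v (\<omega> q))) p vs"
      using Cons.prems by (simp add: partial_grading_sign ext_derivative_uminus s)
    also have "\<dots> = - grading_sign (ext_derivative \<omega> p) (v # vs)"
      using Cons by (simp add: s) (simp add: grading_sign_def ext_derivative_Cons algebra_simps)
    finally show ?case .
  qed (simp add: grading_sign_def)
  then have sgn': "ext_derivative (\<lambda>q. grading_sign (\<omega> q)) p = - grading_sign (ext_derivative \<omega> p)"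
    if "smooth_form \<omega>" for \<omega> :: "'a form" using that by (simp add: fun_eq_iff)
  show "ext_derivative (\<lambda>p. lwedge (\<omega> p) (\<eta> p)) p vs =
      (lwedge (ext_derivative \<omega> p) (\<eta> p) + lwedge (grading_sign (\<omega> p)) (ext_derivative \<eta> p)) vs"
    using assms
  proof (induction vs arbitrary: \<omega> \<eta>)
    case (Cons v vs)
    let ?\<omega> = "\<lambda>q. contract v (\<omega> q)" and ?\<eta> = "\<lambda>q. contract v (\<eta> q)" and ?s = "\<lambda>q. grading_sign (\<omega> q)"
    have sm: "smooth_form ?\<omega>" "smooth_form ?\<eta>" "smooth_form ?s" using Cons.prems s by auto
    have "ext_derivative (\<lambda>p. lwedge (\<omega> p) (\<eta> p)) p (v # vs) =
        (lwedge (partial v \<omega> p) (\<eta> p) + lwedge (\<omega> p) (partial v \<eta> p)) vs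
        - ext_derivative (\<lambda>q. lwedge (?\<omega> q) (\<eta> q) + lwedge (?s q) (?\<eta> q)) p vs"
      using Cons.prems by (simp add: ext_derivative_Cons partial_lwedge contract_lwedge)
    also have "ext_derivative (\<lambda>q. lwedge (?\<omega> q) (\<eta> q) + lwedge (?s q) (?\<eta> q)) p vs =
        (lwedge (ext_derivative ?\<omega> p) (\<eta> p) + lwedge (grading_sign (?\<omega> p)) (ext_derivative \<eta> p)) vs
        + (lwedge (ext_derivative ?s p) (?\<eta> p) + lwedge (\<omega> p) (ext_derivative ?\<eta> p)) vs"
      unfolding ext_derivative_add[OF s(3)[OF sm(1) Cons.prems(2)] s(3)[OF sm(3) sm(2)]] plus_fun_apply
        Cons.IH[OF sm(1) Cons.prems(2)] Cons.IH[OF sm(3) sm(2)] by simp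
    also have "ext_derivative ?s p = - grading_sign (ext_derivative \<omega> p)" by (rule sgn'[OF Cons.prems(1)])
    finally show ?case
      by (simp add: lwedge_Cons contract_ext_derivative contract_grading_sign lwedge_uminus_left
          lwedge_diff_left lwedge_diff_right lwedge_uminus_left[unfolded fun_Compl_def])
  qed (simp add: grading_sign_def)
qed

lemma dir_deriv_affine:
  fixes L :: "'v::euclidean_space \<Rightarrow> 'v"
  shows "linear L \<Longrightarrow> frechet_derivative (\<lambda>p. a + L p) (at p) = L"
  by (rule frechet_derivative_at[symmetric])
    (auto intro!: derivative_eq_intros linear_imp_has_derivative)

lemma pullback_affine:
  fixes L :: "'v::euclidean_space \<Rightarrow> 'v"
  shows "linear L \<Longrightarrow> pullback (\<lambda>p. a + L p) \<omega> = (\<lambda>p. lpullback L (\<omega> (a + L p)))"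
  by (simp add: pullback_def lpullback_def dir_deriv_affine)

lemma smooth_form_pullback:
  assumes "linear L" "smooth_form \<omega>"
  shows "smooth_form (\<lambda>p. lpullback L (\<omega> (a + L p)))"
  using alternating_lpullback[OF smooth_formD(1)[OF assms(2)] assms(1)]
    smooth_comp_affine[OF smooth_formD(2)[OF assms(2)] assms(1)]
  by (simp add: smooth_form_def) (simp add: lpullback_def)

lemma ext_derivative_pullback:
  assumes "linear L" "smooth_form \<omega>"
  shows "ext_derivative (\<lambda>p. lpullback L (\<omega> (a + L p))) = (\<lambda>p. lpullback L (ext_derivative \<omega> (a + L p)))"
  using fun_cong[OF dir_deriv_comp_affine(1)[OF smooth_formD(2)[OF assms(2)] assms(1)]]
  by (simp add: ext_derivative_def lpullback_def fun_eq_iff take_map drop_map)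

definition is_affine :: "('v::real_vector \<Rightarrow> 'v) \<Rightarrow> bool" where
  "is_affine \<phi> \<longleftrightarrow> (\<exists>a L. linear L \<and> \<phi> = (\<lambda>p. a + L p))"

lemma pullback_laws:
  assumes "is_affine \<phi>"
  shows "pullback \<phi> (\<lambda>p. lwedge (\<omega> p) (\<eta> p)) = (\<lambda>p. lwedge (pullback \<phi> \<omega> p) (pullback \<phi> \<eta> p))"
    and "smooth_form \<omega> \<Longrightarrow> smooth_form (pullback \<phi> \<omega>)"
    and "smooth_form \<omega> \<Longrightarrow> pullback \<phi> (ext_derivative \<omega>) = ext_derivative (pullback \<phi> \<omega>)"
  using assms by (auto simp: is_affine_def pullback_affine lpullback_lwedge ext_derivative_pullback
      smooth_form_pullback)

lemma pullback_linear_laws: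
  "pullback \<phi> (\<lambda>p. \<omega> p + \<eta> p) = (\<lambda>p. pullback \<phi> \<omega> p + pullback \<phi> \<eta> p)"
  "pullback \<phi> (\<omega> + \<eta>) = pullback \<phi> \<omega> + pullback \<phi> \<eta>"
  "pullback \<phi> (- \<omega>) = - pullback \<phi> \<omega>"
  "pullback \<phi> (\<lambda>p vs. r * \<omega> p vs) = (\<lambda>p vs. r * pullback \<phi> \<omega> p vs)"
  by (simp_all add: pullback_def fun_eq_iff)

section \<open>The algebra of invariant forms\<close>

lemma wedge_fun: "\<omega> \<and>\<^sub>w \<eta> = (\<lambda>p. lwedge (\<omega> p) (\<eta> p))"
  by (simp add: fun_eq_iff wedge_eq_lwedge)

lemma wedge_assoc: "(\<omega> \<and>\<^sub>w \<eta>) \<and>\<^sub>w \<theta> = \<omega> \<and>\<^sub>w (\<eta> \<and>\<^sub>w \<theta>)"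
  by (simp add: wedge_fun lwedge_assoc)

lemma wedge_add_left: "(\<omega> + \<eta>) \<and>\<^sub>w \<theta> = \<omega> \<and>\<^sub>w \<theta> + \<eta> \<and>\<^sub>w \<theta>"
  and wedge_add_right: "\<theta> \<and>\<^sub>w (\<omega> + \<eta>) = \<theta> \<and>\<^sub>w \<omega> + \<theta> \<and>\<^sub>w \<eta>"
  and wedge_uminus_left: "(- \<omega>) \<and>\<^sub>w \<theta> = - (\<omega> \<and>\<^sub>w \<theta>)"
  and wedge_uminus_right: "\<theta> \<and>\<^sub>w (- \<omega>) = - (\<theta> \<and>\<^sub>w \<omega>)"
  by (simp_all add: wedge_fun fun_eq_iff lwedge_add_left[unfolded plus_fun_def, THEN fun_cong]
      lwedge_add_right[unfolded plus_fun_def, THEN fun_cong] lwedge_uminus_left[unfolded fun_Compl_def, THEN fun_cong]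
      lwedge_uminus_right[unfolded fun_Compl_def, THEN fun_cong] lwedge_add_left lwedge_add_right
      lwedge_uminus_left lwedge_uminus_right)

lemma wedge_unit: "(\<lambda>p. unit_form) \<and>\<^sub>w \<omega> = \<omega>" "\<omega> \<and>\<^sub>w (\<lambda>p. unit_form) = \<omega>"
  by (simp_all add: wedge_fun)

lemma smooth_form_closed:
  "smooth_form 0" "smooth_form \<omega> \<Longrightarrow> smooth_form \<eta> \<Longrightarrow> smooth_form (\<omega> + \<eta>)"
  "smooth_form \<omega> \<Longrightarrow> smooth_form (- \<omega>)"
  "smooth_form \<omega> \<Longrightarrow> smooth_form (\<lambda>p vs. r * \<omega> p vs)"
  "smooth_form \<omega> \<Longrightarrow> smooth_form \<eta> \<Longrightarrow> smooth_form (\<omega> \<and>\<^sub>w \<eta>)"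
  "smooth_form (\<lambda>p. unit_form)"
  using smooth_form_const[OF alternating_zero] smooth_form_add[of \<omega> \<eta>] smooth_form_uminus[of \<omega>]
    smooth_form_lwedge[of \<omega> \<eta>]
  by (simp_all add: smooth_form_const smooth_form_scale wedge_fun plus_fun_def fun_Compl_def zero_fun_def)

definition degree_part :: "nat \<Rightarrow> 'v form \<Rightarrow> 'v form" where
  "degree_part k \<omega> = (\<lambda>p vs. if length vs = k then \<omega> p vs else 0)"

lemma smooth_form_degree_part:
  assumes "smooth_form \<omega>"
  shows "smooth_form (degree_part k \<omega>)"
proof -
  have "linear (\<lambda>v. if b then \<omega> p (us @ v # vs) else 0)" for b p us vs
    using smooth_formD(1)[OF assms] by (cases b) (simp_all add: alternating_def linear_zero)
  moreover have "smooth (\<lambda>p. if b then \<omega> p vs else 0)" for b vs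
    using smooth_formD(2)[OF assms] by (cases b) auto
  ultimately show ?thesis
    using smooth_formD(1)[OF assms] by (auto simp: smooth_form_def degree_part_def alternating_def)
qed

locale affine_invariance =
  fixes \<Phi> :: "('v::euclidean_space \<Rightarrow> 'v) set"
  assumes affine: "\<phi> \<in> \<Phi> \<Longrightarrow> is_affine \<phi>"
begin

abbreviation "F \<equiv> invariant_forms \<Phi>"

lemma F_simps [simp]:
  "carrier F = {\<omega>. smooth_form \<omega> \<and> (\<forall>\<phi>\<in>\<Phi>. pullback \<phi> \<omega> = \<omega>)}"
  "mult F = wedge" "one F = (\<lambda>p. unit_form)" "zero F = 0" "add F = (+)"
  "smult F r \<omega> = (\<lambda>p vs. r * \<omega> p vs)"
  "hcomp F k = {\<omega> \<in> carrier F. \<forall>p. of_degree k (\<omega> p)}"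
  "differential F = ext_derivative"
  by (auto simp: invariant_forms_def Let_def of_degree_def unit_form_def[abs_def])

lemma invariant_wedge:
  assumes "\<forall>\<phi>\<in>\<Phi>. pullback \<phi> \<omega> = \<omega>" "\<forall>\<phi>\<in>\<Phi>. pullback \<phi> \<eta> = \<eta>"
  shows "\<forall>\<phi>\<in>\<Phi>. pullback \<phi> (\<omega> \<and>\<^sub>w \<eta>) = \<omega> \<and>\<^sub>w \<eta>"
  using assms pullback_laws(1)[OF affine] by (simp add: wedge_fun)

lemma pullback_unit: "pullback \<phi> (\<lambda>p. unit_form) = (\<lambda>p. unit_form)"
  by (simp add: pullback_def unit_form_def fun_eq_iff)

lemma pullback_zero: "pullback \<phi> 0 = 0"
  by (simp add: pullback_def fun_eq_iff)

lemma ring_F: "ring F"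
proof (intro ringI abelian_groupI monoidI)
  show "\<exists>\<eta>\<in>carrier F. \<eta> \<oplus>\<^bsub>F\<^esub> \<omega> = \<zero>\<^bsub>F\<^esub>" if "\<omega> \<in> carrier F" for \<omega>
    using that by (intro bexI[of _ "- \<omega>"]) (auto simp: smooth_form_closed pullback_linear_laws)
qed (auto simp: smooth_form_closed pullback_linear_laws invariant_wedge pullback_unit pullback_zero
    wedge_unit wedge_assoc wedge_add_left wedge_add_right algebra_simps)

lemma finsum_F:
  assumes "finite I" "\<And>i. i \<in> I \<Longrightarrow> g i \<in> carrier F"
  shows "(\<Oplus>\<^bsub>F\<^esub>i\<in>I. g i) = (\<lambda>p vs. \<Sum>i\<in>I. g i p vs)"
proof -
  interpret ring F by (rule ring_F)
  show ?thesis using assms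
  proof (induction I rule: finite_induct)
    case (insert i I)
    then have "g \<in> I \<rightarrow> carrier F" "g i \<in> carrier F" by auto
    with insert show ?case by (subst finsum_insert) (auto simp: fun_eq_iff simp del: F_simps(1))
  qed (simp add: fun_eq_iff)
qed

theorem dg_algebra_F: "dg_algebra F"
proof (intro dg_algebra.intro dg_algebra_axioms.intro ring_F)
  show "\<exists>!f. (\<forall>k. f k \<in> hcomp F k) \<and> finite {k. f k \<noteq> \<zero>\<^bsub>F\<^esub>} \<and> \<omega> = (\<Oplus>\<^bsub>F\<^esub>k\<in>{k. f k \<noteq> \<zero>\<^bsub>F\<^esub>}. f k)"
    if "\<omega> \<in> carrier F" for \<omega>
  proof (rule direct_sum_of_projections[where \<pi> = degree_part, OF _ _ _ _ _ _ _ that])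
    show "abelian_monoid F" using ring_F by (simp add: ring_def abelian_group_def)
    have inv: "degree_part k \<omega> \<in> carrier F" if "\<omega> \<in> carrier F" for k \<omega>
    proof -
      have "pullback \<phi> (degree_part k \<omega>) = degree_part k (pullback \<phi> \<omega>)" for \<phi>
        by (simp add: pullback_def degree_part_def fun_eq_iff)
      with that show ?thesis by (simp add: smooth_form_degree_part)
    qed
    then show "degree_part k \<omega> \<in> hcomp F k" if "\<omega> \<in> carrier F" for k \<omega>
      using that by (auto simp: of_degree_def degree_part_def simp del: F_simps(1))
    show "\<exists>I. finite I \<and> (\<forall>k. k \<notin> I \<longrightarrow> degree_part k \<omega> = \<zero>\<^bsub>F\<^esub>) \<and> \<omega> = (\<Oplus>\<^bsub>F\<^esub>k\<in>I. degree_part k \<omega>)"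
    proof (intro exI[of _ "{..DIM('v)}"] conjI allI impI)
      have z: "\<omega> p vs = 0" if "DIM('v) < length vs" for p vs
        using alternating_long_zero[OF _ that] \<open>\<omega> \<in> carrier F\<close> smooth_formD(1) by auto
      then show "degree_part k \<omega> = \<zero>\<^bsub>F\<^esub>" if "k \<notin> {..DIM('v)}" for k
        using that by (auto simp: degree_part_def fun_eq_iff)
      have "\<omega> p vs = (\<Sum>k\<le>DIM('v). degree_part k \<omega> p vs)" for p vs
        using z[of vs p] by (cases "length vs \<le> DIM('v)") (auto simp: degree_part_def)
      then show "\<omega> = (\<Oplus>\<^bsub>F\<^esub>k\<in>{..DIM('v)}. degree_part k \<omega>)"
        using inv[OF that] by (subst finsum_F) (auto simp: fun_eq_iff simp del: F_simps(1))
    qed simp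
  qed (auto simp: smooth_form_closed pullback_zero of_degree_def degree_part_def fun_eq_iff)
  show "differential F (\<omega> \<otimes>\<^bsub>F\<^esub> \<eta>) = differential F \<omega> \<otimes>\<^bsub>F\<^esub> \<eta> \<oplus>\<^bsub>F\<^esub> (- 1) ^ i \<odot>\<^bsub>F\<^esub> (\<omega> \<otimes>\<^bsub>F\<^esub> differential F \<eta>)"
    if "\<omega> \<in> hcomp F i" "\<eta> \<in> carrier F" for \<omega> \<eta> i
  proof -
    have "grading_sign (\<omega> p) = scale ((- 1) ^ i) (\<omega> p)" for p
      by (rule grading_sign_of_degree) (use that in auto)
    with that show ?thesis
      by (simp add: wedge_fun ext_derivative_lwedge lwedge_scale_left) (simp add: plus_fun_def)
  qed
  show "\<omega> \<otimes>\<^bsub>F\<^esub> \<eta> = (- 1) ^ (i * j) \<odot>\<^bsub>F\<^esub> (\<eta> \<otimes>\<^bsub>F\<^esub> \<omega>)" if "\<omega> \<in> hcomp F i" "\<eta> \<in> hcomp F j" for \<omega> \<eta> i j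
  proof -
    have "lwedge (\<omega> p) (\<eta> p) = scale ((- 1) ^ (i * j)) (lwedge (\<eta> p) (\<omega> p))" for p
      by (rule lwedge_commute) (use that in auto)
    then show ?thesis by (simp add: wedge_fun)
  qed
  have "of_degree (Suc k) (ext_derivative \<omega> p)" if "\<forall>p. of_degree k (\<omega> p)" for \<omega> :: "'v form" and k p
  proof -
    have "(\<lambda>q. \<omega> q (take i vs @ drop (Suc i) vs)) = (\<lambda>_. 0)" if "length vs \<noteq> Suc k" "i < length vs" for i vs
      using \<open>\<forall>p. of_degree k (\<omega> p)\<close> that by (auto simp: of_degree_def fun_eq_iff)
    then show ?thesis by (auto simp: of_degree_def ext_derivative_def intro!: sum.neutral)
  qed
  moreover have "ext_derivative \<omega> \<in> carrier F" if "\<omega> \<in> carrier F" for \<omega>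
  proof -
    have "pullback \<phi> (ext_derivative \<omega>) = ext_derivative \<omega>" if "\<phi> \<in> \<Phi>" for \<phi>
      using pullback_laws(3)[OF affine[OF that], of \<omega>] \<open>\<omega> \<in> carrier F\<close> that by simp
    with that show ?thesis by (simp add: smooth_form_ext_derivative)
  qed
  ultimately show "differential F \<omega> \<in> hcomp F (Suc k)" if "\<omega> \<in> hcomp F k" for \<omega> k
    using that by auto
  show "differential F (\<omega> \<oplus>\<^bsub>F\<^esub> \<eta>) = differential F \<omega> \<oplus>\<^bsub>F\<^esub> differential F \<eta>"
    if "\<omega> \<in> carrier F" "\<eta> \<in> carrier F" for \<omega> \<eta>
    using that ext_derivative_add[of \<omega> \<eta>] by (simp add: plus_fun_def)
  show "\<omega> \<otimes>\<^bsub>F\<^esub> \<eta> \<in> hcomp F (i + j)" if "\<omega> \<in> hcomp F i" "\<eta> \<in> hcomp F j" for \<omega> \<eta> i j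
    using that by (auto simp: smooth_form_closed invariant_wedge wedge_eq_lwedge of_degree_lwedge)
qed (auto simp: smooth_form_closed pullback_linear_laws pullback_zero pullback_unit wedge_fun
    lwedge_scale_left lwedge_scale_right ext_derivative_scale ext_derivative_ext_derivative
    of_degree_def unit_form_def algebra_simps fun_eq_iff)

end

section \<open>The left invariant frame\<close>

definition one_form :: "('v \<Rightarrow> real) \<Rightarrow> 'v list \<Rightarrow> real" where
  "one_form \<beta> = (\<lambda>vs. case vs of [v] \<Rightarrow> \<beta> v | _ \<Rightarrow> 0)"

lemma contract_one_form [simp]: "contract v (one_form \<beta>) = scale (\<beta> v) unit_form"
  by (auto simp: contract_def one_form_def unit_form_def fun_eq_iff split: list.splits)

lemma of_degree_one_form: "of_degree 1 (one_form \<beta>)"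
  by (auto simp: of_degree_def one_form_def split: list.splits)

lemma grading_sign_one_form [simp]: "grading_sign (one_form \<beta>) = - one_form \<beta>"
  using grading_sign_of_degree[OF of_degree_one_form] by (simp add: fun_eq_iff)

lemma one_form_Nil [simp]: "one_form \<beta> [] = 0"
  by (simp add: one_form_def)

lemma lpullback_one_form: "lpullback L (one_form \<beta>) = one_form (\<lambda>v. \<beta> (L v))"
  by (auto simp: lpullback_def one_form_def fun_eq_iff split: list.splits)

lemma contract_one_form_lwedge:
  "contract v (lwedge (one_form \<beta>) f) = scale (\<beta> v) f - lwedge (one_form \<beta>) (contract v f)"
  by (simp add: contract_lwedge lwedge_scale_left lwedge_uminus_left)

lemma one_form_lwedge_Cons:
  "lwedge (one_form \<beta>) f (v # vs) = \<beta> v * f vs - lwedge (one_form \<beta>) (contract v f) vs"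
  using fun_cong[OF contract_one_form_lwedge[of v \<beta> f], of vs] by (simp add: contract_def[of v "lwedge _ _"])

lemma alternating_one_form:
  assumes "linear \<beta>"
  shows "alternating (one_form \<beta>)"
proof -
  have "one_form \<beta> (us @ v # vs) = (if us = [] \<and> vs = [] then \<beta> v else 0)" for us v vs
    by (auto simp: one_form_def split: list.splits simp: append_eq_Cons_conv Cons_eq_append_conv)
  moreover have "linear (\<lambda>v. if b then \<beta> v else 0)" for b
    using assms by (cases b) (simp_all add: linear_zero)
  ultimately show ?thesis by (simp add: alternating_iff multilinear_def)
qed

lemma smooth_form_fscale:
  assumes "smooth s" "smooth_form \<omega>"
  shows "smooth_form (\<lambda>p. scale (s p) (\<omega> p))"
  using assms by (auto simp: smooth_form_def alternating_scale smooth_mult)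

lemma partial_fscale:
  assumes "smooth s" "smooth_form \<omega>"
  shows "partial v (\<lambda>p. scale (s p) (\<omega> p)) p = scale (s p) (partial v \<omega> p) + scale (dir_deriv v s p) (\<omega> p)"
  by (simp add: partial_def fun_eq_iff fun_cong[OF dir_deriv_mult[OF assms(1) smooth_formD(2)[OF assms(2)]]])

lemma ext_derivative_fscale:
  assumes "smooth s" "smooth_form \<omega>"
  shows "ext_derivative (\<lambda>p. scale (s p) (\<omega> p)) p =
    lwedge (one_form (\<lambda>v. dir_deriv v s p)) (\<omega> p) + scale (s p) (ext_derivative \<omega> p)"
proof
  show "ext_derivative (\<lambda>p. scale (s p) (\<omega> p)) p vs =
    (lwedge (one_form (\<lambda>v. dir_deriv v s p)) (\<omega> p) + scale (s p) (ext_derivative \<omega> p)) vs" for vs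
    using assms(2)
  proof (induction vs arbitrary: \<omega>)
    case (Cons v vs)
    then show ?case
      using Cons.IH[OF smooth_form_contract[OF Cons.prems, of v]]
      by (simp add: ext_derivative_Cons partial_fscale[OF assms(1) Cons.prems] one_form_lwedge_Cons
          contract_scale algebra_simps)
  qed simp
qed

type_synonym pt = "real ^ coord"

text \<open>The commutators of the group span the two directions of the coordinates \<open>v\<^sub>1, v\<^sub>2\<close>; the
  bilinear functions \<open>sig\<close> are the nonlinear terms of the group law in these coordinates.\<close>

definition sig :: "coord \<Rightarrow> pt \<Rightarrow> pt \<Rightarrow> real" where
  "sig k p v = (case k of
      V1 \<Rightarrow> (p $ Y1 - p $ Y2) * v $ Z1 - (p $ Y1 + 2 * p $ Y2) * v $ Z2
    | V2 \<Rightarrow> (p $ Y2 - p $ Y1) * v $ Z2 - (2 * p $ Y1 + p $ Y2) * v $ Z1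
    | _ \<Rightarrow> 0)"

abbreviation vdir :: "coord \<Rightarrow> pt" where
  "vdir k \<equiv> axis k 1"

definition frame :: "pt \<Rightarrow> pt \<Rightarrow> pt" where
  "frame p v = v + sig V1 p v *\<^sub>R vdir V1 + sig V2 p v *\<^sub>R vdir V2"

lemma linear_sig: "linear (sig k p)" "linear (\<lambda>p. sig k p v)"
  by (cases k; auto intro!: linearI simp: sig_def algebra_simps)+

lemma sig_vdir [simp]: "sig k p (vdir V1) = 0" "sig k p (vdir V2) = 0" "sig k (vdir V1) v = 0"
  "sig k (vdir V2) v = 0"
  by (cases k; simp add: sig_def axis_def)+

lemma sig_linear_simps [simp]: "sig k p (v + w) = sig k p v + sig k p w"
  "sig k p (r *\<^sub>R v) = r * sig k p v" "sig k (p + q) v = sig k p v + sig k q v"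
  "sig k (r *\<^sub>R p) v = r * sig k p v" "sig k (- p) v = - sig k p v" "sig k p (- v) = - sig k p v"
  using linear_add[OF linear_sig(1)] linear_cmul[OF linear_sig(1)] linear_neg[OF linear_sig(1)]
    linear_add[OF linear_sig(2)] linear_cmul[OF linear_sig(2)] linear_neg[OF linear_sig(2)] by auto

lemma sig_frame [simp]: "sig k (frame p v) w = sig k v w" "sig k w (frame p v) = sig k w v"
  by (simp_all add: frame_def)

lemma frame_frame: "frame p (frame q v) = frame (p + q) v"
  by (simp add: frame_def algebra_simps)

lemma frame_neg [simp]: "frame p (frame (- p) v) = v" "frame (- p) (frame p v) = v"
proof -
  have "frame 0 v = v" using linear_0[OF linear_sig(2)] by (simp add: frame_def)
  then show "frame p (frame (- p) v) = v" "frame (- p) (frame p v) = v"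
    by (simp_all add: frame_frame)
qed

lemma frame_vdir [simp]: "frame p (vdir V1) = vdir V1" "frame p (vdir V2) = vdir V2"
  by (simp_all add: frame_def)

lemma linear_frame: "linear (frame p)"
  by (rule linearI) (simp_all add: frame_def algebra_simps)

lemma group_mult_eq_frame: "group_mult g p = g + frame g p"
proof -
  have "group_mult g p $ c = (g + frame g p) $ c" for c
    by (cases c) (simp_all add: group_mult_def frame_def sig_def axis_def)
  then show ?thesis by (simp add: vec_eq_iff)
qed

text \<open>The coefficients of a form with respect to the left invariant frame.\<close>

definition hat :: "pt form \<Rightarrow> pt form" where
  "hat \<omega> = (\<lambda>p. lpullback (frame p) (\<omega> p))"

definition unhat :: "pt form \<Rightarrow> pt form" where
  "unhat f = (\<lambda>p. lpullback (frame (- p)) (f p))"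

lemma hat_unhat [simp]: "hat (unhat f) = f" "unhat (hat \<omega>) = \<omega>"
  by (simp_all add: hat_def unhat_def lpullback_def fun_eq_iff o_def)

lemma contract_hat: "contract v (hat \<omega> p) = hat (\<lambda>q. contract (frame q v) (\<omega> q)) p"
  by (simp add: hat_def contract_lpullback)

lemma contract_frame:
  assumes "alternating f"
  shows "contract (frame p v) f =
    contract v f + scale (sig V1 p v) (contract (vdir V1) f) + scale (sig V2 p v) (contract (vdir V2) f)"
proof
  fix vs
  have l: "linear (\<lambda>v. f (v # vs))"
    using assms[unfolded alternating_def, THEN conjunct1, rule_format, of "[]" vs] by simp
  show "contract (frame p v) f vs = (contract v f + scale (sig V1 p v) (contract (vdir V1) f) +
      scale (sig V2 p v) (contract (vdir V2) f)) vs"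
    by (simp add: contract_def frame_def linear_add[OF l] linear_cmul[OF l])
qed

lemma smooth_form_contract_frame:
  assumes "smooth_form \<omega>"
  shows "smooth_form (\<lambda>q. contract (frame q v) (\<omega> q))"
proof -
  have "smooth_form (\<lambda>q. contract v (\<omega> q) + scale (sig V1 q v) (contract (vdir V1) (\<omega> q)) +
      scale (sig V2 q v) (contract (vdir V2) (\<omega> q)))"
    by (intro smooth_form_add smooth_form_fscale smooth_form_contract assms smooth_linear linear_sig)
  then show ?thesis by (simp add: contract_frame[OF smooth_formD(1)[OF assms]])
qed

lemma smooth_form_hat:
  assumes "smooth_form \<omega>"
  shows "smooth_form (hat \<omega>)"
proof -
  have "smooth (\<lambda>p. hat \<omega> p vs)" for vs
    using assms
  proof (induction vs arbitrary: \<omega>)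
    case Nil
    then show ?case using smooth_formD(2)[OF Nil, of "[]"] by (simp add: hat_def lpullback_def)
  next
    case (Cons v vs)
    have "hat \<omega> p (v # vs) = hat (\<lambda>q. contract (frame q v) (\<omega> q)) p vs" for p
      using fun_cong[OF contract_hat[of v \<omega> p], of vs] by (simp add: contract_def[of v "hat \<omega> p"])
    with Cons.IH[OF smooth_form_contract_frame[OF Cons.prems]] show ?case by simp
  qed
  moreover have "alternating (hat \<omega> p)" for p
    unfolding hat_def by (rule alternating_lpullback[OF smooth_formD(1)[OF assms] linear_frame])
  ultimately show ?thesis by (simp add: smooth_form_def)
qed

lemma unhat_eq_hat: "unhat f p = hat (\<lambda>q. f (- q)) (- p)"
  by (simp add: hat_def unhat_def)

lemma smooth_form_reflect:
  assumes "smooth_form \<omega>"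
  shows "smooth_form (\<lambda>q :: pt. \<omega> (- q))"
proof -
  have "linear (uminus :: pt \<Rightarrow> pt)" by (rule linearI) simp_all
  from smooth_comp_affine[where a = 0, OF smooth_formD(2)[OF assms] this] smooth_formD(1)[OF assms]
  show ?thesis by (simp add: smooth_form_def)
qed

lemma smooth_form_unhat: "smooth_form f \<Longrightarrow> smooth_form (unhat f)"
  using smooth_form_reflect[OF smooth_form_hat[OF smooth_form_reflect]]
  by (simp add: unhat_eq_hat[abs_def])

text \<open>Substitution of the vertical vector \<open>\<beta> V1 w * e\<^sub>v\<^sub>1 + \<beta> V2 w * e\<^sub>v\<^sub>2\<close> for each argument \<open>w\<close> in turn.\<close>

definition vert :: "(coord \<Rightarrow> pt \<Rightarrow> real) \<Rightarrow> (pt list \<Rightarrow> real) \<Rightarrow> pt list \<Rightarrow> real" where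
  "vert \<beta> f = lwedge (one_form (\<beta> V1)) (contract (vdir V1) f) + lwedge (one_form (\<beta> V2)) (contract (vdir V2) f)"

lemma contract_vert:
  assumes "alternating f"
  shows "contract w (vert \<beta> f) = scale (\<beta> V1 w) (contract (vdir V1) f) +
    scale (\<beta> V2 w) (contract (vdir V2) f) + vert \<beta> (contract w f)"
  using alternating_contract_contract[OF assms, of w]
  by (simp add: vert_def contract_add contract_one_form_lwedge lwedge_uminus_right algebra_simps)

lemma vert_Nil [simp]: "vert \<beta> f [] = 0"
  by (simp add: vert_def)

lemma lpullback_vert:
  assumes "\<And>k w. \<beta> k (frame p w) = \<beta> k w"
  shows "lpullback (frame p) (vert \<beta> f) = vert \<beta> (lpullback (frame p) f)"
proof -
  have add: "lpullback L (f + g) = lpullback L f + lpullback L g" for L :: "pt \<Rightarrow> pt" and f g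
    by (simp add: lpullback_def fun_eq_iff)
  show ?thesis
    by (simp add: vert_def add lpullback_lwedge lpullback_one_form assms contract_lpullback)
qed

lemma ext_derivative_contract_frame:
  assumes "smooth_form \<omega>"
  shows "ext_derivative (\<lambda>q. contract (frame q v) (\<omega> q)) p =
    ext_derivative (\<lambda>q. contract (frame p v) (\<omega> q)) p + vert (\<lambda>k w. sig k w v) (\<omega> p)"
proof -
  let ?\<eta> = "\<lambda>k q. contract (vdir k) (\<omega> q)"
  note s = smooth_form_contract[OF assms]
  have s2: "smooth (\<lambda>q. sig k q v)" "dir_deriv w (\<lambda>q. sig k q v) p = sig k w v" for k w
    using smooth_linear[OF linear_sig(2)] by (auto simp: fun_eq_iff)
  have frz: "(\<lambda>q. contract (frame p v) (\<omega> q)) = (\<lambda>q. contract v (\<omega> q) +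
      scale (sig V1 p v) (?\<eta> V1 q) + scale (sig V2 p v) (?\<eta> V2 q))"
    and mov: "(\<lambda>q. contract (frame q v) (\<omega> q)) = (\<lambda>q. contract v (\<omega> q) +
      scale (sig V1 q v) (?\<eta> V1 q) + scale (sig V2 q v) (?\<eta> V2 q))"
    by (simp_all add: contract_frame[OF smooth_formD(1)[OF assms]])
  have "ext_derivative (\<lambda>q. contract (frame p v) (\<omega> q)) p = ext_derivative (\<lambda>q. contract v (\<omega> q)) p +
      scale (sig V1 p v) (ext_derivative (?\<eta> V1) p) + scale (sig V2 p v) (ext_derivative (?\<eta> V2) p)"
    unfolding frz by (simp add: ext_derivative_add smooth_form_add smooth_form_scale s ext_derivative_scale)
  moreover have "ext_derivative (\<lambda>q. contract (frame q v) (\<omega> q)) p = ext_derivative (\<lambda>q. contract v (\<omega> q)) p +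
      ext_derivative (\<lambda>q. scale (sig V1 q v) (?\<eta> V1 q)) p + ext_derivative (\<lambda>q. scale (sig V2 q v) (?\<eta> V2 q)) p"
    unfolding mov by (simp add: ext_derivative_add smooth_form_add smooth_form_fscale s s2(1))
  ultimately show ?thesis
    by (simp add: ext_derivative_fscale[OF s2(1) s] s2(2) vert_def algebra_simps)
qed

lemma partial_hat:
  assumes "smooth_form \<omega>"
  shows "partial u (hat \<omega>) p = lpullback (frame p) (partial u \<omega> p) + vert (\<lambda>k w. sig k u w) (hat \<omega> p)"
proof
  show "partial u (hat \<omega>) p vs =
    (lpullback (frame p) (partial u \<omega> p) + vert (\<lambda>k w. sig k u w) (hat \<omega> p)) vs" for vs
    using assms
  proof (induction vs arbitrary: \<omega>)
    case Nil
    then show ?case by (simp add: partial_def hat_def lpullback_def)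
  next
    case (Cons w vs)
    let ?\<iota> = "\<lambda>q. contract (frame q w) (\<omega> q)" and ?\<eta> = "\<lambda>k q. contract (vdir k) (\<omega> q)"
    note s = smooth_form_contract[OF Cons.prems]
    have s2: "smooth (\<lambda>q. sig k q w)" "dir_deriv u (\<lambda>q. sig k q w) p = sig k u w" for k
      using smooth_linear[OF linear_sig(2)] by (auto simp: fun_eq_iff)
    have mov: "?\<iota> = (\<lambda>q. contract w (\<omega> q) + scale (sig V1 q w) (?\<eta> V1 q) + scale (sig V2 q w) (?\<eta> V2 q))"
      by (simp add: contract_frame[OF smooth_formD(1)[OF Cons.prems]])
    have "partial u ?\<iota> p = contract w (partial u \<omega> p) +
        (scale (sig V1 p w) (contract (vdir V1) (partial u \<omega> p)) + scale (sig V1 u w) (?\<eta> V1 p)) +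
        (scale (sig V2 p w) (contract (vdir V2) (partial u \<omega> p)) + scale (sig V2 u w) (?\<eta> V2 p))"
      unfolding mov
      by (simp add: partial_add smooth_form_add smooth_form_fscale s s2 partial_fscale partial_contract)
    also have "\<dots> = contract (frame p w) (partial u \<omega> p) + scale (sig V1 u w) (?\<eta> V1 p) + scale (sig V2 u w) (?\<eta> V2 p)"
      by (simp add: contract_frame[OF smooth_formD(1)[OF smooth_form_partial[OF Cons.prems]]] algebra_simps)
    finally have P: "partial u ?\<iota> p = \<dots>" .
    have "hat \<omega> q (w # vs) = hat ?\<iota> q vs" for q
      using fun_cong[OF contract_hat[of w \<omega> q], of vs] by (simp add: contract_def[of w "hat \<omega> q"])
    then have "partial u (hat \<omega>) p (w # vs) = partial u (hat ?\<iota>) p vs"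
      by (simp add: partial_def)
    also have "\<dots> = lpullback (frame p) (partial u ?\<iota> p) vs + vert (\<lambda>k w. sig k u w) (contract w (hat \<omega> p)) vs"
      using Cons.IH[OF smooth_form_contract_frame[OF Cons.prems]] by (simp add: contract_hat)
    also have "\<dots> = contract w (lpullback (frame p) (partial u \<omega> p) + vert (\<lambda>k w. sig k u w) (hat \<omega> p)) vs"
      unfolding P contract_add contract_vert[OF smooth_formD(1)[OF smooth_form_hat[OF Cons.prems]]]
      by (simp add: contract_lpullback contract_hat) (simp add: hat_def lpullback_def)
    finally show ?case by (simp add: contract_def)
  qed
qed

definition frame_d :: "pt form \<Rightarrow> pt form" where
  "frame_d f = hat (ext_derivative (unhat f))"

definition brk :: "pt \<Rightarrow> coord \<Rightarrow> pt \<Rightarrow> real" where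
  "brk v k w = sig k v w - sig k w v"

text \<open>Cartan's formula for a left invariant vector field: the Lie derivative differentiates the
  coefficients and subtracts the brackets with the arguments.\<close>

lemma contract_frame_d:
  assumes "smooth_form f"
  shows "contract v (frame_d f p) =
    partial (frame p v) f p - vert (brk v) (f p) - frame_d (\<lambda>q. contract v (f q)) p"
proof -
  define \<omega> where "\<omega> = unhat f"
  have \<omega>: "smooth_form \<omega>" "f = hat \<omega>" using smooth_form_unhat[OF assms] by (simp_all add: \<omega>_def)
  let ?L = "lpullback (frame p)"
  have Ldiff: "?L (f - g) = ?L f - ?L g" for f g by (simp add: lpullback_def fun_eq_iff)
  have eq: "(\<lambda>q. contract v (f q)) = hat (\<lambda>q. contract (frame q v) (\<omega> q))"
    by (simp add: \<omega>(2) contract_hat)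
  have 1: "frame_d (\<lambda>q. contract v (f q)) p = ?L (ext_derivative (\<lambda>q. contract (frame q v) (\<omega> q)) p)"
    unfolding eq frame_d_def hat_unhat(2) by (simp add: hat_def)
  have "contract v (frame_d f p) = ?L (contract (frame p v) (ext_derivative \<omega> p))"
    by (simp add: frame_d_def hat_def contract_lpullback \<omega>_def)
  also have "\<dots> = ?L (partial (frame p v) \<omega> p) - (frame_d (\<lambda>q. contract v (f q)) p -
      ?L (vert (\<lambda>k w. sig k w v) (\<omega> p)))"
    unfolding contract_ext_derivative 1 Ldiff
      ext_derivative_contract_frame[OF \<omega>(1)] by (simp add: lpullback_def fun_eq_iff)
  also have "?L (partial (frame p v) \<omega> p) = partial (frame p v) f p - vert (\<lambda>k w. sig k v w) (f p)"
    using partial_hat[OF \<omega>(1), of "frame p v" p] by (simp add: \<omega>(2))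
  also have "?L (vert (\<lambda>k w. sig k w v) (\<omega> p)) = vert (\<lambda>k w. sig k w v) (f p)"
    by (subst lpullback_vert) (simp_all add: \<omega>(2) hat_def)
  also have "vert (\<lambda>k w. sig k v w) (f p) = vert (brk v) (f p) + vert (\<lambda>k w. sig k w v) (f p)"
  proof -
    have "one_form (\<lambda>w. sig k v w) = one_form (brk v k) + one_form (\<lambda>w. sig k w v)" for k
      by (auto simp: one_form_def brk_def fun_eq_iff split: list.splits)
    then show ?thesis by (simp add: vert_def lwedge_add_left algebra_simps)
  qed
  finally show ?thesis by (simp add: fun_eq_iff)
qed

lemma frame_d_Nil [simp]: "frame_d f p [] = 0"
  by (simp add: frame_d_def hat_def lpullback_def)

lemma smooth_form_frame_d: "smooth_form f \<Longrightarrow> smooth_form (frame_d f)"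
  by (simp add: frame_d_def smooth_form_hat smooth_form_ext_derivative smooth_form_unhat)

lemma frame_d_frame_d: "smooth_form f \<Longrightarrow> frame_d (frame_d f) = (\<lambda>p. 0)"
  by (simp add: frame_d_def ext_derivative_ext_derivative smooth_form_unhat)
    (simp add: hat_def lpullback_def fun_eq_iff)

lemma unhat_linear:
  "unhat (\<lambda>p. f p + g p) = (\<lambda>p. unhat f p + unhat g p)"
  "unhat (\<lambda>p. scale r (f p)) = (\<lambda>p. scale r (unhat f p))"
  "unhat (\<lambda>p. lwedge (f p) (g p)) = (\<lambda>p. lwedge (unhat f p) (unhat g p))"
  "unhat (\<lambda>p. grading_sign (f p)) = (\<lambda>p. grading_sign (unhat f p))"
  by (simp_all add: unhat_def lpullback_lwedge grading_sign_lpullback)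
    (simp_all add: lpullback_def fun_eq_iff)

lemma hat_linear:
  "hat (\<lambda>p. f p + g p) = (\<lambda>p. hat f p + hat g p)"
  "hat (\<lambda>p. scale r (f p)) = (\<lambda>p. scale r (hat f p))"
  "hat (\<lambda>p. lwedge (f p) (g p)) = (\<lambda>p. lwedge (hat f p) (hat g p))"
  by (simp_all add: hat_def lpullback_lwedge) (simp_all add: lpullback_def fun_eq_iff)

lemma frame_d_add: "smooth_form f \<Longrightarrow> smooth_form g \<Longrightarrow>
    frame_d (\<lambda>p. f p + g p) = (\<lambda>p. frame_d f p + frame_d g p)"
  by (simp add: frame_d_def unhat_linear ext_derivative_add smooth_form_unhat hat_linear)

lemma frame_d_scale: "smooth_form f \<Longrightarrow> frame_d (\<lambda>p. scale r (f p)) = (\<lambda>p. scale r (frame_d f p))"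
  by (simp add: frame_d_def unhat_linear ext_derivative_scale smooth_form_unhat hat_linear)

lemma frame_d_lwedge:
  assumes "smooth_form f" "smooth_form g"
  shows "frame_d (\<lambda>p. lwedge (f p) (g p)) =
    (\<lambda>p. lwedge (frame_d f p) (g p) + lwedge (grading_sign (f p)) (frame_d g p))"
proof -
  have gs: "grading_sign (f p) = hat (\<lambda>p. grading_sign (unhat f p)) p" for p
    by (simp flip: unhat_linear(4))
  show ?thesis
    unfolding frame_d_def unhat_linear ext_derivative_lwedge[OF smooth_form_unhat[OF assms(1)] smooth_form_unhat[OF assms(2)]]
      hat_linear gs by simp
qed

section \<open>Averaging closed forms\<close>

definition periodic_form :: "pt form \<Rightarrow> bool" where
  "periodic_form f \<longleftrightarrow> smooth_form f \<and> (\<forall>g\<in>lattice. \<forall>p. f (group_mult g p) = f p)"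

definition indep :: "coord \<Rightarrow> pt form \<Rightarrow> bool" where
  "indep c f \<longleftrightarrow> (\<forall>p r. f (p + r *\<^sub>R axis c 1) = f p)"

text \<open>Translations in a direction act on the coefficients of invariant forms if the direction is
  central or the coefficients do not depend on the central coordinates \<open>v\<^sub>1, v\<^sub>2\<close>.\<close>

definition averageable :: "coord \<Rightarrow> pt form \<Rightarrow> bool" where
  "averageable c f \<longleftrightarrow> c \<in> {X1, X2, V1, V2} \<or> indep V1 f \<and> indep V2 f"

definition form_mean :: "(real \<Rightarrow> real) \<Rightarrow> coord \<Rightarrow> pt form \<Rightarrow> pt form" where
  "form_mean w c f = (\<lambda>p vs. line_mean w 3 (axis c 1) (\<lambda>q. f q vs) p)"

lemma sig_central:
  assumes "c \<in> {X1, X2, V1, V2}"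
  shows "sig k (axis c 1) v = 0" "sig k v (axis c 1) = 0"
  using assms by (cases k; auto simp: sig_def axis_def)+

lemma indep_vertical:
  assumes "indep V1 f" "indep V2 f"
  shows "f (p + (a *\<^sub>R vdir V1 + b *\<^sub>R vdir V2)) = f p"
proof -
  have "f (p + (a *\<^sub>R vdir V1 + b *\<^sub>R vdir V2)) = f (p + a *\<^sub>R vdir V1 + b *\<^sub>R vdir V2)"
    by (simp add: add.assoc)
  also have "\<dots> = f p" using assms unfolding indep_def by metis
  finally show ?thesis .
qed

lemma averageable_frame:
  assumes "averageable c f"
  shows "f (p + t *\<^sub>R frame g (axis c 1)) = f (p + t *\<^sub>R axis c 1)"
proof (cases "c \<in> {X1, X2, V1, V2}")
  case True
  then show ?thesis by (simp add: frame_def sig_central)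
next
  case False
  with assms have i: "indep V1 f" "indep V2 f" by (auto simp: averageable_def)
  have "p + t *\<^sub>R frame g (axis c 1) = (p + t *\<^sub>R axis c 1) +
      ((t * sig V1 g (axis c 1)) *\<^sub>R vdir V1 + (t * sig V2 g (axis c 1)) *\<^sub>R vdir V2)"
    by (simp add: frame_def algebra_simps)
  then show ?thesis using indep_vertical[OF i] by metis
qed

lemma lattice_period: "3 *\<^sub>R axis c 1 \<in> lattice"
proof -
  have "(3 *\<^sub>R axis c 1 :: pt) $ d \<in> \<int>" for d by (simp add: axis_def)
  moreover have "\<exists>n::int. (3 *\<^sub>R axis c 1 :: pt) $ V1 - (3 *\<^sub>R axis c 1) $ V2 = 3 * of_int n"
    by (rule exI[of _ "if c = V1 then 1 else if c = V2 then -1 else 0"]) (simp add: axis_def)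
  ultimately show ?thesis by (simp add: lattice_def)
qed

lemma periodic_period:
  assumes "periodic_form f" "averageable c f"
  shows "f (p + 3 *\<^sub>R axis c 1) = f p"
proof (cases "c \<in> {X1, X2, V1, V2}")
  case True
  then have "group_mult (3 *\<^sub>R axis c 1) p = p + 3 *\<^sub>R axis c 1"
    by (simp add: group_mult_eq_frame frame_def sig_central add.commute)
  with assms(1) lattice_period[of c] show ?thesis unfolding periodic_form_def by metis
next
  case False
  with assms have i: "indep V1 f" "indep V2 f" by (auto simp: averageable_def)
  have "group_mult (3 *\<^sub>R axis c 1) p = (p + 3 *\<^sub>R axis c 1) +
      ((3 * sig V1 (axis c 1) p) *\<^sub>R vdir V1 + (3 * sig V2 (axis c 1) p) *\<^sub>R vdir V2)"
    by (simp add: group_mult_eq_frame frame_def algebra_simps)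
  then have "f (p + 3 *\<^sub>R axis c 1) = f (group_mult (3 *\<^sub>R axis c 1) p)"
    using indep_vertical[OF i] by metis
  with assms(1) lattice_period[of c] show ?thesis by (simp add: periodic_form_def)
qed

context
  fixes w :: "real \<Rightarrow> real"
  assumes w: "continuous_on UNIV w"
begin

lemma form_mean_add:
  assumes "smooth_form f" "smooth_form g"
  shows "form_mean w c (\<lambda>p. f p + g p) = (\<lambda>p. form_mean w c f p + form_mean w c g p)"
proof (intro ext)
  fix p vs
  show "form_mean w c (\<lambda>p. f p + g p) p vs = (form_mean w c f p + form_mean w c g p) vs"
    by (simp add: form_mean_def line_mean_def distrib_left integral_add
        integrable_along_line[OF smooth_formD(2)[OF assms(1)] w]
        integrable_along_line[OF smooth_formD(2)[OF assms(2)] w])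
qed

lemma form_mean_diff:
  assumes "smooth_form f" "smooth_form g"
  shows "form_mean w c (\<lambda>p. f p - g p) = (\<lambda>p. form_mean w c f p - form_mean w c g p)"
proof (intro ext)
  fix p vs
  show "form_mean w c (\<lambda>p. f p - g p) p vs = (form_mean w c f p - form_mean w c g p) vs"
    by (simp add: form_mean_def line_mean_def right_diff_distrib integral_diff
        integrable_along_line[OF smooth_formD(2)[OF assms(1)] w]
        integrable_along_line[OF smooth_formD(2)[OF assms(2)] w])
qed

lemma form_mean_scale: "form_mean w c (\<lambda>p. scale r (f p)) = (\<lambda>p. scale r (form_mean w c f p))"
proof (intro ext)
  fix p vs
  show "form_mean w c (\<lambda>p. scale r (f p)) p vs = scale r (form_mean w c f p) vs"
    by (simp add: form_mean_def line_mean_def mult.left_commute[of _ r] flip: integral_mult_right)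
qed

lemma form_mean_contract: "(\<lambda>p. contract v (form_mean w c f p)) = form_mean w c (\<lambda>q. contract v (f q))"
  by (simp add: form_mean_def contract_def)

lemma partial_form_mean:
  assumes "smooth_form f"
  shows "partial v (form_mean w c f) = form_mean w c (partial v f)"
  using fun_cong[OF line_mean_derivative(1)[OF smooth_formD(2)[OF assms] w]]
  by (simp add: form_mean_def partial_def fun_eq_iff)

lemma smooth_form_mean:
  assumes "smooth_form f"
  shows "smooth_form (form_mean w c f)"
proof -
  have "linear (\<lambda>v. form_mean w c f p (us @ v # vs))" for p us vs
  proof (rule linearI)
    have l: "linear (\<lambda>v. f q (us @ v # vs))" for q
      using smooth_formD(1)[OF assms] by (simp add: alternating_def)
    show "form_mean w c f p (us @ (a + b) # vs) =
        form_mean w c f p (us @ a # vs) + form_mean w c f p (us @ b # vs)" for a b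
      by (simp add: form_mean_def line_mean_def linear_add[OF l] distrib_left integral_add
          integrable_along_line[OF smooth_formD(2)[OF assms] w])
    show "form_mean w c f p (us @ (r *\<^sub>R a) # vs) = r *\<^sub>R form_mean w c f p (us @ a # vs)" for r a
      by (simp add: form_mean_def line_mean_def linear_cmul[OF l] mult.left_commute[of _ r]
          flip: integral_mult_right)
  qed
  moreover have "form_mean w c f p vs = 0" if "\<not> distinct vs" for p vs
    using smooth_formD(1)[OF assms] that by (simp add: form_mean_def line_mean_def alternating_def)
  moreover have "smooth (\<lambda>p. form_mean w c f p vs)" for vs
    unfolding form_mean_def by (rule smooth_line_mean[OF smooth_formD(2)[OF assms] w])
  ultimately show ?thesis by (simp add: smooth_form_def alternating_def)
qed

lemma indep_form_mean: "indep c' f \<Longrightarrow> indep c' (form_mean w c f)"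
  unfolding indep_def form_mean_def line_mean_def
  by (simp add: add.assoc add.commute[of _ "_ *\<^sub>R axis c 1"]) (simp flip: add.assoc)

lemma averageable_form_mean: "averageable c' f \<Longrightarrow> averageable c' (form_mean w c f)"
  by (auto simp: averageable_def indep_form_mean)

lemma periodic_form_mean:
  assumes f: "periodic_form f" and c: "averageable c f"
  shows "periodic_form (form_mean w c f)"
proof -
  have "form_mean w c f (group_mult g p) = form_mean w c f p" if g: "g \<in> lattice" for g p
  proof -
    have "f (group_mult g p + t *\<^sub>R axis c 1) = f (p + t *\<^sub>R axis c 1)" for t
    proof -
      have "group_mult g p + t *\<^sub>R frame g (axis c 1) = group_mult g (p + t *\<^sub>R axis c 1)"
        using linear_add[OF linear_frame] linear_cmul[OF linear_frame]
        by (simp add: group_mult_eq_frame algebra_simps)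
      with averageable_frame[OF c, of "group_mult g p" t g] f g show ?thesis
        by (simp add: periodic_form_def)
    qed
    then show ?thesis by (simp add: form_mean_def line_mean_def)
  qed
  with f smooth_form_mean show ?thesis by (simp add: periodic_form_def)
qed

lemma one_form_lwedge_form_mean:
  assumes "smooth_form f" "linear \<beta>"
  shows "lwedge (one_form \<beta>) (form_mean w c f p) = form_mean w c (\<lambda>q. lwedge (one_form \<beta>) (f q)) p"
proof
  show "lwedge (one_form \<beta>) (form_mean w c f p) vs = form_mean w c (\<lambda>q. lwedge (one_form \<beta>) (f q)) p vs" for vs
    using assms(1)
  proof (induction vs arbitrary: f)
    case Nil
    then show ?case by (simp add: form_mean_def line_mean_def)
  next
    case (Cons v vs)
    note s = smooth_form_contract[OF Cons.prems]
    have sl: "smooth_form (\<lambda>q. lwedge (one_form \<beta>) (contract v (f q)))"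
      by (intro smooth_form_lwedge smooth_form_const alternating_one_form assms s)
    have "form_mean w c (\<lambda>q. lwedge (one_form \<beta>) (f q)) p (v # vs) =
        form_mean w c (\<lambda>q. scale (\<beta> v) (f q) - lwedge (one_form \<beta>) (contract v (f q))) p vs"
      by (simp add: form_mean_def one_form_lwedge_Cons)
    also have "\<dots> = \<beta> v * form_mean w c f p vs - form_mean w c (\<lambda>q. lwedge (one_form \<beta>) (contract v (f q))) p vs"
      unfolding form_mean_diff[OF smooth_form_scale[OF Cons.prems] sl] form_mean_scale by simp
    finally show ?case
      using Cons.IH[OF s, of v] fun_cong[OF form_mean_contract[of v c f], of p]
      by (simp add: one_form_lwedge_Cons form_mean_scale)
  qed
qed

lemma vert_form_mean:
  assumes f: "smooth_form f" and "linear (\<beta> V1)" "linear (\<beta> V2)"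
  shows "vert \<beta> (form_mean w c f p) = form_mean w c (\<lambda>q. vert \<beta> (f q)) p"
proof -
  have s: "smooth_form (\<lambda>q. lwedge (one_form (\<beta> k)) (contract v (f q)))" if "linear (\<beta> k)" for k v
    using that by (intro smooth_form_lwedge smooth_form_const alternating_one_form smooth_form_contract f)
  have "contract v (form_mean w c f p) = form_mean w c (\<lambda>q. contract v (f q)) p" for v
    using fun_cong[OF form_mean_contract[of v c f], of p] by simp
  then show ?thesis
    using assms(2,3) s
    by (simp add: vert_def one_form_lwedge_form_mean smooth_form_contract[OF f] form_mean_add)
qed

end

lemma linear_brk: "linear (brk v k)"
  unfolding brk_def by (intro linear_compose_sub linear_sig)

lemma smooth_form_vert:
  "smooth_form f \<Longrightarrow> smooth_form (\<lambda>p. vert (brk v) (f p))"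
  unfolding vert_def
  by (intro smooth_form_add smooth_form_lwedge smooth_form_const alternating_one_form linear_brk smooth_form_contract)

lemma partial_direction:
  assumes "smooth_form f"
  shows "partial (a + b) f p = partial a f p + partial b f p" "partial (r *\<^sub>R a) f p = scale r (partial a f p)"
  using linear_add[OF linear_dir_deriv[OF smooth_formD(2)[OF assms]]]
    linear_cmul[OF linear_dir_deriv[OF smooth_formD(2)[OF assms]]]
  by (simp_all add: partial_def fun_eq_iff)

lemma indep_iff_partial:
  assumes "smooth_form f"
  shows "indep c f \<longleftrightarrow> partial (axis c 1) f = (\<lambda>p. 0)"
proof
  assume i: "indep c f"
  have "dir_deriv (axis c 1) (\<lambda>q. f q vs) p = 0" for p vs
  proof -
    have "((\<lambda>t. f (p + t *\<^sub>R axis c 1) vs) has_vector_derivative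
        dir_deriv (axis c 1) (\<lambda>q. f q vs) (p + 0 *\<^sub>R axis c 1)) (at 0)"
      by (rule has_vector_derivative_along_line[OF smooth_formD(2)[OF assms]])
    moreover have "(\<lambda>t. f (p + t *\<^sub>R axis c 1) vs) = (\<lambda>t. f p vs)"
      using i by (simp add: indep_def)
    ultimately show ?thesis
      using vector_derivative_unique_at[OF _ has_vector_derivative_const] by fastforce
  qed
  then show "partial (axis c 1) f = (\<lambda>p. 0)" by (simp add: partial_def fun_eq_iff)
next
  assume z: "partial (axis c 1) f = (\<lambda>p. 0)"
  show "indep c f" unfolding indep_def
  proof (intro allI ext)
    fix p r vs
    have "((\<lambda>t. f (p + t *\<^sub>R axis c 1) vs) has_real_derivative 0) (at t)" for t
      using has_vector_derivative_along_line[OF smooth_formD(2)[OF assms], of p "axis c 1" vs t UNIV] z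
      by (simp add: partial_def fun_eq_iff has_real_derivative_iff_has_vector_derivative)
    then have "f (p + r *\<^sub>R axis c 1) vs = f (p + 0 *\<^sub>R axis c 1) vs"
      using DERIV_isconst_all by blast
    then show "f (p + r *\<^sub>R axis c 1) vs = f p vs" by simp
  qed
qed

lemma averageable_partial_vertical:
  assumes f: "smooth_form f" and c: "averageable c f"
  shows "scale (sig k (axis c 1) v) (partial (vdir j) f p) = 0 \<or> j \<notin> {V1, V2}"
    "scale (sig k v (axis c 1)) (partial (vdir j) f p) = 0 \<or> j \<notin> {V1, V2}"
proof -
  have "sig k (axis c 1) v = 0 \<and> sig k v (axis c 1) = 0 \<or> (j \<in> {V1, V2} \<longrightarrow> partial (vdir j) f p = 0)"
    using c indep_iff_partial[OF f] sig_central[of c k v] by (auto simp: averageable_def)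
  then show "scale (sig k (axis c 1) v) (partial (vdir j) f p) = 0 \<or> j \<notin> {V1, V2}"
    "scale (sig k v (axis c 1)) (partial (vdir j) f p) = 0 \<or> j \<notin> {V1, V2}"
    by (auto simp: fun_eq_iff)
qed

lemma averageable_contract: "averageable c f \<Longrightarrow> averageable c (\<lambda>q. contract v (f q))"
  by (auto simp: averageable_def indep_def)

lemma frame_d_form_mean:
  assumes w: "continuous_on UNIV w" and "smooth_form f" "averageable c f"
  shows "frame_d (form_mean w c f) = form_mean w c (frame_d f)"
proof (intro ext)
  show "frame_d (form_mean w c f) p vs = form_mean w c (frame_d f) p vs" for p vs
    using assms(2,3)
  proof (induction vs arbitrary: f)
    case Nil
    then show ?case by (simp add: form_mean_def line_mean_def)
  next
    case (Cons v vs)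
    note f = Cons.prems(1)
    let ?e = "axis c 1 :: pt"
    have cd: "frame_d g p (v # vs) = partial (frame p v) g p vs - vert (brk v) (g p) vs -
        frame_d (\<lambda>q. contract v (g q)) p vs" if "smooth_form g" for g p
      using fun_cong[OF contract_frame_d[OF that, of v p], of vs] by (simp add: contract_def[of v "frame_d g p"])
    have mv: "partial (frame (p + t *\<^sub>R ?e) v) f q = partial (frame p v) f q" for p q t
    proof -
      have "frame (p + t *\<^sub>R ?e) v = frame p v + (t *\<^sub>R (sig V1 ?e v *\<^sub>R vdir V1) + t *\<^sub>R (sig V2 ?e v *\<^sub>R vdir V2))"
        by (simp add: frame_def algebra_simps)
      then show ?thesis
        using averageable_partial_vertical(1)[OF Cons.prems, of V1 v V1 q]
          averageable_partial_vertical(1)[OF Cons.prems, of V2 v V2 q]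
        by (simp add: partial_direction[OF f]) (auto simp: fun_eq_iff)
    qed
    have sm: "smooth_form (partial (frame p v) f)" "smooth_form (\<lambda>q. vert (brk v) (f q))"
      "smooth_form (frame_d (\<lambda>q. contract v (f q)))"
      by (intro smooth_form_partial smooth_form_vert smooth_form_frame_d smooth_form_contract f)+
    then have sm4: "smooth_form (\<lambda>q. partial (frame p v) f q - vert (brk v) (f q))"
      using smooth_form_add[OF sm(1) smooth_form_uminus[OF sm(2)]] by simp
    have "form_mean w c (frame_d f) p (v # vs) =
        form_mean w c (\<lambda>q. partial (frame p v) f q - vert (brk v) (f q) - frame_d (\<lambda>q. contract v (f q)) q) p vs"
      by (simp add: form_mean_def line_mean_def cd[OF f] mv)
    also have "\<dots> = form_mean w c (partial (frame p v) f) p vs - form_mean w c (\<lambda>q. vert (brk v) (f q)) p vs -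
        form_mean w c (frame_d (\<lambda>q. contract v (f q))) p vs"
      using form_mean_diff[OF w sm4 sm(3)] form_mean_diff[OF w sm(1,2)] by simp
    also have "\<dots> = frame_d (form_mean w c f) p (v # vs)"
      using Cons.IH[OF smooth_form_contract[OF f] averageable_contract[OF Cons.prems(2)], of v]
        fun_cong[OF vert_form_mean[where \<beta> = "brk v" and c = c and p = p, OF w f linear_brk linear_brk], of vs]
      by (simp add: cd[OF smooth_form_mean[OF w f]] partial_form_mean[OF w f] form_mean_contract[OF w])
    finally show ?case by simp
  qed
qed

lemma vert_vert_vert:
  assumes f: "alternating f"
  shows "vert (brk v) (vert (brk v) (vert (brk v) f)) = 0"
proof -
  let ?\<beta> = "\<lambda>k. one_form (brk v k)" and ?\<iota> = "\<lambda>k. contract (vdir k)"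
  have b: "brk v k (vdir V1) = 0" "brk v k (vdir V2) = 0" for k by (simp_all add: brk_def)
  have c: "?\<iota> j (lwedge (?\<beta> k) g) = - lwedge (?\<beta> k) (?\<iota> j g)" if "j \<in> {V1, V2}" for j k g
    using that b by (auto simp: contract_one_form_lwedge fun_eq_iff)
  have tw: "?\<iota> k (?\<iota> k g) = 0" if "alternating g" for k g using that by (rule alternating_contract_twice)
  have sw: "?\<iota> V2 (?\<iota> V1 g) = - ?\<iota> V1 (?\<iota> V2 g)" if "alternating g" for g
    using that by (rule alternating_contract_contract)
  have f2: "alternating (?\<iota> k f)" for k by (rule alternating_contract[OF f])
  show ?thesis
    by (simp add: vert_def contract_add contract_diff c lwedge_add_right lwedge_diff_right
        lwedge_uminus_right contract_uminus
        tw[OF f] tw[OF f2] sw[OF f] sw[OF f2])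
qed

lemma periodic_form_smooth: "periodic_form f \<Longrightarrow> smooth_form f"
  by (simp add: periodic_form_def)

lemma periodic_form_add: "periodic_form f \<Longrightarrow> periodic_form g \<Longrightarrow> periodic_form (\<lambda>p. f p + g p)"
  and periodic_form_scale: "periodic_form f \<Longrightarrow> periodic_form (\<lambda>p. scale r (f p))"
  and periodic_form_lwedge: "periodic_form f \<Longrightarrow> periodic_form g \<Longrightarrow> periodic_form (\<lambda>p. lwedge (f p) (g p))"
  and periodic_form_contract: "periodic_form f \<Longrightarrow> periodic_form (\<lambda>p. contract v (f p))"
  and periodic_form_vert: "periodic_form f \<Longrightarrow> periodic_form (\<lambda>p. vert (brk v) (f p))"
  and periodic_form_const: "alternating c \<Longrightarrow> periodic_form (\<lambda>p. c)"
  by (simp_all add: periodic_form_def smooth_form_add smooth_form_scale smooth_form_lwedge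
      smooth_form_contract smooth_form_vert smooth_form_const)

lemma continuous_weights: "continuous_on UNIV (\<lambda>_ :: real. 1 :: real)" "continuous_on UNIV (\<lambda>t :: real. t)"
  by (intro continuous_intros)+

abbreviation average :: "coord \<Rightarrow> pt form \<Rightarrow> pt form" where
  "average \<equiv> form_mean (\<lambda>_. 1)"

abbreviation integrate :: "coord \<Rightarrow> pt form \<Rightarrow> pt form" where
  "integrate \<equiv> form_mean (\<lambda>t. t)"

lemma indep_average:
  assumes f: "periodic_form f" "averageable c f"
  shows "indep c (average c f)"
proof -
  note s = periodic_form_smooth[OF f(1)]
  have "partial (axis c 1) (average c f) p vs = 0" for p vs
  proof -
    have "partial (axis c 1) (average c f) p vs = line_mean (\<lambda>_. 1) 3 (axis c 1) (dir_deriv (axis c 1) (\<lambda>q. f q vs)) p"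
      unfolding partial_form_mean[OF continuous_weights(1) s] by (simp add: form_mean_def partial_def)
    also have "\<dots> = f (p + 3 *\<^sub>R axis c 1) vs - f p vs"
      by (rule line_mean_dir_deriv(1)[OF smooth_formD(2)[OF s]]) simp
    finally show ?thesis using periodic_period[OF f] by simp
  qed
  then show ?thesis
    by (simp add: indep_iff_partial smooth_form_mean continuous_weights s fun_eq_iff)
qed

text \<open>For a function \<open>f\<close> of period 3 the integral of \<open>t f (p + t e)\<close> over a period is a
  primitive of \<open>3 f\<close> minus the integral of \<open>f\<close>. For a closed form the derivative in direction \<open>e\<close>
  is exact up to the action of the brackets with \<open>e\<close>; so \<open>f\<close> is cohomologous to its average up to
  a bracket term.\<close>

lemma homotopy_formula:
  assumes f: "periodic_form f" "averageable c f" and closed: "frame_d f = (\<lambda>p. 0)"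
  shows "scale 3 (f p) = average c f p + vert (brk (axis c 1)) (integrate c f p) +
      frame_d (\<lambda>q. contract (axis c 1) (integrate c f q)) p"
    "frame_d (\<lambda>p. vert (brk (axis c 1)) (integrate c f p)) = (\<lambda>p. 0)"
proof -
  let ?e = "axis c 1 :: pt" and ?u = "integrate c f"
  note s = periodic_form_smooth[OF f(1)]
  note su = smooth_form_mean[OF continuous_weights(2) s, of c]
  have zmean: "form_mean w c (\<lambda>p. 0) = (\<lambda>p. 0)" for w
    by (simp add: form_mean_def line_mean_def fun_eq_iff)
  have du: "frame_d ?u = (\<lambda>p. 0)"
    by (simp add: frame_d_form_mean[OF continuous_weights(2) s f(2)] closed zmean)
  have "partial (frame p ?e) ?u p = partial ?e ?u p" for p
  proof -
    have "frame p ?e = ?e + (sig V1 p ?e *\<^sub>R vdir V1 + sig V2 p ?e *\<^sub>R vdir V2)"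
      by (simp add: frame_def)
    moreover have "averageable c ?u" by (rule averageable_form_mean[OF continuous_weights(2) f(2)])
    ultimately show ?thesis
      using averageable_partial_vertical(2)[OF su, of c V1 p V1 p]
        averageable_partial_vertical(2)[OF su, of c V2 p V2 p]
      by (simp add: partial_direction[OF su])
  qed
  moreover have "partial ?e ?u p = scale 3 (f p) - average c f p" for p
  proof
    fix vs
    have "partial ?e ?u p vs = line_mean (\<lambda>t. t) 3 ?e (dir_deriv ?e (\<lambda>q. f q vs)) p"
      unfolding partial_form_mean[OF continuous_weights(2) s] by (simp add: form_mean_def partial_def)
    also have "\<dots> = 3 * f (p + 3 *\<^sub>R ?e) vs - average c f p vs"
      unfolding form_mean_def by (rule line_mean_dir_deriv(2)[OF smooth_formD(2)[OF s]]) simp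
    finally show "partial ?e ?u p vs = (scale 3 (f p) - average c f p) vs"
      using periodic_period[OF f] by simp
  qed
  ultimately have "contract ?e (0 :: pt list \<Rightarrow> real) = scale 3 (f p) - average c f p -
      vert (brk ?e) (?u p) - frame_d (\<lambda>q. contract ?e (?u q)) p" for p
    using contract_frame_d[OF su, of ?e p] by (simp add: du)
  then have *: "vert (brk ?e) (?u p) = scale 3 (f p) - average c f p - frame_d (\<lambda>q. contract ?e (?u q)) p" for p
    by (simp add: fun_eq_iff algebra_simps)
  show "scale 3 (f p) = average c f p + vert (brk ?e) (?u p) + frame_d (\<lambda>q. contract ?e (?u q)) p"
    unfolding * by (simp add: fun_eq_iff)
  have sa: "smooth_form (average c f)" by (rule smooth_form_mean[OF continuous_weights(1) s])
  have sc: "smooth_form (\<lambda>q. contract ?e (?u q))" by (rule smooth_form_contract[OF su])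
  have "frame_d (average c f) = (\<lambda>p. 0)"
    by (simp add: frame_d_form_mean[OF continuous_weights(1) s f(2)] closed zmean)
  then have "frame_d (\<lambda>p. scale 3 (f p) + (scale (-1) (average c f p) +
      scale (-1) (frame_d (\<lambda>q. contract ?e (?u q)) p))) = (\<lambda>p. 0)"
    by (simp only: frame_d_add frame_d_scale smooth_form_add smooth_form_scale smooth_form_frame_d
        s sa sc closed frame_d_frame_d) (simp add: fun_eq_iff)
  moreover have "(\<lambda>p. scale 3 (f p) + (scale (-1) (average c f p) +
      scale (-1) (frame_d (\<lambda>q. contract ?e (?u q)) p))) = (\<lambda>p. vert (brk ?e) (?u p))"
    unfolding * by (simp add: fun_eq_iff)
  ultimately show "frame_d (\<lambda>p. vert (brk ?e) (?u p)) = (\<lambda>p. 0)" by simp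
qed

lemma indep_closed:
  "indep c f \<Longrightarrow> indep c g \<Longrightarrow> indep c (\<lambda>p. f p + g p)"
  "indep c f \<Longrightarrow> indep c (\<lambda>p. scale r (f p))"
  "indep c f \<Longrightarrow> indep c (\<lambda>p. vert \<beta> (f p))"
  by (simp_all add: indep_def)

text \<open>The bracket term is again closed, and the bracket acts nilpotently: applying the formula to the
  bracket terms twice more, only averages remain.\<close>

lemma average_closed_form:
  assumes f: "periodic_form f" "averageable c f" and closed: "frame_d f = (\<lambda>p. 0)"
  obtains f' h where "periodic_form f'" "frame_d f' = (\<lambda>p. 0)" "periodic_form h"
    "f = (\<lambda>p. f' p + frame_d h p)" "indep c f'" "\<And>c'. indep c' f \<Longrightarrow> indep c' f'"
proof -
  let ?b = "vert (brk (axis c 1))"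
  define T where "T f = (\<lambda>p. ?b (integrate c f p))" for f
  define H where "H f = (\<lambda>q. contract (axis c 1) (integrate c f q))" for f
  define good where "good f \<longleftrightarrow> periodic_form f \<and> averageable c f \<and> frame_d f = (\<lambda>p. 0)" for f
  have T: "good (T f)" "periodic_form (H f)" "\<And>c'. indep c' f \<Longrightarrow> indep c' (T f)"
    "\<And>p. scale 3 (f p) = average c f p + T f p + frame_d (H f) p" if "good f" for f
  proof -
    have f: "periodic_form f" "averageable c f" "frame_d f = (\<lambda>p. 0)" using that by (auto simp: good_def)
    have i: "periodic_form (integrate c f)" by (rule periodic_form_mean[OF continuous_weights(2) f(1,2)])
    show ind: "indep c' (T f)" if "indep c' f" for c'
      unfolding T_def by (intro indep_closed indep_form_mean continuous_weights that)
    have "averageable c (T f)" using f(2) ind by (auto simp: averageable_def)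
    then show "good (T f)"
      using homotopy_formula(2)[OF f] i by (simp add: good_def T_def periodic_form_vert)
    show "periodic_form (H f)" unfolding H_def by (intro periodic_form_contract i)
    show "scale 3 (f p) = average c f p + T f p + frame_d (H f) p" for p
      using homotopy_formula(1)[OF f] by (simp add: T_def H_def)
  qed
  have g0: "good f" using f closed by (simp add: good_def)
  note g1 = T(1)[OF g0] note g2 = T(1)[OF g1]
  have "T (T (T f)) p = 0" for p
  proof -
    let ?I = "integrate c"
    have comm: "?I (\<lambda>q. ?b (g q)) = (\<lambda>p. ?b (?I g p))" if "smooth_form g" for g
      using vert_form_mean[OF continuous_weights(2) that linear_brk linear_brk] by (simp add: fun_eq_iff)
    have s: "smooth_form f" using f by (simp add: periodic_form_def)
    have sI: "smooth_form (?I g)" if "smooth_form g" for g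
      using that by (rule smooth_form_mean[OF continuous_weights(2)])
    have "T (T (T f)) p = ?b (?b (?b (?I (?I (?I f)) p)))"
      unfolding T_def by (simp add: comm s sI smooth_form_vert)
    also have "\<dots> = 0" by (rule vert_vert_vert[OF smooth_formD(1)]) (intro sI s)
    finally show ?thesis .
  qed
  note T3 = this
  define f' where "f' = (\<lambda>p. scale (1/3) (average c f p) + (scale (1/9) (average c (T f) p) + scale (1/27) (average c (T (T f)) p)))"
  define h where "h = (\<lambda>p. scale (1/3) (H f p) + (scale (1/9) (H (T f) p) + scale (1/27) (H (T (T f)) p)))"
  have av: "periodic_form (average c g)" "frame_d (average c g) = (\<lambda>p. 0)" "indep c (average c g)" if "good g" for g
    using that periodic_form_mean[OF continuous_weights(1)] indep_average
      frame_d_form_mean[OF continuous_weights(1) periodic_form_smooth]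
    by (auto simp: good_def form_mean_def line_mean_def fun_eq_iff)
  have sH: "smooth_form (H g)" and sA: "smooth_form (average c g)" if "good g" for g
    using T(2)[OF that] av(1)[OF that] by (simp_all add: periodic_form_def)
  have dh: "frame_d h = (\<lambda>p. scale (1/3) (frame_d (H f) p) + (scale (1/9) (frame_d (H (T f)) p) +
      scale (1/27) (frame_d (H (T (T f))) p)))"
    unfolding h_def by (simp only: frame_d_add frame_d_scale smooth_form_add smooth_form_scale sH g0 g1 g2)
  show ?thesis
  proof (rule that)
    show "periodic_form f'" "periodic_form h"
      unfolding f'_def h_def by (intro periodic_form_add periodic_form_scale av T(2) g0 g1 g2)+
    show "frame_d f' = (\<lambda>p. 0)" unfolding f'_def
      by (simp only: frame_d_add frame_d_scale smooth_form_add smooth_form_scale sA g0 g1 g2 av(2))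
        (simp add: fun_eq_iff)
    show "indep c f'" unfolding f'_def by (intro indep_closed av(3) g0 g1 g2)
    show "indep c' f'" if "indep c' f" for c'
      unfolding f'_def by (intro indep_closed indep_form_mean continuous_weights T(3) g0 g1 that)
    show "f = (\<lambda>p. f' p + frame_d h p)"
    proof (intro ext)
      fix p vs
      have "3 * f p vs = average c f p vs + T f p vs + frame_d (H f) p vs"
        "3 * T f p vs = average c (T f) p vs + T (T f) p vs + frame_d (H (T f)) p vs"
        "3 * T (T f) p vs = average c (T (T f)) p vs + frame_d (H (T (T f))) p vs"
        using fun_cong[OF T(4)[OF g0, of p], of vs] fun_cong[OF T(4)[OF g1, of p], of vs]
          fun_cong[OF T(4)[OF g2, of p], of vs] T3[of p] by simp_all
      then show "f p vs = (f' p + frame_d h p) vs" by (simp add: f'_def dh)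
    qed
  qed
qed

lemma UNIV_coord: "UNIV = {V1, V2, X1, X2, Y1, Y2, Z1, Z2}"
  using coord.exhaust by blast

lemma const_if_indep:
  assumes "\<And>c. indep c f"
  shows "f p = f 0"
proof -
  have shift: "f (r *\<^sub>R axis c 1 + q) = f q" for r c q
    using assms[of c] unfolding indep_def by (simp add: add.commute)
  have "f (\<Sum>c\<in>S. (p $ c) *\<^sub>R axis c 1) = f 0" if "finite S" for S
    using that by (induction S rule: finite_induct) (simp_all add: shift)
  moreover have "(\<Sum>c\<in>UNIV. (p $ c) *\<^sub>R axis c 1) = p"
    by (simp add: vec_eq_iff axis_def if_distrib sum.delta cong: if_cong)
  ultimately show ?thesis by (metis finite)
qed

text \<open>The central directions are treated first.\<close>

lemma average_all_directions:
  assumes "P f" and step: "\<And>f c. P f \<Longrightarrow> averageable c f \<Longrightarrow>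
    \<exists>f'. P f' \<and> indep c f' \<and> (\<forall>c'. indep c' f \<longrightarrow> indep c' f')"
  shows "\<exists>f'. P f' \<and> (\<forall>p. f' p = f' 0)"
proof -
  have "\<exists>f'. P f' \<and> indep V1 f'"
    using step[OF \<open>P f\<close>, of V1] by (auto simp: averageable_def)
  then obtain f1 where f1: "P f1" "indep V1 f1" by blast
  obtain f2 where f2: "P f2" "indep V1 f2" "indep V2 f2"
    using step[OF f1(1), of V2] f1(2) by (auto simp: averageable_def)
  have "\<exists>f'. P f' \<and> (\<forall>c\<in>S. indep c f')" if "finite S" "{V1, V2} \<subseteq> S" for S
  proof -
    have "\<exists>f'. P f' \<and> (\<forall>c\<in>{V1, V2} \<union> R. indep c f')" if "finite R" for R
      using that
    proof (induction R rule: finite_induct)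
      case (insert c R)
      then obtain g where g: "P g" "\<forall>c\<in>{V1, V2} \<union> R. indep c g" by blast
      then have "averageable c g" by (simp add: averageable_def)
      from step[OF g(1) this] g(2) show ?case by blast
    qed (use f2 in blast)
    from this[OF that(1)] show ?thesis unfolding Un_absorb1[OF that(2)] .
  qed
  from this[of UNIV] obtain f' where "P f'" "\<forall>c. indep c f'" by auto
  with const_if_indep show ?thesis by blast
qed

text \<open>Nomizu's theorem for this nilmanifold: closed forms are cohomologous to left invariant ones.\<close>

theorem closed_form_cohomologous_const:
  assumes f: "periodic_form f" and closed: "frame_d f = (\<lambda>p. 0)"
  obtains c h where "alternating c" "periodic_form h" "f = (\<lambda>p. c + frame_d h p)"
proof -
  define P where "P g \<longleftrightarrow> periodic_form g \<and> frame_d g = (\<lambda>p. 0) \<and>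
      (\<exists>h. periodic_form h \<and> f = (\<lambda>p. g p + frame_d h p))" for g
  have z: "periodic_form (\<lambda>p. 0)" by (rule periodic_form_const) simp
  have "frame_d (\<lambda>p. 0) = (\<lambda>p. 0)"
    using frame_d_scale[of "\<lambda>p. 0" 0] z by (simp add: periodic_form_def) (simp add: fun_eq_iff zero_fun_def)
  then have "f = (\<lambda>p. f p + frame_d (\<lambda>p. 0) p)" by simp
  with f closed z have "P f" unfolding P_def by blast
  then have "\<exists>g. P g \<and> (\<forall>p. g p = g 0)"
  proof (rule average_all_directions)
    fix g c assume "P g" and c: "averageable c g"
    then obtain h where g: "periodic_form g" "frame_d g = (\<lambda>p. 0)" "periodic_form h"
      "f = (\<lambda>p. g p + frame_d h p)" by (auto simp: P_def)
    obtain g' h' where g': "periodic_form g'" "frame_d g' = (\<lambda>p. 0)" "periodic_form h'"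
      "g = (\<lambda>p. g' p + frame_d h' p)" "indep c g'" "\<And>c'. indep c' g \<Longrightarrow> indep c' g'"
      by (rule average_closed_form[OF g(1) c g(2)]) blast
    have "f = (\<lambda>p. g' p + frame_d (\<lambda>p. h' p + h p) p)"
      using g(3) g'(3) unfolding g(4) by (subst g'(4)) (simp add: frame_d_add periodic_form_smooth add.assoc)
    then have "P g'" using g' g(3) periodic_form_add unfolding P_def by blast
    with g'(5,6) show "\<exists>f'. P f' \<and> indep c f' \<and> (\<forall>c'. indep c' g \<longrightarrow> indep c' f')" by blast
  qed
  then obtain g where g: "P g" "\<And>p. g p = g 0" by blast
  then obtain h where h: "periodic_form h" "f = (\<lambda>p. g p + frame_d h p)" "smooth_form g"
    by (auto simp: P_def periodic_form_def)
  have "f p = g 0 + frame_d h p" for p using fun_cong[OF h(2), of p] g(2)[of p] by simp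
  then have "f = (\<lambda>p. g 0 + frame_d h p)" by (rule ext)
  with that smooth_formD(1)[OF h(3)] h(1) show ?thesis by blast
qed

lemma const_primitive:
  assumes "periodic_form \<theta>" "frame_d \<theta> = (\<lambda>p. c)"
  obtains k where "alternating k" "frame_d (\<lambda>p. k) = (\<lambda>p. c)"
proof -
  define P where "P g \<longleftrightarrow> periodic_form g \<and> frame_d g = (\<lambda>p. c)" for g
  have "P \<theta>" using assms by (simp add: P_def)
  then have "\<exists>g. P g \<and> (\<forall>p. g p = g 0)"
  proof (rule average_all_directions)
    fix g d assume "P g" and d: "averageable d g"
    then have g: "periodic_form g" "frame_d g = (\<lambda>p. c)" by (auto simp: P_def)
    note s = periodic_form_smooth[OF g(1)]
    have cm: "average d (\<lambda>p. c) = (\<lambda>p. scale 3 c)"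
      by (simp add: form_mean_def line_mean_def fun_eq_iff)
    have "frame_d (\<lambda>p. scale (1/3) (average d g p)) = (\<lambda>p. c)"
      unfolding frame_d_scale[OF smooth_form_mean[OF continuous_weights(1) s]]
        frame_d_form_mean[OF continuous_weights(1) s d] g(2) cm
      by (simp add: fun_eq_iff)
    then have "P (\<lambda>p. scale (1/3) (average d g p))"
      using periodic_form_scale[OF periodic_form_mean[OF continuous_weights(1) g(1) d], of "1/3"]
      by (simp add: P_def)
    moreover have "indep d (\<lambda>p. scale (1/3) (average d g p))"
      by (intro indep_closed indep_average g d)
    moreover have "indep c' (\<lambda>p. scale (1/3) (average d g p))" if "indep c' g" for c'
      by (intro indep_closed indep_form_mean continuous_weights that)
    ultimately show "\<exists>f'. P f' \<and> indep d f' \<and> (\<forall>c'. indep c' g \<longrightarrow> indep c' f')" by blast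
  qed
  then obtain g where g: "P g" "\<And>p. g p = g 0" by blast
  then have "g = (\<lambda>p. g 0)" by blast
  then have "frame_d (\<lambda>p. g 0) = (\<lambda>p. c)" "alternating (g 0)"
    using g(1) smooth_formD(1) by (auto simp: P_def periodic_form_def)
  with that show ?thesis by blast
qed

section \<open>Orbifold forms in the left invariant frame\<close>

lemma linear_rho: "linear rho"
proof (rule linearI)
  show "rho (p + q) = rho p + rho q" for p q
    by (simp add: vec_eq_iff rho_def split: coord.split)
  show "rho (r *\<^sub>R p) = r *\<^sub>R rho p" for r p
    by (simp add: vec_eq_iff rho_def algebra_simps split: coord.split)
qed

lemma rho_nth [simp]:
  "rho p $ X1 = - p $ X1 - p $ X2" "rho p $ X2 = p $ X1"
  "rho p $ Y1 = - p $ Y1 - p $ Y2" "rho p $ Y2 = p $ Y1"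
  "rho p $ Z1 = - p $ Z1 - p $ Z2" "rho p $ Z2 = p $ Z1"
  "rho p $ V1 = - p $ V1 - p $ V2" "rho p $ V2 = p $ V1"
  by (simp_all add: rho_def)

lemma vec_eq_coord: "(p :: pt) = q \<longleftrightarrow> p $ X1 = q $ X1 \<and> p $ X2 = q $ X2 \<and> p $ Y1 = q $ Y1 \<and> p $ Y2 = q $ Y2 \<and>
    p $ Z1 = q $ Z1 \<and> p $ Z2 = q $ Z2 \<and> p $ V1 = q $ V1 \<and> p $ V2 = q $ V2"
  (is "_ \<longleftrightarrow> ?R")
proof
  assume ?R
  then have "p $ c = q $ c" for c by (cases c) simp_all
  then show "p = q" by (simp add: vec_eq_iff)
qed simp

lemma rho_rho: "rho (rho p) = - p - rho p"
  by (simp add: vec_eq_coord)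

lemma rho_rho_rho: "rho (rho (rho p)) = p"
  by (simp add: vec_eq_coord)

lemma rho_frame: "rho (frame p v) = frame (rho p) (rho v)"
  by (simp add: vec_eq_coord frame_def sig_def axis_def algebra_simps)

lemma rho_group_mult: "rho (group_mult g p) = group_mult (rho g) (rho p)"
  by (simp add: group_mult_eq_frame linear_add[OF linear_rho] rho_frame)

lemma rho_lattice:
  assumes "g \<in> lattice"
  shows "rho g \<in> lattice"
proof -
  obtain n :: int where n: "g $ V1 - g $ V2 = 3 * of_int n" and i: "g $ c \<in> \<int>" for c
    using assms by (auto simp: lattice_def)
  obtain m where m: "g $ V1 = of_int m" using i[of V1] by (auto elim: Ints_cases)
  have "rho g $ V1 - rho g $ V2 = 3 * of_int (n - m)" using n m by simp
  moreover have "rho g $ c \<in> \<int>" for c using i by (cases c) simp_all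
  ultimately show ?thesis unfolding lattice_def by blast
qed

lemma pullback_rho: "pullback rho f = (\<lambda>p. lpullback rho (f (rho p)))"
  using pullback_affine[OF linear_rho, of 0 f] by simp

lemma pullback_group_mult: "pullback (group_mult g) \<omega> = (\<lambda>p. lpullback (frame g) (\<omega> (group_mult g p)))"
  using pullback_affine[OF linear_frame[of g], of g \<omega>] by (simp add: group_mult_eq_frame[abs_def])

interpretation orbifold: affine_invariance "insert rho (group_mult ` lattice)"
proof
  have "rho = (\<lambda>p. 0 + rho p)" "group_mult g = (\<lambda>p. g + frame g p)" for g
    by (simp_all add: group_mult_eq_frame[abs_def])
  then show "is_affine \<phi>" if "\<phi> \<in> insert rho (group_mult ` lattice)" for \<phi>
    using that linear_rho linear_frame unfolding is_affine_def by blast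
qed

lemma lpullback_lpullback: "lpullback L (lpullback K f) = lpullback (\<lambda>v. K (L v)) f"
  by (simp add: lpullback_def o_def)

lemma hat_pullback_rho: "hat (pullback rho \<omega>) = pullback rho (hat \<omega>)"
  by (simp add: hat_def pullback_rho lpullback_lpullback rho_frame)

lemma hat_group_mult: "hat \<omega> (group_mult g p) = hat (pullback (group_mult g) \<omega>) p"
proof -
  have "frame (group_mult g p) = (\<lambda>v. frame g (frame p v))"
    by (intro ext, simp add: group_mult_eq_frame frame_frame) (simp add: frame_def)
  then show ?thesis by (simp add: hat_def pullback_group_mult lpullback_lpullback)
qed

lemma hat_inject: "hat \<omega> = hat \<eta> \<longleftrightarrow> \<omega> = \<eta>"
  by (metis hat_unhat(2))

definition orbifold_coefficients :: "pt form \<Rightarrow> bool" where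
  "orbifold_coefficients f \<longleftrightarrow> periodic_form f \<and> pullback rho f = f"

lemma carrier_orbifold_forms: "\<omega> \<in> carrier orbifold_forms \<longleftrightarrow> orbifold_coefficients (hat \<omega>)"
proof -
  have "smooth_form \<omega> \<longleftrightarrow> smooth_form (hat \<omega>)"
    using smooth_form_hat smooth_form_unhat[of "hat \<omega>"] by auto
  moreover have "pullback rho \<omega> = \<omega> \<longleftrightarrow> pullback rho (hat \<omega>) = hat \<omega>"
    by (metis hat_inject hat_pullback_rho)
  moreover have "pullback (group_mult g) \<omega> = \<omega> \<longleftrightarrow> (\<forall>p. hat \<omega> (group_mult g p) = hat \<omega> p)" for g
    unfolding hat_inject[symmetric, of "pullback (group_mult g) \<omega>"] hat_group_mult by (rule fun_eq_iff)
  ultimately show ?thesis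
    unfolding orbifold_forms_def orbifold.F_simps orbifold_coefficients_def periodic_form_def by auto
qed

lemma of_degree_hat: "of_degree k (hat \<omega> p) \<longleftrightarrow> of_degree k (\<omega> p)"
proof -
  have "of_degree k (lpullback L f)" if "of_degree k f" for L :: "pt \<Rightarrow> pt" and f
    using that by (simp add: of_degree_def lpullback_def)
  then show ?thesis using fun_cong[OF hat_unhat(2)[of \<omega>], of p]
    unfolding hat_def unhat_def by metis
qed

lemma hcomp_orbifold_forms:
  "\<omega> \<in> hcomp orbifold_forms k \<longleftrightarrow> orbifold_coefficients (hat \<omega>) \<and> (\<forall>p. of_degree k (hat \<omega> p))"
  using carrier_orbifold_forms[of \<omega>]
  unfolding orbifold_forms_def orbifold.F_simps(7) by (auto simp: of_degree_hat)

lemma hat_ext_derivative: "hat (ext_derivative \<omega>) = frame_d (hat \<omega>)"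
  by (simp add: frame_d_def)

lemma frame_d_pullback_rho:
  assumes "smooth_form f"
  shows "frame_d (pullback rho f) = pullback rho (frame_d f)"
proof -
  have "unhat (pullback rho f) = pullback rho (unhat f)"
    by (metis hat_pullback_rho hat_unhat)
  moreover have "ext_derivative (pullback rho (unhat f)) = pullback rho (ext_derivative (unhat f))"
    using pullback_laws(3)[OF orbifold.affine smooth_form_unhat[OF assms], of rho] by simp
  ultimately show ?thesis by (simp add: frame_d_def hat_pullback_rho)
qed

lemma frame_d_degree_part: "frame_d (degree_part k f) = degree_part (Suc k) (frame_d f)"
proof -
  have "ext_derivative (degree_part k \<omega>) = degree_part (Suc k) (ext_derivative \<omega>)" for \<omega> :: "pt form"
  proof (intro ext)
    fix p :: pt and vs :: "pt list"
    have "length (take i vs @ drop (Suc i) vs) = k \<longleftrightarrow> length vs = Suc k" if "i < length vs" for i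
      using that by auto
    then show "ext_derivative (degree_part k \<omega>) p vs = degree_part (Suc k) (ext_derivative \<omega>) p vs"
      by (auto simp: ext_derivative_def degree_part_def intro!: sum.cong sum.neutral)
  qed
  moreover have "hat (degree_part k f) = degree_part k (hat f)" "unhat (degree_part k f) = degree_part k (unhat f)" for k f
    by (simp_all add: hat_def unhat_def lpullback_def degree_part_def)
  ultimately show ?thesis by (simp add: frame_d_def)
qed

lemma periodic_form_degree_part:
  assumes "periodic_form f"
  shows "periodic_form (degree_part k f)"
  using assms smooth_form_degree_part[of f k] by (auto simp: periodic_form_def) (simp add: degree_part_def fun_eq_iff)

lemma periodic_form_pullback_rho:
  assumes "periodic_form f"
  shows "periodic_form (pullback rho f)"
proof -
  have "pullback rho f (group_mult g p) = pullback rho f p" if "g \<in> lattice" for g p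
    using assms rho_lattice[OF that] by (simp add: pullback_rho rho_group_mult periodic_form_def)
  moreover have "smooth_form (pullback rho f)"
    using pullback_laws(2)[OF orbifold.affine periodic_form_smooth[OF assms], of rho] by simp
  ultimately show ?thesis by (simp add: periodic_form_def)
qed

lemma closed_orbifold_form_cohomologous_const:
  assumes f: "orbifold_coefficients f" and deg: "\<And>p. of_degree (Suc k) (f p)" and closed: "frame_d f = (\<lambda>p. 0)"
  obtains c h where "alternating c" "of_degree (Suc k) c" "lpullback rho c = c" "frame_d (\<lambda>p. c) = (\<lambda>p. 0)"
    "periodic_form h" "f = (\<lambda>p. c + frame_d h p)"
proof -
  have fp: "periodic_form f" "pullback rho f = f" using f by (auto simp: orbifold_coefficients_def)
  obtain c0 h0 where c0: "alternating c0" "periodic_form h0" "f = (\<lambda>p. c0 + frame_d h0 p)"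
    using closed_form_cohomologous_const[OF fp(1) closed] .
  define c1 where "c1 = degree_part (Suc k) (\<lambda>p. c0) 0"
  define h1 where "h1 = degree_part k h0"
  have c1: "(\<lambda>p. c1) = degree_part (Suc k) (\<lambda>p. c0)" by (simp add: c1_def degree_part_def)
  have h1: "periodic_form h1" unfolding h1_def by (rule periodic_form_degree_part[OF c0(2)])
  have alt1: "alternating c1"
    using smooth_formD(1)[OF smooth_form_degree_part[OF smooth_form_const[OF c0(1)]]] by (simp add: c1_def)
  have "degree_part (Suc k) f = f"
    using deg by (auto simp: degree_part_def of_degree_def fun_eq_iff)
  then have "f p vs = degree_part (Suc k) (\<lambda>p. c0 + frame_d h0 p) p vs" for p vs using c0(3) by simp
  then have f1: "f = (\<lambda>p. c1 + frame_d h1 p)"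
    unfolding h1_def frame_d_degree_part c1_def by (intro ext) (simp add: degree_part_def)
  let ?r = "lpullback rho" and ?R = "pullback rho"
  have radd: "?r (f + g) = ?r f + ?r g" for f g :: "pt list \<Rightarrow> real" by (simp add: lpullback_def fun_eq_iff)
  have step: "f = (\<lambda>p. ?r c + frame_d (?R h) p)" if "f = (\<lambda>p. c + frame_d h p)" "periodic_form h" for c h
  proof -
    have "f = ?R (\<lambda>p. c + frame_d h p)" using fp(2) that(1) by simp
    then show ?thesis
      unfolding frame_d_pullback_rho[OF periodic_form_smooth[OF that(2)]] by (simp add: pullback_rho radd)
  qed
  define c where "c = scale (1/3) (c1 + (?r c1 + ?r (?r c1)))"
  define h where "h = (\<lambda>p. scale (1/3) (h1 p + (?R h1 p + ?R (?R h1) p)))"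
  have h2: "periodic_form (?R h1)" by (rule periodic_form_pullback_rho[OF h1])
  have h3: "periodic_form (?R (?R h1))" by (rule periodic_form_pullback_rho[OF h2])
  note f2 = step[OF f1 h1]
  note f3 = step[OF f2 h2]
  note s = h1[THEN periodic_form_smooth] h2[THEN periodic_form_smooth] h3[THEN periodic_form_smooth]
  have dh: "frame_d h = (\<lambda>p. scale (1/3) (frame_d h1 p + (frame_d (?R h1) p + frame_d (?R (?R h1)) p)))"
    unfolding h_def by (simp only: frame_d_scale frame_d_add smooth_form_add smooth_form_scale s)
  have "f p vs = (c + frame_d h p) vs" for p vs
    using fun_cong[OF fun_cong[OF f1, of p], of vs] fun_cong[OF fun_cong[OF f2, of p], of vs]
      fun_cong[OF fun_cong[OF f3, of p], of vs] by (simp add: c_def dh field_simps)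
  then have fc: "f = (\<lambda>p. c + frame_d h p)" by (intro ext) simp
  have alt: "alternating c"
    unfolding c_def by (intro alternating_scale alternating_add alternating_lpullback alt1 linear_rho)
  have hp: "periodic_form h" unfolding h_def by (intro periodic_form_scale periodic_form_add h1 h2 h3)
  have rc: "?r c = c"
    by (simp add: c_def lpullback_def fun_eq_iff o_def rho_rho_rho)
  have "c1 vs = 0" if "length vs \<noteq> Suc k" for vs using that by (simp add: c1_def degree_part_def)
  then have dc: "of_degree (Suc k) c" by (simp add: of_degree_def c_def lpullback_def)
  have "frame_d (\<lambda>p. c + frame_d h p) = (\<lambda>p. 0)" using closed fc by simp
  then have "frame_d (\<lambda>p. c) = (\<lambda>p. 0)"
    by (simp add: frame_d_add smooth_form_const alt smooth_form_frame_d periodic_form_smooth[OF hp] frame_d_frame_d)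
  from that[OF alt dc rc this hp fc] show ?thesis .
qed

section \<open>Left invariant forms\<close>

definition delta :: "(pt list \<Rightarrow> real) \<Rightarrow> pt list \<Rightarrow> real" where
  "delta c = frame_d (\<lambda>p. c) 0"

lemma contract_frame_d_const:
  assumes "alternating c"
  shows "contract v (frame_d (\<lambda>p. c) p) = - vert (brk v) c - frame_d (\<lambda>p. contract v c) p"
  using contract_frame_d[OF smooth_form_const[OF assms], of v p] by (simp add: fun_eq_iff)

lemma frame_d_const:
  assumes "alternating c"
  shows "frame_d (\<lambda>p. c) = (\<lambda>p. delta c)"
proof (intro ext)
  fix p vs
  show "frame_d (\<lambda>p. c) p vs = delta c vs" using assms
  proof (induction vs arbitrary: c)
    case (Cons v vs)
    have "frame_d (\<lambda>p. c) q (v # vs) = - vert (brk v) c vs - frame_d (\<lambda>p. contract v c) q vs" for q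
      using fun_cong[OF contract_frame_d_const[OF Cons.prems, of v q], of vs]
      by (simp add: contract_def[of v "frame_d _ _"])
    then show ?case using Cons.IH[OF alternating_contract[OF Cons.prems]] by (simp add: delta_def)
  qed (simp add: delta_def)
qed

lemma contract_delta: "alternating c \<Longrightarrow> contract v (delta c) = - vert (brk v) c - delta (contract v c)"
  by (simp add: delta_def contract_frame_d_const)

lemma delta_Nil [simp]: "delta c [] = 0"
  by (simp add: delta_def)

lemma delta_Cons:
  "alternating c \<Longrightarrow> delta c (v # vs) = - vert (brk v) c vs - delta (contract v c) vs"
  using fun_cong[OF contract_delta[of c v], of vs] by (simp add: contract_def[of v "delta c"])

lemma delta_add: "alternating c \<Longrightarrow> alternating e \<Longrightarrow> delta (c + e) = delta c + delta e"
  by (simp add: delta_def frame_d_add smooth_form_const)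

lemma delta_scale: "alternating c \<Longrightarrow> delta (scale r c) = scale r (delta c)"
  by (simp add: delta_def frame_d_scale smooth_form_const)

lemma delta_uminus: "alternating c \<Longrightarrow> delta (- c) = - delta c"
  using delta_scale[of c "-1"] by (simp add: fun_Compl_def)

lemma alternating_diff: "alternating f \<Longrightarrow> alternating g \<Longrightarrow> alternating (f - g)"
  using alternating_add[of f "- g"] alternating_uminus[of g] by simp

lemma delta_diff: "alternating c \<Longrightarrow> alternating e \<Longrightarrow> delta (c - e) = delta c - delta e"
  using delta_add[of c "- e"] by (simp add: alternating_uminus delta_uminus)

lemma delta_lwedge:
  "alternating c \<Longrightarrow> alternating e \<Longrightarrow>
    delta (lwedge c e) = lwedge (delta c) e + lwedge (grading_sign c) (delta e)"
  by (simp add: delta_def frame_d_lwedge smooth_form_const)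

lemma alternating_delta: "alternating c \<Longrightarrow> alternating (delta c)"
  using smooth_formD(1)[OF smooth_form_frame_d[OF smooth_form_const]] by (simp add: delta_def)

lemma delta_delta: "alternating c \<Longrightarrow> delta (delta c) = 0"
  using fun_cong[OF frame_d_frame_d[OF smooth_form_const], of c 0] by (simp add: frame_d_const) (simp add: delta_def)

lemma delta_vertical:
  assumes "alternating c"
  shows "delta c (vdir V1 # vdir V2 # vs) = 0"
proof -
  have "delta c vs = 0" if "alternating c" "contract (vdir V1) c = 0" "contract (vdir V2) c = 0" for c vs
    using that
  proof (induction vs arbitrary: c)
    case (Cons v vs)
    have "contract w (contract v c) = 0" if "contract w c = 0" for w
      unfolding alternating_contract_contract[OF Cons.prems(1), of w v] that contract_zero by simp
    from this[OF Cons.prems(2)] this[OF Cons.prems(3)] have "delta (contract v c) vs = 0"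
      by (intro Cons.IH alternating_contract Cons.prems(1))
    then show ?case using Cons.prems
      by (simp add: delta_Cons vert_def lwedge_zero_right[unfolded zero_fun_def])
  qed simp
  moreover have "vert (brk (vdir k)) f = 0" if "k \<in> {V1, V2}" for k f
  proof -
    have "one_form (brk (vdir k) j) = 0" for j
      using that by (auto simp: brk_def one_form_def fun_eq_iff split: list.splits)
    then show ?thesis by (simp add: vert_def)
  qed
  moreover have "contract (vdir V1) (contract (vdir V2) (contract (vdir V1) c)) = 0"
    unfolding alternating_contract_contract[OF assms, of "vdir V2" "vdir V1"] contract_uminus
      alternating_contract_twice[OF alternating_contract[OF assms]] by simp
  moreover have "contract (vdir V2) (contract (vdir V2) (contract (vdir V1) c)) = 0"
    by (rule alternating_contract_twice[OF alternating_contract[OF assms]])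
  ultimately show ?thesis
    using assms by (simp add: delta_Cons alternating_contract)
qed

abbreviation E :: "coord \<Rightarrow> pt list \<Rightarrow> real" where
  "E c \<equiv> one_form (\<lambda>v. v $ c)"

notation lwedge (infixr "\<cdot>" 75)

lemma alternating_E [simp]: "alternating (E c)"
  by (rule alternating_one_form) (simp add: linear_iff)

lemma one_form_single [simp]: "one_form \<beta> [v] = \<beta> v" "one_form \<beta> (v # w # vs) = 0"
  by (simp_all add: one_form_def)

lemma two_form_eqI:
  assumes "f [] = g []" "\<And>v. f [v] = g [v]" "\<And>v w. f [v, w] = g [v, w]"
    "\<And>u v w vs. f (u # v # w # vs) = g (u # v # w # vs)"
  shows "f = g"
proof
  show "f vs = g vs" for vs
  proof (cases vs)
    case (Cons u us)
    then show ?thesis using assms by (cases us; cases "tl us") auto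
  qed (simp add: assms)
qed

lemma delta_E:
  "c \<notin> {V1, V2} \<Longrightarrow> delta (E c) = 0"
  "delta (E V1) = E Y2 \<cdot> E Z1 + E Y1 \<cdot> E Z2 + E Y2 \<cdot> E Z2 + E Y2 \<cdot> E Z2 - E Y1 \<cdot> E Z1"
  "delta (E V2) = E Y1 \<cdot> E Z1 + E Y1 \<cdot> E Z1 + E Y2 \<cdot> E Z1 + E Y1 \<cdot> E Z2 - E Y2 \<cdot> E Z2"
proof -
  have u: "delta (scale r unit_form) = 0" for r :: real
  proof
    show "delta (scale r unit_form) vs = 0 vs" for vs
    proof (cases vs)
      case (Cons v ws)
      have "contract w (scale r unit_form) = (0 :: pt list \<Rightarrow> real)" for w
        by (simp add: contract_scale) (simp add: fun_eq_iff)
      moreover have "delta 0 = 0" using delta_scale[OF alternating_zero, of 0] by (simp add: zero_fun_def)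
      ultimately show ?thesis
        using Cons by (simp add: delta_Cons alternating_scale vert_def)
    qed simp
  qed
  have d: "delta (E c) (v # vs) = - vert (brk v) (E c) vs" for c v vs
    by (simp add: delta_Cons u)
  show "delta (E c) = 0" if "c \<notin> {V1, V2}"
  proof
    show "delta (E c) vs = 0 vs" for vs
      using that by (cases vs) (auto simp: d vert_def axis_def lwedge_zero_right[unfolded zero_fun_def])
  qed
  show "delta (E V1) = E Y2 \<cdot> E Z1 + E Y1 \<cdot> E Z2 + E Y2 \<cdot> E Z2 + E Y2 \<cdot> E Z2 - E Y1 \<cdot> E Z1"
    "delta (E V2) = E Y1 \<cdot> E Z1 + E Y1 \<cdot> E Z1 + E Y2 \<cdot> E Z1 + E Y1 \<cdot> E Z2 - E Y2 \<cdot> E Z2"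
    by (rule two_form_eqI; simp add: d vert_def axis_def lwedge_scale_right one_form_lwedge_Cons
        lwedge_zero_right[unfolded zero_fun_def]; simp add: brk_def sig_def algebra_simps)+
qed

primrec rank :: "coord \<Rightarrow> nat" where
  "rank V1 = 0" | "rank V2 = 1" | "rank X1 = 2" | "rank X2 = 3"
| "rank Y1 = 4" | "rank Y2 = 5" | "rank Z1 = 6" | "rank Z2 = 7"

lemma E_commute: "E a \<cdot> E b = - (E b \<cdot> E a)"
  using lwedge_commute[OF of_degree_one_form of_degree_one_form, of "\<lambda>v. v $ a" "\<lambda>v. v $ b"]
  by (simp add: fun_Compl_def)

lemma E_square: "E a \<cdot> E a = 0"
proof -
  have "(E a \<cdot> E a) vs = 0" for vs using fun_cong[OF E_commute[of a a], of vs] by simp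
  then show ?thesis by (simp add: fun_eq_iff)
qed

lemma E_left_commute: "E a \<cdot> E b \<cdot> f = - (E b \<cdot> E a \<cdot> f)"
  by (metis E_commute lwedge_assoc lwedge_uminus_left)

lemma E_left_square: "E a \<cdot> E a \<cdot> f = 0"
  by (metis E_square lwedge_assoc lwedge_zero_left)

lemma E_sort:
  "rank b < rank a \<Longrightarrow> E a \<cdot> E b = - (E b \<cdot> E a)"
  "rank b < rank a \<Longrightarrow> E a \<cdot> E b \<cdot> f = - (E b \<cdot> E a \<cdot> f)"
  by (rule E_commute E_left_commute)+

lemma fun_numeral_mult: "numeral n * (f :: 'v list \<Rightarrow> real) = scale (numeral n) f"
  by (simp add: fun_eq_iff)

lemma numeral_mult_rules:
  fixes f :: "pt list \<Rightarrow> real"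
  shows "lwedge (numeral n * f) g = numeral n * lwedge f g" "lwedge f (numeral n * g) = numeral n * lwedge f g"
    "lpullback L (numeral n * f) = numeral n * lpullback L f" "(numeral n * f) vs = numeral n * f vs"
    "alternating f \<Longrightarrow> alternating (numeral n * f)"
    "alternating f \<Longrightarrow> delta (numeral n * f) = numeral n * delta f"
  by (simp_all only: fun_numeral_mult lwedge_scale_left lwedge_scale_right alternating_scale delta_scale)
    (simp_all add: lpullback_def)

lemmas exterior_simps = lwedge_assoc lwedge_add_left lwedge_add_right lwedge_diff_left
  lwedge_diff_right lwedge_uminus_left lwedge_uminus_right E_sort E_square E_left_square
  numeral_mult_rules

lemma lpullback_linear:
  "lpullback L (f + g) = lpullback L f + lpullback L g"
  "lpullback L (f - g) = lpullback L f - lpullback L g"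
  "lpullback L (- f) = - lpullback L f"
  "lpullback L (scale r f) = scale r (lpullback L f)"
  by (simp_all add: lpullback_def fun_eq_iff)

lemma lpullback_rho_E [simp]:
  "lpullback rho (E X1) = - E X1 - E X2" "lpullback rho (E X2) = E X1"
  "lpullback rho (E Y1) = - E Y1 - E Y2" "lpullback rho (E Y2) = E Y1"
  "lpullback rho (E Z1) = - E Z1 - E Z2" "lpullback rho (E Z2) = E Z1"
  "lpullback rho (E V1) = - E V1 - E V2" "lpullback rho (E V2) = E V1"
  unfolding lpullback_one_form by (auto simp: one_form_def fun_eq_iff split: list.splits)

lemmas alternating_intros = alternating_E alternating_add alternating_diff alternating_uminus
  alternating_scale alternating_lwedge alternating_delta numeral_mult_rules(5)

lemma delta_lwedge_E: "alternating f \<Longrightarrow> delta (E a \<cdot> f) = delta (E a) \<cdot> f - E a \<cdot> delta f"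
  by (simp add: delta_lwedge lwedge_uminus_left)

lemmas delta_simps = delta_lwedge_E delta_E delta_add delta_diff delta_scale numeral_mult_rules(6) alternating_intros

definition vanish :: "(pt list \<Rightarrow> real) \<Rightarrow> pt \<Rightarrow> pt \<Rightarrow> pt \<Rightarrow> bool" where
  "vanish c u v w \<longleftrightarrow> c [u, v, w] = 0 \<and> c [rho u, v, w] = 0"

context
  fixes c :: "pt list \<Rightarrow> real"
  assumes alt: "alternating c" and inv: "lpullback rho c = c"
begin

lemma three_linear:
  "c [u + u', v, w] = c [u, v, w] + c [u', v, w]" "c [u, v + v', w] = c [u, v, w] + c [u, v', w]"
  "c [u, v, w + w'] = c [u, v, w] + c [u, v, w']"
  "c [u - u', v, w] = c [u, v, w] - c [u', v, w]" "c [u, v - v', w] = c [u, v, w] - c [u, v', w]"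
  "c [u, v, w - w'] = c [u, v, w] - c [u, v, w']"
  "c [- u, v, w] = - c [u, v, w]" "c [u, - v, w] = - c [u, v, w]" "c [u, v, - w] = - c [u, v, w]"
proof -
  have l: "linear (\<lambda>v. c (us @ v # vs))" for us vs using alt by (simp add: alternating_def)
  note s = linear_add linear_diff linear_neg
  show "c [u + u', v, w] = c [u, v, w] + c [u', v, w]" "c [u - u', v, w] = c [u, v, w] - c [u', v, w]"
    "c [- u, v, w] = - c [u, v, w]" using s[OF l[of "[]" "[v, w]"]] by simp_all
  show "c [u, v + v', w] = c [u, v, w] + c [u, v', w]" "c [u, v - v', w] = c [u, v, w] - c [u, v', w]"
    "c [u, - v, w] = - c [u, v, w]" using s[OF l[of "[u]" "[w]"]] by simp_all
  show "c [u, v, w + w'] = c [u, v, w] + c [u, v, w']" "c [u, v, w - w'] = c [u, v, w] - c [u, v, w']"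
    "c [u, v, - w] = - c [u, v, w]" using s[OF l[of "[u, v]" "[]"]] by simp_all
qed

lemma three_swap: "c [v, u, w] = - c [u, v, w]" "c [u, w, v] = - c [u, v, w]"
proof -
  have m: "multilinear c" "\<And>us v vs. c (us @ v # v # vs) = 0" using alt by (simp_all add: alternating_iff)
  show "c [v, u, w] = - c [u, v, w]" "c [u, w, v] = - c [u, v, w]"
    using adjacent_swap[OF m, of "[]" v u "[w]"] adjacent_swap[OF m, of "[u]" w v "[]"] by simp_all
qed

lemma three_invariant: "c [rho u, rho v, rho w] = c [u, v, w]"
  using fun_cong[OF inv, of "[u, v, w]"] by (simp add: lpullback_def)

lemma three_move: "c [u, rho v, w] = c [rho u, v, w]" "c [u, v, rho w] = c [rho u, v, w]"
  using three_invariant[of u v w] three_invariant[of "rho u" v w] three_invariant[of u "rho v" w]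
    three_invariant[of u v "rho w"] three_invariant[of "rho u" "rho v" w]
    three_invariant[of "rho u" v "rho w"] three_invariant[of u "rho v" "rho w"]
  by (simp_all add: rho_rho three_linear)

lemma vanish_swap: "vanish c u v w \<Longrightarrow> vanish c v u w" "vanish c u v w \<Longrightarrow> vanish c u w v"
  using three_swap[of u v w] three_swap[of "rho u" v w] three_swap[of u "rho v" w] three_move(1)[of u v w]
  unfolding vanish_def by auto

lemma vanish_repeat: "vanish c u u w"
  using three_swap(1)[of u u w] three_swap(1)[of u "rho u" w] three_move(1)[of u u w]
  unfolding vanish_def by auto

end

lemma second_axis:
  "axis X2 1 = axis X1 1 + rho (axis X1 1)" "axis Y2 1 = axis Y1 1 + rho (axis Y1 1)"
  "axis Z2 1 = axis Z1 1 + rho (axis Z1 1)" "axis V2 1 = axis V1 1 + rho (axis V1 1)"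
  by (simp_all add: vec_eq_coord axis_def)

lemma linear_eq_zero:
  fixes f :: "pt \<Rightarrow> real"
  assumes "linear f" "\<And>a. a \<in> {X1, Y1, Z1, V1} \<Longrightarrow> f (axis a 1) = 0 \<and> f (rho (axis a 1)) = 0"
  shows "f v = 0"
proof -
  have "f (axis a 1) = 0" for a
    using assms(2) by (cases a) (simp_all add: second_axis linear_add[OF assms(1)])
  moreover have "(\<Sum>a\<in>UNIV. (v $ a) *\<^sub>R axis a 1) = v"
    by (simp add: vec_eq_iff axis_def if_distrib sum.delta cong: if_cong)
  moreover have "f (\<Sum>a\<in>UNIV. (v $ a) *\<^sub>R axis a 1) = (\<Sum>a\<in>UNIV. (v $ a) *\<^sub>R f (axis a 1))"
    by (simp add: linear_sum[OF assms(1)] linear_cmul[OF assms(1)])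
  ultimately show ?thesis by simp
qed

lemma closed_three_form:
  assumes "alternating c" "delta c = 0"
  shows "0 = (\<Sum>k\<in>{V1, V2}. brk a k b * c [vdir k, u, t] - brk a k u * c [vdir k, b, t] + brk a k t * c [vdir k, b, u]
     + brk b k u * c [vdir k, a, t] - brk b k t * c [vdir k, a, u] + brk u k t * c [vdir k, a, b])"
proof -
  have s: "c [a, vdir k, t] = - c [vdir k, a, t]" "c [a, b, vdir k] = c [vdir k, a, b]" for k a b t
  proof -
    have m: "multilinear c" "\<And>us v vs. c (us @ v # v # vs) = 0" using assms(1) by (simp_all add: alternating_iff)
    show "c [a, vdir k, t] = - c [vdir k, a, t]" "c [a, b, vdir k] = c [vdir k, a, b]"
      using adjacent_swap[OF m, of "[]" a "vdir k" "[t]"] adjacent_swap[OF m, of "[a]" b "vdir k" "[]"]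
        adjacent_swap[OF m, of "[]" a "vdir k" "[b]"] by simp_all
  qed
  have "delta c [a, b, u, t] = 0" using assms(2) by simp
  then show ?thesis
    by (simp add: delta_Cons assms(1) alternating_contract vert_def one_form_lwedge_Cons)
      (simp add: contract_def s algebra_simps)
qed

lemma invariant_closed_three_form_vanishes:
  assumes alt: "alternating c" and deg: "of_degree 3 c" and inv: "lpullback rho c = c" and closed: "delta c = 0"
    and X: "c [axis X1 1, axis Y1 1, axis Z1 1] = 0" "c [axis X2 1, axis Y1 1, axis Z1 1] = 0"
    and V: "c [axis V1 1, axis Y1 1, axis Z1 1] = 0"
  shows "c = 0"
proof -
  note lin = three_linear[OF alt inv] and move = three_move[OF alt inv]
  note cl = closed_three_form[OF alt closed]
  let ?v = "\<lambda>a b d. vanish c (axis a 1) (axis b 1) (axis d 1)"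
  have xyz: "?v X1 Y1 Z1" using X by (simp add: vanish_def second_axis lin)
  have nth: "(axis a 1 :: pt) $ b = (if b = a then 1 else 0)" for a b by (simp add: axis_def)
  have vxy: "?v V1 X1 Y1"
    using cl[of "axis Y1 1" "axis Y2 1" "axis Z1 1" "axis X1 1"] cl[of "axis Y1 1" "axis Y2 1" "axis Z2 1" "axis X1 1"]
    by (simp add: vanish_def brk_def sig_def nth) (simp add: second_axis lin move rho_rho linear_add[OF linear_rho] linear_neg[OF linear_rho] three_swap(2)[OF alt inv, of _ "axis X1 1" "axis Y1 1"])
  have vxz: "?v V1 X1 Z1"
    using cl[of "axis Z1 1" "axis Z2 1" "axis Y1 1" "axis X1 1"] cl[of "axis Z1 1" "axis Z2 1" "axis Y2 1" "axis X1 1"]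
    by (simp add: vanish_def brk_def sig_def nth) (simp add: second_axis lin move rho_rho linear_add[OF linear_rho] linear_neg[OF linear_rho] three_swap(2)[OF alt inv, of _ "axis X1 1" "axis Z1 1"])
  have vyz: "?v V1 Y1 Z1"
    using V cl[of "axis Y1 1" "axis Y2 1" "axis Z1 1" "axis Z2 1"]
    by (simp add: vanish_def brk_def sig_def nth) (simp add: second_axis lin move rho_rho linear_add[OF linear_rho] linear_neg[OF linear_rho])
  have perm: "vanish c u w v \<and> vanish c v u w \<and> vanish c v w u \<and> vanish c w u v \<and> vanish c w v u"
    if "vanish c u v w" for u v w using that by (metis vanish_swap[OF alt inv])
  have rep: "vanish c u u v" "vanish c u v u" "vanish c v u u" for u v
    using vanish_repeat[OF alt inv, of u v] perm[of u u v] by auto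
  have "?v a b d" if "a \<in> {X1, Y1, Z1, V1}" "b \<in> {X1, Y1, Z1, V1}" "d \<in> {X1, Y1, Z1, V1}" for a b d
    using that xyz vxy vxz vyz by (auto simp: rep perm[OF xyz] perm[OF vxy] perm[OF vxz] perm[OF vyz])
  then have z: "c [axis a 1, axis b 1, axis d 1] = 0 \<and> c [rho (axis a 1), axis b 1, axis d 1] = 0"
    if "a \<in> {X1, Y1, Z1, V1}" "b \<in> {X1, Y1, Z1, V1}" "d \<in> {X1, Y1, Z1, V1}" for a b d
    using that unfolding vanish_def by blast
  have l: "linear (\<lambda>v. c (us @ v # vs))" for us vs using alt by (simp add: alternating_def)
  have 1: "c [u, axis b 1, axis d 1] = 0" if "b \<in> {X1, Y1, Z1, V1}" "d \<in> {X1, Y1, Z1, V1}" for u b d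
    using linear_eq_zero[OF l[of "[]" "[axis b 1, axis d 1]"], of u] z that by simp
  have 2: "c [u, v, axis d 1] = 0" if "d \<in> {X1, Y1, Z1, V1}" for u v d
    using linear_eq_zero[OF l[of "[u]" "[axis d 1]"], of v] 1 that by (simp add: move)
  have 3: "c [u, v, w] = 0" for u v w
    using linear_eq_zero[OF l[of "[u, v]" "[]"], of w] 2 by (simp add: move)
  have "c vs = 0" for vs
  proof (cases "length vs = 3")
    case True
    then show ?thesis using 3 by (auto simp: numeral_3_eq_3 length_Suc_conv)
  qed (use deg in \<open>simp add: of_degree_def\<close>)
  then show ?thesis by (simp add: fun_eq_iff)
qed

lemma of_degree_add: "of_degree k f \<Longrightarrow> of_degree k g \<Longrightarrow> of_degree k (f + g)"
  and of_degree_diff: "of_degree k f \<Longrightarrow> of_degree k g \<Longrightarrow> of_degree k (f - g)"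
  and of_degree_uminus: "of_degree k f \<Longrightarrow> of_degree k (- f)"
  and of_degree_scale: "of_degree k f \<Longrightarrow> of_degree k (scale r f)"
  and of_degree_numeral_mult: "of_degree k f \<Longrightarrow> of_degree k (numeral n * f)"
  by (simp_all add: of_degree_def fun_numeral_mult)

lemma of_degree_EE: "of_degree 2 (E a \<cdot> E b)" "of_degree 3 (E a \<cdot> E b \<cdot> E c)"
  using of_degree_lwedge[OF of_degree_one_form of_degree_one_form, of "\<lambda>v. v $ a" "\<lambda>v. v $ b"]
    of_degree_lwedge[OF of_degree_one_form of_degree_lwedge[OF of_degree_one_form of_degree_one_form],
      of "\<lambda>v. v $ a" "\<lambda>v. v $ b" "\<lambda>v. v $ c"]
  by (simp_all add: numeral_eq_Suc)

lemmas of_degree_intros = of_degree_add of_degree_diff of_degree_scale of_degree_numeral_mult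
  of_degree_EE of_degree_uminus

lemma invariant_closed_three_form_exact:
  assumes alt: "alternating c" and deg: "of_degree 3 c" and inv: "lpullback rho c = c" and closed: "delta c = 0"
  obtains k where "alternating k" "delta k = c"
proof -
  define Q1 where "Q1 = E V1 \<cdot> E X1 + E V2 \<cdot> E X1 + E V2 \<cdot> E X2"
  define Q2 where "Q2 = E V1 \<cdot> E X2 - E V2 \<cdot> E X1"
  define Q3 where "Q3 = E V1 \<cdot> E V2"
  note Q = Q1_def Q2_def Q3_def
  have aQ: "alternating Q1" "alternating Q2" "alternating Q3"
    unfolding Q by (intro alternating_intros)+
  have rQ: "lpullback rho (delta Q1) = delta Q1" "lpullback rho (delta Q2) = delta Q2"
    "lpullback rho (delta Q3) = delta Q3"
    unfolding Q by (simp_all add: delta_simps lpullback_linear lpullback_lwedge exterior_simps)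
  have dQ: "of_degree 3 (delta Q1)" "of_degree 3 (delta Q2)" "of_degree 3 (delta Q3)"
    unfolding Q by (simp_all add: delta_simps exterior_simps of_degree_intros)
  have nth: "(axis a 1 :: pt) $ b = (if b = a then 1 else 0)" for a b by (simp add: axis_def)
  let ?val = "\<lambda>f a. f [axis a 1, axis Y1 1, axis Z1 1]"
  have vQ: "?val (delta Q1) X1 = 1" "?val (delta Q1) X2 = 2" "?val (delta Q1) V1 = 0"
    "?val (delta Q2) X1 = -2" "?val (delta Q2) X2 = -1" "?val (delta Q2) V1 = 0"
    "?val (delta Q3) X1 = 0" "?val (delta Q3) X2 = 0" "?val (delta Q3) V1 = -2"
    unfolding Q by (simp_all add: delta_simps exterior_simps)
      (simp_all add: one_form_lwedge_Cons contract_one_form_lwedge lwedge_scale_right nth)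
  define k where "k = scale ((2 * ?val c X2 - ?val c X1) / 3) Q1 +
    (scale ((?val c X2 - 2 * ?val c X1) / 3) Q2 + scale (- ?val c V1 / 2) Q3)"
  have ak: "alternating k" unfolding k_def by (intro alternating_intros aQ)
  have dk: "delta k = scale ((2 * ?val c X2 - ?val c X1) / 3) (delta Q1) +
    (scale ((?val c X2 - 2 * ?val c X1) / 3) (delta Q2) + scale (- ?val c V1 / 2) (delta Q3))"
    unfolding k_def by (simp only: delta_add delta_scale alternating_add alternating_scale aQ)
  have "c - delta k = 0"
  proof (rule invariant_closed_three_form_vanishes)
    show "alternating (c - delta k)" by (intro alternating_intros alt ak)
    show "of_degree 3 (c - delta k)" using deg dQ by (simp add: of_degree_def dk)
    show "lpullback rho (c - delta k) = c - delta k"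
      unfolding lpullback_linear inv dk by (simp only: lpullback_linear rQ)
    show "delta (c - delta k) = 0"
      by (simp add: delta_diff alt alternating_delta ak closed delta_delta)
  qed (simp_all add: dk vQ field_simps)
  with that[OF ak] show ?thesis by simp
qed

definition "form_a = E Z1 \<cdot> E Z2"
definition "form_b = E Y1 \<cdot> E Y2"
definition "form_c = E X1 \<cdot> E Z1 + E X2 \<cdot> E Z1 + E X2 \<cdot> E Z2"
definition "form_t = E X1 \<cdot> E Z1 + 2 * (E X1 \<cdot> E Z2) - E X2 \<cdot> E Z1 + E X2 \<cdot> E Z2"
definition "raw_ab = E V1 \<cdot> (E Y1 \<cdot> E Z2 + E Y2 \<cdot> E Z1 + E Y2 \<cdot> E Z2) +
  E V2 \<cdot> (E Y1 \<cdot> E Z1 + E Y1 \<cdot> E Z2 + E Y2 \<cdot> E Z1)"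
definition "raw_bc = E V1 \<cdot> (E X1 \<cdot> E Y1 + E X1 \<cdot> E Y2 + E X2 \<cdot> E Y1) +
  E V2 \<cdot> (E X1 \<cdot> E Y1 - E X2 \<cdot> E Y2)"
definition "prim_ab = scale (1/6) raw_ab"
definition "prim_bc = scale (1/3) raw_bc"

lemmas form_defs = form_a_def form_b_def form_c_def form_t_def raw_ab_def raw_bc_def

lemma alternating_raw: "alternating form_a" "alternating form_b" "alternating form_c" "alternating form_t"
  "alternating raw_ab" "alternating raw_bc"
  unfolding form_defs by (intro alternating_intros)+

lemmas alternating_forms = alternating_raw(1-4) alternating_scale[OF alternating_raw(5), of "1/6", folded prim_ab_def]
  alternating_scale[OF alternating_raw(6), of "1/3", folded prim_bc_def]

lemma rho_forms:
  "lpullback rho form_a = form_a" "lpullback rho form_b = form_b" "lpullback rho form_c = form_c"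
  "lpullback rho prim_ab = prim_ab" "lpullback rho prim_bc = prim_bc"
proof -
  have "lpullback rho raw_ab = raw_ab" "lpullback rho raw_bc = raw_bc"
    unfolding form_defs by (simp_all add: lpullback_linear lpullback_lwedge exterior_simps)
  then show "lpullback rho prim_ab = prim_ab" "lpullback rho prim_bc = prim_bc"
    unfolding prim_ab_def prim_bc_def lpullback_linear by simp_all
  show "lpullback rho form_a = form_a" "lpullback rho form_b = form_b" "lpullback rho form_c = form_c"
    unfolding form_defs by (simp_all add: lpullback_linear lpullback_lwedge exterior_simps)
qed

lemma delta_forms: "delta form_a = 0" "delta form_b = 0" "delta form_c = 0" "delta form_t = 0"
  unfolding form_defs by (simp_all add: delta_simps exterior_simps)

lemma delta_prims: "delta prim_ab = form_a \<cdot> form_b" "delta prim_bc = form_b \<cdot> form_c"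
proof -
  have "delta raw_ab = 6 * (form_a \<cdot> form_b)" "delta raw_bc = 3 * (form_b \<cdot> form_c)"
    unfolding form_defs by (simp_all add: delta_simps exterior_simps algebra_simps)
  then show "delta prim_ab = form_a \<cdot> form_b" "delta prim_bc = form_b \<cdot> form_c"
    unfolding prim_ab_def prim_bc_def delta_scale[OF alternating_raw(5)] delta_scale[OF alternating_raw(6)]
    by (simp_all add: numeral_mult_rules(4))
qed

lemma form_products: "form_b \<cdot> form_b = 0" "prim_ab \<cdot> form_b = 0" "form_b \<cdot> prim_bc = 0"
  "form_a \<cdot> form_t = 0" "form_c \<cdot> form_t = 0"
proof -
  have "raw_ab \<cdot> form_b = 0" "form_b \<cdot> raw_bc = 0"
    unfolding form_defs by (simp_all add: exterior_simps)
  then show "prim_ab \<cdot> form_b = 0" "form_b \<cdot> prim_bc = 0"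
    unfolding prim_ab_def prim_bc_def lwedge_scale_left lwedge_scale_right by (simp_all add: fun_eq_iff)
  show "form_b \<cdot> form_b = 0" "form_a \<cdot> form_t = 0" "form_c \<cdot> form_t = 0"
    unfolding form_defs by (simp_all add: exterior_simps)
qed

lemma volume: "(prim_ab \<cdot> prim_bc \<cdot> form_t)
    [vdir V1, vdir V2, axis X1 1, axis X2 1, axis Y1 1, axis Y2 1, axis Z1 1, axis Z2 1] = - 1/3"
proof -
  have nth: "(axis a 1 :: pt) $ b = (if b = a then 1 else 0)" for a b by (simp add: axis_def)
  have "raw_ab \<cdot> raw_bc \<cdot> form_t = - 6 * (E V1 \<cdot> E V2 \<cdot> E X1 \<cdot> E X2 \<cdot> E Y1 \<cdot> E Y2 \<cdot> E Z1 \<cdot> E Z2)"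
    unfolding form_defs by (simp add: exterior_simps algebra_simps)
  then show ?thesis
    unfolding prim_ab_def prim_bc_def lwedge_scale_left lwedge_scale_right
    by (simp add: numeral_mult_rules(4) one_form_lwedge_Cons contract_one_form_lwedge lwedge_scale_right nth)
qed

lemma degree_forms: "of_degree 2 form_a" "of_degree 2 form_b" "of_degree 2 form_c" "of_degree 2 form_t"
  "of_degree 3 prim_ab" "of_degree 3 prim_bc"
  unfolding form_defs prim_ab_def prim_bc_def lwedge_add_right lwedge_diff_right
  by (intro of_degree_intros)+

section \<open>The Massey product\<close>

lemma no_periodic_volume_primitive:
  assumes "periodic_form \<theta>" "frame_d \<theta> = (\<lambda>p. prim_ab \<cdot> prim_bc \<cdot> form_t)"
  shows False
proof -
  obtain k where k: "alternating k" "frame_d (\<lambda>p. k) = (\<lambda>p. prim_ab \<cdot> prim_bc \<cdot> form_t)"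
    using const_primitive[OF assms] .
  then have "delta k = prim_ab \<cdot> prim_bc \<cdot> form_t" by (simp add: delta_def)
  with delta_vertical[OF k(1)] volume show False by simp
qed

lemma closed_orbifold_three_form_exact:
  assumes z: "orbifold_coefficients z" "\<And>p. of_degree 3 (z p)" "frame_d z = (\<lambda>p. 0)"
  obtains \<zeta> where "periodic_form \<zeta>" "\<And>p. of_degree 2 (\<zeta> p)" "frame_d \<zeta> = z"
proof -
  obtain c h where c: "alternating c" "of_degree 3 c" "lpullback rho c = c" "frame_d (\<lambda>p. c) = (\<lambda>p. 0)"
    and h: "periodic_form h" "z = (\<lambda>p. c + frame_d h p)"
    by (rule closed_orbifold_form_cohomologous_const[of z 2]) (use z in \<open>simp_all add: numeral_3_eq_3 numeral_2_eq_2\<close>)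
  have "delta c = 0" using c(4) by (simp add: delta_def)
  then obtain k where k: "alternating k" "delta k = c"
    using invariant_closed_three_form_exact[OF c(1-3)] by blast
  define \<zeta> where "\<zeta> = degree_part 2 (\<lambda>p. k + h p)"
  have "frame_d (\<lambda>p. k + h p) = z"
    by (simp add: h(2) frame_d_add smooth_form_const k periodic_form_smooth[OF h(1)] frame_d_const)
  then have "frame_d \<zeta> = degree_part 3 z" by (simp add: \<zeta>_def frame_d_degree_part)
  also have "\<dots> = z" using z(2) by (auto simp: degree_part_def of_degree_def fun_eq_iff)
  finally have "frame_d \<zeta> = z" .
  moreover have "periodic_form \<zeta>"
    unfolding \<zeta>_def by (intro periodic_form_degree_part periodic_form_add periodic_form_const k h)
  moreover have "of_degree 2 (\<zeta> p)" for p by (simp add: \<zeta>_def degree_part_def of_degree_def)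
  ultimately show ?thesis by (intro that)
qed

lemma orbifold_coefficients_const:
  assumes "alternating c" "lpullback rho c = c"
  shows "orbifold_coefficients (\<lambda>p. c)"
  using assms by (simp add: orbifold_coefficients_def periodic_form_const pullback_rho)

lemma orbifold_coefficients_diff:
  assumes "orbifold_coefficients f" "orbifold_coefficients g"
  shows "orbifold_coefficients (\<lambda>p. f p - g p)"
proof -
  have "periodic_form (\<lambda>p. f p + scale (-1) (g p))"
    using assms by (intro periodic_form_add periodic_form_scale) (simp_all add: orbifold_coefficients_def)
  moreover have "(\<lambda>p. f p + scale (-1) (g p)) = (\<lambda>p. f p - g p)" by (simp add: fun_eq_iff)
  moreover have "lpullback rho (e (rho p)) = e p" if "orbifold_coefficients e" for e p
  proof -
    have "(\<lambda>p. lpullback rho (e (rho p))) = e"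
      using that by (simp add: orbifold_coefficients_def flip: pullback_rho)
    from fun_cong[OF this, of p] show ?thesis .
  qed
  ultimately show ?thesis
    using assms by (simp add: orbifold_coefficients_def[of "\<lambda>p. f p - g p"] pullback_rho lpullback_linear)
qed

lemma even_commute: "of_degree 2 f \<Longrightarrow> of_degree k g \<Longrightarrow> f \<cdot> g = g \<cdot> f"
  using lwedge_commute[of 2 f k g] by simp

lemma no_corner:
  assumes n: "orbifold_coefficients n01" "orbifold_coefficients n23" "periodic_form n03"
    and deg: "\<And>p. of_degree 3 (n01 p)" "\<And>p. of_degree 3 (n23 p)" "\<And>p. of_degree 4 (n13 p)"
    and d01: "frame_d n01 = (\<lambda>p. form_a \<cdot> form_b)" and d23: "frame_d n23 = (\<lambda>p. form_b \<cdot> form_c)"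
    and d03: "\<And>p. frame_d n03 p = form_a \<cdot> n13 p - n01 p \<cdot> n23 p + n02 p \<cdot> form_c"
  shows False
proof -
  note smooth = n(1,2)[unfolded orbifold_coefficients_def periodic_form_def, THEN conjunct1, THEN conjunct1]
  have unique: "\<exists>\<zeta>. periodic_form \<zeta> \<and> (\<forall>p. of_degree 2 (\<zeta> p)) \<and> (\<forall>p. f p = c + frame_d \<zeta> p)"
    if f: "orbifold_coefficients f" "smooth_form f" "\<And>p. of_degree 3 (f p)" "frame_d f = (\<lambda>p. delta c)"
      and c: "alternating c" "of_degree 3 c" "lpullback rho c = c" for f c
  proof -
    have "frame_d (\<lambda>p. f p + scale (-1) c) = (\<lambda>p. 0)"
      using f(2,4) c(1) by (simp only: frame_d_add frame_d_const alternating_scale delta_scale smooth_form_const)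
        (simp add: fun_eq_iff)
    moreover have "(\<lambda>p. f p + scale (-1) c) = (\<lambda>p. f p - c)" by (simp add: fun_eq_iff)
    ultimately have "frame_d (\<lambda>p. f p - c) = (\<lambda>p. 0)" by simp
    moreover have "orbifold_coefficients (\<lambda>p. f p - c)"
      by (intro orbifold_coefficients_diff orbifold_coefficients_const f c)
    moreover have "of_degree 3 (f p - c)" for p by (intro of_degree_diff f c)
    ultimately obtain \<zeta> where \<zeta>: "periodic_form \<zeta>" "\<And>p. of_degree 2 (\<zeta> p)" "frame_d \<zeta> = (\<lambda>p. f p - c)"
      using closed_orbifold_three_form_exact by blast
    then show ?thesis by (intro exI[of _ \<zeta>]) simp
  qed
  obtain \<zeta> where \<zeta>: "periodic_form \<zeta>" "\<And>p. of_degree 2 (\<zeta> p)" "\<And>p. n01 p = prim_ab + frame_d \<zeta> p"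
    using unique[OF n(1) smooth(1) deg(1) _ alternating_forms(5) degree_forms(5) rho_forms(4)] d01
    by (auto simp: delta_prims)
  obtain \<xi> where \<xi>: "periodic_form \<xi>" "\<And>p. of_degree 2 (\<xi> p)" "\<And>p. n23 p = prim_bc + frame_d \<xi> p"
    using unique[OF n(2) smooth(2) deg(2) _ alternating_forms(6) degree_forms(6) rho_forms(5)] d23
    by (auto simp: delta_prims)
  have P: "periodic_form n01" "periodic_form (\<lambda>p. form_t)" "periodic_form (\<lambda>p. prim_bc \<cdot> form_t)"
    using n(1) by (auto simp: orbifold_coefficients_def intro!: periodic_form_const alternating_lwedge alternating_forms)
  note S = P[THEN periodic_form_smooth] n(3)[THEN periodic_form_smooth] \<zeta>(1)[THEN periodic_form_smooth]
    \<xi>(1)[THEN periodic_form_smooth]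
  have "frame_d (\<lambda>p. form_t) = (\<lambda>p. 0)"
    by (simp add: frame_d_const alternating_forms delta_forms)
  note d = frame_d_lwedge[OF S(4,2)] frame_d_lwedge[OF S(6,2)] this
  have e1: "frame_d (\<lambda>p. n03 p \<cdot> form_t) p = frame_d n03 p \<cdot> form_t" for p by (simp add: d)
  have e2: "frame_d (\<lambda>p. \<zeta> p \<cdot> prim_bc \<cdot> form_t) p = frame_d \<zeta> p \<cdot> prim_bc \<cdot> form_t" for p
    by (simp add: frame_d_lwedge[OF S(5,3)] frame_d_const alternating_lwedge alternating_forms delta_lwedge
        delta_forms delta_prims lwedge_assoc form_products)
  have e3: "frame_d (\<lambda>p. n01 p \<cdot> \<xi> p \<cdot> form_t) p = - (n01 p \<cdot> frame_d \<xi> p \<cdot> form_t)" for p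
  proof -
    have "form_a \<cdot> form_b \<cdot> \<xi> p \<cdot> form_t = form_b \<cdot> \<xi> p \<cdot> form_a \<cdot> form_t"
      using arg_cong[OF even_commute[OF degree_forms(1) of_degree_lwedge[OF degree_forms(2) \<xi>(2)]], of "\<lambda>f. f \<cdot> form_t" p]
      unfolding lwedge_assoc .
    then have "form_a \<cdot> form_b \<cdot> \<xi> p \<cdot> form_t = 0" by (simp add: form_products)
    moreover have "grading_sign (n01 p) = - n01 p"
      using grading_sign_of_degree[OF deg(1)] by (simp add: fun_eq_iff)
    ultimately show ?thesis
      by (simp add: frame_d_lwedge[OF S(1) smooth_form_lwedge[OF S(6,2)]] d d01 lwedge_assoc lwedge_uminus_left)
  qed
  define \<theta> where "\<theta> = (\<lambda>p. scale (-1) (n03 p \<cdot> form_t) + (scale (-1) (\<zeta> p \<cdot> prim_bc \<cdot> form_t) + n01 p \<cdot> \<xi> p \<cdot> form_t))"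
  have "periodic_form \<theta>" unfolding \<theta>_def
    by (intro periodic_form_add periodic_form_scale periodic_form_lwedge[of _ "\<lambda>p. form_t"]
        periodic_form_lwedge[of _ "\<lambda>p. prim_bc \<cdot> form_t"] periodic_form_lwedge[of n01] P n(3) \<zeta>(1) \<xi>(1))
  moreover have "frame_d \<theta> p = prim_ab \<cdot> prim_bc \<cdot> form_t" for p
  proof -
    have "frame_d \<theta> p = - frame_d (\<lambda>p. n03 p \<cdot> form_t) p - frame_d (\<lambda>p. \<zeta> p \<cdot> prim_bc \<cdot> form_t) p +
        frame_d (\<lambda>p. n01 p \<cdot> \<xi> p \<cdot> form_t) p"
    proof -
      note s = smooth_form_lwedge[OF S(4,2)] smooth_form_lwedge[OF S(5,3)]
        smooth_form_lwedge[OF S(1) smooth_form_lwedge[OF S(6,2)]]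
      show ?thesis unfolding \<theta>_def
        by (simp only: frame_d_add frame_d_scale smooth_form_add smooth_form_scale s) (simp add: fun_eq_iff)
    qed
    also have "\<dots> = - ((form_a \<cdot> n13 p - n01 p \<cdot> n23 p + n02 p \<cdot> form_c) \<cdot> form_t) -
        frame_d \<zeta> p \<cdot> prim_bc \<cdot> form_t - n01 p \<cdot> frame_d \<xi> p \<cdot> form_t"
      by (simp add: e1 e2 e3 d03)
    also have "(form_a \<cdot> n13 p - n01 p \<cdot> n23 p + n02 p \<cdot> form_c) \<cdot> form_t =
        n13 p \<cdot> form_a \<cdot> form_t - n01 p \<cdot> n23 p \<cdot> form_t + n02 p \<cdot> form_c \<cdot> form_t"
      by (simp add: lwedge_add_left lwedge_diff_left even_commute[OF degree_forms(1) deg(3)] lwedge_assoc)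
    also have "n01 p \<cdot> n23 p \<cdot> form_t =
        (prim_ab + frame_d \<zeta> p) \<cdot> prim_bc \<cdot> form_t + n01 p \<cdot> frame_d \<xi> p \<cdot> form_t"
      unfolding \<xi>(3)[of p] by (simp add: lwedge_add_left lwedge_add_right \<zeta>(3)[of p])
    finally show ?thesis unfolding form_products lwedge_zero_right lwedge_add_left by simp
  qed
  ultimately show False using no_periodic_volume_primitive by blast
qed

lemma invariant_forms_eq_const:
  "\<gamma>\<^sub>1 \<and>\<^sub>w \<gamma>\<^sub>2 = (\<lambda>p. form_a)" "\<beta>\<^sub>1 \<and>\<^sub>w \<beta>\<^sub>2 = (\<lambda>p. form_b)"
  "\<alpha>\<^sub>1 \<and>\<^sub>w \<gamma>\<^sub>1 + \<alpha>\<^sub>2 \<and>\<^sub>w \<gamma>\<^sub>1 + \<alpha>\<^sub>2 \<and>\<^sub>w \<gamma>\<^sub>2 = (\<lambda>p. form_c)"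
proof -
  have "d_coord c = (\<lambda>p. E c)" for c by (simp add: d_coord_def one_form_def)
  then show "\<gamma>\<^sub>1 \<and>\<^sub>w \<gamma>\<^sub>2 = (\<lambda>p. form_a)" "\<beta>\<^sub>1 \<and>\<^sub>w \<beta>\<^sub>2 = (\<lambda>p. form_b)"
    "\<alpha>\<^sub>1 \<and>\<^sub>w \<gamma>\<^sub>1 + \<alpha>\<^sub>2 \<and>\<^sub>w \<gamma>\<^sub>1 + \<alpha>\<^sub>2 \<and>\<^sub>w \<gamma>\<^sub>2 = (\<lambda>p. form_c)"
    by (simp_all add: wedge_fun form_a_def form_b_def form_c_def) (simp add: plus_fun_def)
qed

lemma hat_forms: "hat (\<lambda>p. form_a) = (\<lambda>p. form_a)" "hat (\<lambda>p. form_b) = (\<lambda>p. form_b)"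
  "hat (\<lambda>p. form_c) = (\<lambda>p. form_c)"
proof -
  have "lpullback (frame p) (E c) = E c" if "c \<notin> {V1, V2}" for p c
    using that by (simp add: lpullback_one_form frame_def axis_def)
  then show "hat (\<lambda>p. form_a) = (\<lambda>p. form_a)" "hat (\<lambda>p. form_b) = (\<lambda>p. form_b)"
    "hat (\<lambda>p. form_c) = (\<lambda>p. form_c)"
    by (simp_all add: hat_def form_a_def form_b_def form_c_def lpullback_lwedge lpullback_linear)
qed

lemma orbifold_simps:
  "mult orbifold_forms = wedge" "zero orbifold_forms = 0"
  "smult orbifold_forms r \<omega> = (\<lambda>p vs. r * \<omega> p vs)" "differential orbifold_forms = ext_derivative"
  by (simp_all add: orbifold_forms_def)

lemma delta_zero: "delta 0 = 0"
  using delta_scale[OF alternating_zero, of 0] by (simp add: zero_fun_def)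

lemma const_cocycle:
  assumes "f \<in> {form_a, form_b, form_c}"
  shows "(\<lambda>p. f) \<in> cocycles orbifold_forms \<inter> hcomp orbifold_forms 2"
proof -
  have f: "hat (\<lambda>p. f) = (\<lambda>p. f)" "alternating f" "lpullback rho f = f" "of_degree 2 f" "delta f = 0"
    using assms hat_forms alternating_forms rho_forms degree_forms delta_forms by auto
  have "hat (ext_derivative (\<lambda>p. f)) = hat 0"
    unfolding hat_ext_derivative f(1) frame_d_const[OF f(2)] f(5) by (simp add: hat_def lpullback_def fun_eq_iff)
  then have "ext_derivative (\<lambda>p. f) = 0" by (simp only: hat_inject)
  then show ?thesis
    by (simp add: cocycles_def carrier_orbifold_forms hcomp_orbifold_forms f orbifold_coefficients_const orbifold_simps)
qed

lemma massey_sum_orbifold: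
  assumes "\<And>k. k \<in> {i..<j} \<Longrightarrow> m i k \<in> carrier orbifold_forms \<and> m (Suc k) j \<in> carrier orbifold_forms"
  shows "hat (massey_sum orbifold_forms ps m i j) p = (\<lambda>vs. \<Sum>k\<in>{i..<j}. (- 1) ^ massey_degree ps i k *
    (hat (m i k) p \<cdot> hat (m (Suc k) j) p) vs)"
proof -
  interpret A: dg_algebra orbifold_forms
    unfolding orbifold_forms_def by (rule orbifold.dg_algebra_F)
  have "massey_sum orbifold_forms ps m i j =
      (\<lambda>p vs. \<Sum>k\<in>{i..<j}. (((- 1) ^ massey_degree ps i k \<odot>\<^bsub>orbifold_forms\<^esub> m i k) \<otimes>\<^bsub>orbifold_forms\<^esub> m (Suc k) j) p vs)"
    unfolding massey_sum_def
    by (rule orbifold.finsum_F[folded orbifold_forms_def]) (use assms in \<open>auto intro!: A.m_closed\<close>)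
  then show ?thesis
    by (simp add: orbifold_simps wedge_fun lwedge_scale_left hat_def lpullback_lwedge[symmetric]) (simp add: lpullback_def)
qed

lemma massey_degree_two: "i \<le> j \<Longrightarrow> j < 4 \<Longrightarrow> massey_degree [2, 2, 2, 2] i j = j - i + 2"
proof -
  assume ij: "i \<le> j" "j < 4"
  have "(\<Sum>l=i..j. [2, 2, 2, 2] ! l) = (\<Sum>l=i..j. 2 :: nat)"
    using ij by (intro sum.cong) (auto simp: nth_Cons' )
  then show ?thesis using ij by (simp add: massey_degree_def)
qed

theorem quadruple_product_nontrivial:
  "massey_nontrivial orbifold_forms [2, 2, 2, 2]
    [cohomology_class orbifold_forms (\<lambda>p. form_a), cohomology_class orbifold_forms (\<lambda>p. form_b),
     cohomology_class orbifold_forms (\<lambda>p. form_b), cohomology_class orbifold_forms (\<lambda>p. form_c)]"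
  (is "massey_nontrivial ?A ?ps ?cs")
proof -
  interpret A: dg_algebra orbifold_forms
    unfolding orbifold_forms_def by (rule orbifold.dg_algebra_F)
  define M where "M i j = (if (i, j) = (0, 0) then form_a else if i = j \<and> j < 3 then form_b
    else if (i, j) = (3, 3) then form_c else if (i, j) = (0, 1) then prim_ab
    else if (i, j) = (2, 3) then prim_bc else 0)" for i j :: nat
  define m where "m i j = unhat (\<lambda>p. M i j)" for i j
  have hat_m: "hat (m i j) = (\<lambda>p. M i j)" for i j by (simp add: m_def)
  have mc: "alternating (M i j)" "lpullback rho (M i j) = M i j" for i j
  proof -
    have "lpullback rho (0 :: pt list \<Rightarrow> real) = 0" by (simp add: lpullback_def fun_eq_iff)
    then show "alternating (M i j)" "lpullback rho (M i j) = M i j"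
      by (simp_all add: M_def alternating_forms rho_forms)
  qed
  have m_carrier: "m i j \<in> carrier ?A" for i j
    by (simp add: carrier_orbifold_forms hat_m orbifold_coefficients_const mc)
  have system: "defining_system ?A ?ps ?cs m"
    unfolding defining_system_def
  proof (intro conjI allI impI)
    fix i assume "i < length ?cs"
    have "m 0 0 = (\<lambda>p. form_a)" "m 1 1 = (\<lambda>p. form_b)" "m 2 2 = (\<lambda>p. form_b)" "m 3 3 = (\<lambda>p. form_c)"
      unfolding m_def M_def using hat_forms[THEN arg_cong, of unhat] by simp_all
    moreover have "i \<in> {0, 1, 2, 3}" using \<open>i < length ?cs\<close> by auto
    ultimately show "cohomology_class ?A (m i i) = ?cs ! i"
      by (auto simp: eval_nat_numeral)
  next
    fix i j assume "i \<le> j \<and> j < length ?cs \<and> (i, j) \<noteq> (0, length ?cs - 1)"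
    then have ij: "i \<le> j" "j < 4" "(i, j) \<noteq> (0, 3)" by auto
    then have cases: "(i, j) \<in> {(0,0), (1,1), (2,2), (3,3), (0,1), (1,2), (2,3), (0,2), (1,3)}"
    proof -
      have "i = 0 \<or> i = 1 \<or> i = 2 \<or> i = 3" "j = 0 \<or> j = 1 \<or> j = 2 \<or> j = 3" using ij(1,2) by linarith+
      then show ?thesis using ij by (elim disjE; simp)
    qed
    have deg: "massey_degree ?ps i k = k - i + 2" if "k \<in> {i..<j}" for k
      using that ij by (intro massey_degree_two) auto
    have "of_degree (j - i + 2) (M i j)"
      using cases degree_forms by (auto simp: M_def of_degree_def)
    then have "m i j \<in> hcomp ?A (massey_degree ?ps i j)"
      using ij by (simp add: massey_degree_two hcomp_orbifold_forms hat_m orbifold_coefficients_const mc)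
    moreover have "j - i \<le> (\<Sum>l=i..j. ?ps ! l)"
      using massey_degree_two[OF ij(1,2)] unfolding massey_degree_def by linarith
    ultimately show "m i j \<in> massey_component ?A ?ps i j" by (simp add: massey_component_def)
    have "delta (M i j) vs = (\<Sum>k\<in>{i..<j}. (- 1) ^ (k - i + 2) * (M i k \<cdot> M (Suc k) j) vs)" for vs
      using cases by (elim insertE emptyE; clarsimp simp: M_def delta_zero delta_forms delta_prims form_products
          eval_nat_numeral)
    then have "hat (differential ?A (m i j)) = hat (massey_sum ?A ?ps m i j)"
      by (intro ext) (simp add: orbifold_simps hat_ext_derivative hat_m frame_d_const mc
          massey_sum_orbifold m_carrier deg)
    then show "differential ?A (m i j) = massey_sum ?A ?ps m i j" by (simp add: hat_inject)
  qed
  have "massey_defined ?A ?ps ?cs"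
    unfolding massey_defined_def by (intro conjI exI[of _ m] system) simp_all
  moreover have "\<zero>\<^bsub>cohomology ?A\<^esub> \<notin> massey_product ?A ?ps ?cs"
  proof
    assume zero: "\<zero>\<^bsub>cohomology ?A\<^esub> \<in> massey_product ?A ?ps ?cs"
    define x where "x = (!) [\<lambda>p :: pt. form_a, \<lambda>p. form_b, \<lambda>p. form_b, \<lambda>p. form_c]"
    have lt4: "i \<in> {0, 1, 2, 3}" if "i < 4" for i :: nat using that by auto
    have x: "x i \<in> cocycles ?A \<inter> hcomp ?A (?ps ! i)" if "i < 4" for i
      using lt4[OF that] by (elim insertE emptyE; simp add: x_def const_cocycle del: Int_iff)
    obtain n where n: "full_defining_system ?A ?ps 4 n" "\<And>i. i < 4 \<Longrightarrow> n i i = x i"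
    proof (rule A.full_defining_system_of_trivial_product[of ?cs 4 ?ps x])
      show "1 \<le> ?ps ! l" if "l < 4" for l using lt4[OF that] by (auto simp: eval_nat_numeral)
      show "?cs ! i = cohomology_class ?A (x i)" if "i < 4" for i
        using lt4[OF that] by (auto simp: x_def eval_nat_numeral)
    qed (use x zero in auto)
    have nh: "orbifold_coefficients (hat (n i j))" "of_degree (j - i + 2) (hat (n i j) p)" and
      nc: "n i j \<in> carrier ?A" if "i \<le> j" "j < 4" for i j p
    proof -
      have "n i j \<in> hcomp ?A (massey_degree ?ps i j)"
        using n(1) that unfolding full_defining_system_def by blast
      then show "orbifold_coefficients (hat (n i j))" "of_degree (j - i + 2) (hat (n i j) p)"
        "n i j \<in> carrier ?A"
        unfolding massey_degree_two[OF that] hcomp_orbifold_forms carrier_orbifold_forms by blast+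
    qed
    have dn: "frame_d (hat (n i j)) p vs = (\<Sum>k\<in>{i..<j}. (- 1) ^ (k - i + 2) *
        (hat (n i k) p \<cdot> hat (n (Suc k) j) p) vs)" if "i \<le> j" "j < 4" for i j p vs
    proof -
      have "ext_derivative (n i j) = massey_sum ?A ?ps n i j"
        using n(1) that by (simp add: full_defining_system_def orbifold_simps)
      then have "frame_d (hat (n i j)) p vs = hat (massey_sum ?A ?ps n i j) p vs"
        by (simp flip: hat_ext_derivative)
      also have "\<dots> = (\<Sum>k\<in>{i..<j}. (- 1) ^ massey_degree ?ps i k * (hat (n i k) p \<cdot> hat (n (Suc k) j) p) vs)"
        using nc that by (subst massey_sum_orbifold) auto
      finally show ?thesis using that by (simp add: massey_degree_two)
    qed
    have diag: "hat (n 0 0) = (\<lambda>p. form_a)" "hat (n 1 1) = (\<lambda>p. form_b)" "hat (n 2 2) = (\<lambda>p. form_b)"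
      "hat (n 3 3) = (\<lambda>p. form_c)" using n(2) hat_forms by (simp_all add: x_def)
    show False
    proof (rule no_corner)
      show "orbifold_coefficients (hat (n 0 1))" "orbifold_coefficients (hat (n 2 3))" by (simp_all add: nh)
      show "periodic_form (hat (n 0 3))" using nh(1)[of 0 3] by (simp add: orbifold_coefficients_def)
      show "of_degree 3 (hat (n 0 1) p)" "of_degree 3 (hat (n 2 3) p)" "of_degree 4 (hat (n 1 3) p)" for p
        using nh(2)[of 0 1 p] nh(2)[of 2 3 p] nh(2)[of 1 3 p] by (simp_all add: eval_nat_numeral)
      show "frame_d (hat (n 0 1)) = (\<lambda>p. form_a \<cdot> form_b)"
        by (intro ext) (use diag in \<open>simp add: dn\<close>)
      show "frame_d (hat (n 2 3)) = (\<lambda>p. form_b \<cdot> form_c)"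
        by (intro ext) (use diag in \<open>simp add: dn eval_nat_numeral\<close>)
      show "frame_d (hat (n 0 3)) p = form_a \<cdot> hat (n 1 3) p - hat (n 0 1) p \<cdot> hat (n 2 3) p +
          hat (n 0 2) p \<cdot> form_c" for p
        by (intro ext) (use diag in \<open>simp add: dn eval_nat_numeral\<close>)
    qed
  qed
  ultimately show ?thesis by (simp add: massey_nontrivial_def)
qed

theorem proposition8:
  shows "{\<gamma>\<^sub>1 \<and>\<^sub>w \<gamma>\<^sub>2, \<beta>\<^sub>1 \<and>\<^sub>w \<beta>\<^sub>2, \<alpha>\<^sub>1 \<and>\<^sub>w \<gamma>\<^sub>1 + \<alpha>\<^sub>2 \<and>\<^sub>w \<gamma>\<^sub>1 + \<alpha>\<^sub>2 \<and>\<^sub>w \<gamma>\<^sub>2}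
           \<subseteq> cocycles orbifold_forms \<inter> hcomp orbifold_forms 2 \<and>
         massey_nontrivial orbifold_forms [2, 2, 2, 2]
           [cohomology_class orbifold_forms (\<gamma>\<^sub>1 \<and>\<^sub>w \<gamma>\<^sub>2),
            cohomology_class orbifold_forms (\<beta>\<^sub>1 \<and>\<^sub>w \<beta>\<^sub>2),
            cohomology_class orbifold_forms (\<beta>\<^sub>1 \<and>\<^sub>w \<beta>\<^sub>2),
            cohomology_class orbifold_forms (\<alpha>\<^sub>1 \<and>\<^sub>w \<gamma>\<^sub>1 + \<alpha>\<^sub>2 \<and>\<^sub>w \<gamma>\<^sub>1 + \<alpha>\<^sub>2 \<and>\<^sub>w \<gamma>\<^sub>2)] \<and>
         \<not> formal TYPE('c) orbifold_forms"
proof -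
  interpret A: dg_algebra orbifold_forms
    unfolding orbifold_forms_def by (rule orbifold.dg_algebra_F)
  let ?xs = "[\<lambda>p :: pt. form_a, \<lambda>p. form_b, \<lambda>p. form_b, \<lambda>p. form_c]"
  have "\<not> formal TYPE('c) orbifold_forms"
  proof
    assume "formal TYPE('c) orbifold_forms"
    then have "\<not> massey_nontrivial orbifold_forms [2, 2, 2, 2] (map (cohomology_class orbifold_forms) ?xs)"
    proof (rule A.formal_imp_massey_product_trivial[where x = "(!) ?xs"])
      fix i assume "i < length (map (cohomology_class orbifold_forms) ?xs)"
      then have "i < length ?xs" "i = 0 \<or> i = 1 \<or> i = 2 \<or> i = 3" by (simp, simp, linarith)
      then show "?xs ! i \<in> cocycles orbifold_forms \<inter> hcomp orbifold_forms ([2, 2, 2, 2] ! i)"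
        by (elim disjE; simp add: const_cocycle del: Int_iff)
    qed (simp_all only: length_map nth_map, simp)
    with quadruple_product_nontrivial show False by simp
  qed
  with quadruple_product_nontrivial const_cocycle show ?thesis
    unfolding invariant_forms_eq_const by simp
qed
end
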